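(* $\mathrm{MC}(\cup,\cap,\overline{\phantom{c}},+,/) \in \mathrm{PSPACE}$.
   Context: Natural numbers include $0$. For $A,B\subseteq\mathbb N$: $A\cup B$, $A\cap B$ are the usual operations, $\overline{A}=\mathbb N\setminus A$, $A+B=\{a+b: a\in A, b\in B\}$, $A\times B=\{a\cdot b: a\in A, b\in B\}$, and $A/B=\{c\in\mathbb N:\exists a\in A\ \exists b\in B\setminus\{0\}: a=c\cdot b\}$ (exact integer division without remainder or rounding). For $\emptyset\ne\mathcal O\subseteq\{\cup,\cap,\overline{\phantom{c}},+,\times,/\}$, an $\mathcal O$-circuit $C=(V,E,g_C,\alpha)$ is a finite acyclic directed multigraph with gate set $V\subseteq\mathbb N$, every gate having indegree $0$, $1$ or $2$, a designated output gate $g_C\in V$, and a labeling $\alpha$: gates of indegree $0$ (input gates) are labeled by natural numbers, gates of indegree $1$ are labeled $\overline{\phantom{c}}$ (allowed only if $\overline{\phantom{c}}\in\mathcal O$), and gates of indegree $2$ are labeled by an operation in $\mathcal O\setminus\{\overline{\phantom{c}}\}$. The result set $I(g)\subseteq\mathbb N$ is defined inductively: $I(g)=\{\alpha(g)\}$ for an input gate; $I(g)=\mathbb N\setminus I(p)$ for a complement gate with predecessor $p$; $I(g)=I(g_1)\,\sigma\,I(g_2)$ for a gate labeled $\sigma$ with predecessors $g_1\le g_2$ (a double edge from one gate gives $g_1=g_2$). $I(C)=I(g_C)$. A circuit is encoded as a bit string listing its gates in reverse topological order, each gate as the triple (gate name, label, list of predecessors), with all numbers (including input labels) in binary; $|C|$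 denotes the length of this encoding. The membership problem is $\mathrm{MC}(\mathcal O)=\{(C,b): C \text{ is an } \mathcal O\text{-circuit},\ b\in\mathbb N,\ b\in I(C)\}$, with $b$ given in binary; $\mathrm{MC}(\sigma_1,\dots,\sigma_n)$ abbreviates $\mathrm{MC}(\{\sigma_1,\dots,\sigma_n\})$. *)

theory Defs
  imports Main
begin

definition set_plus :: "nat set \<Rightarrow> nat set \<Rightarrow> nat set" where
  "set_plus A B = {a + b | a b. a \<in> A \<and> b \<in> B}"

definition set_times :: "nat set \<Rightarrow> nat set \<Rightarrow> nat set" where
  "set_times A B = {a * b | a b. a \<in> A \<and> b \<in> B}"

definition set_div :: "nat set \<Rightarrow> nat set \<Rightarrow> nat set" where
  "set_div A B = {c. \<exists>a\<in>A. \<exists>b\<in>B - {0}. a = c * b}"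

datatype op = Union | Inter | Compl | Plus | Times | Div

datatype glabel = Input nat | Oper op

type_synonym gate = "nat \<times> glabel \<times> nat list"

text \<open>A circuit: output gate and the list of its gates in reverse topological
  order (every gate is listed before all of its predecessors).\<close>
type_synonym circuit = "nat \<times> gate list"

fun apply_bin :: "op \<Rightarrow> nat set \<Rightarrow> nat set \<Rightarrow> nat set" where
  "apply_bin Union A B = A \<union> B"
| "apply_bin Inter A B = A \<inter> B"
| "apply_bin Plus A B = set_plus A B"
| "apply_bin Times A B = set_times A B"
| "apply_bin Div A B = set_div A B"
| "apply_bin Compl A B = {}"

fun gate_ok :: "op set \<Rightarrow> glabel \<Rightarrow> nat list \<Rightarrow> bool" where
  "gate_ok Ops (Input n) ps = (ps = [])"
| "gate_ok Ops (Oper Compl) ps = (Compl \<in> Ops \<and> length ps = 1)"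
| "gate_ok Ops (Oper s) ps = (s \<in> Ops \<and> length ps = 2)"

definition gname :: "gate \<Rightarrow> nat" where "gname g = fst g"
definition glab :: "gate \<Rightarrow> glabel" where "glab g = fst (snd g)"
definition gpreds :: "gate \<Rightarrow> nat list" where "gpreds g = snd (snd g)"

definition is_circuit :: "op set \<Rightarrow> circuit \<Rightarrow> bool" where
  "is_circuit Ops C \<longleftrightarrow>
     Ops \<noteq> {} \<and>
     distinct (map gname (snd C)) \<and>
     fst C \<in> set (map gname (snd C)) \<and>
     (\<forall>i < length (snd C).
        gate_ok Ops (glab (snd C ! i)) (gpreds (snd C ! i)) \<and>
        (\<forall>p \<in> set (gpreds (snd C ! i)).
           \<exists>j. i < j \<and> j < length (snd C) \<and> gname (snd C ! j) = p))"

text \<open>Value of a gate given the values of (later-listed) gates.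
  For a binary gate with predecessors g1 \<le> g2 the result is I(g1) op I(g2).\<close>
fun gate_val :: "gate \<Rightarrow> (nat \<Rightarrow> nat set) \<Rightarrow> nat set" where
  "gate_val (n, Input a, ps) f = {a}"
| "gate_val (n, Oper Compl, ps) f = - f (hd ps)"
| "gate_val (n, Oper s, ps) f =
     apply_bin s (f (min (ps ! 0) (ps ! 1))) (f (max (ps ! 0) (ps ! 1)))"

fun gate_sem :: "gate list \<Rightarrow> nat \<Rightarrow> nat set" where
  "gate_sem [] = (\<lambda>_. {})"
| "gate_sem (g # gs) = (let f = gate_sem gs in f (gname g := gate_val g f))"

definition circuit_sem :: "circuit \<Rightarrow> nat set" where
  "circuit_sem C = gate_sem (snd C) (fst C)"

datatype sym = B0 | B1 | LPar | RPar | Comma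
  | SUnion | SInter | SCompl | SPlus | STimes | SDiv

fun bin :: "nat \<Rightarrow> sym list" where
  "bin n = (if n < 2 then [if n = 0 then B0 else B1]
            else bin (n div 2) @ [if n mod 2 = 0 then B0 else B1])"

fun enc_op :: "op \<Rightarrow> sym" where
  "enc_op Union = SUnion" | "enc_op Inter = SInter" | "enc_op Compl = SCompl"
| "enc_op Plus = SPlus" | "enc_op Times = STimes" | "enc_op Div = SDiv"

fun enc_label :: "glabel \<Rightarrow> sym list" where
  "enc_label (Input n) = bin n"
| "enc_label (Oper s) = [enc_op s]"

fun enc_list :: "nat list \<Rightarrow> sym list" where
  "enc_list [] = []"
| "enc_list [p] = bin p"
| "enc_list (p # ps) = bin p @ [Comma] @ enc_list ps"

definition enc_gate :: "gate \<Rightarrow> sym list" where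
  "enc_gate g = [LPar] @ bin (gname g) @ [Comma] @ enc_label (glab g) @ [Comma]
                @ [LPar] @ enc_list (gpreds g) @ [RPar, RPar]"

definition enc_instance :: "circuit \<Rightarrow> nat \<Rightarrow> sym list" where
  "enc_instance C b = [LPar] @ bin (fst C) @ [Comma] @ concat (map enc_gate (snd C))
                      @ [Comma] @ bin b @ [RPar]"

definition MC :: "op set \<Rightarrow> sym list set" where
  "MC Ops = {enc_instance C b | C b. is_circuit Ops C \<and> b \<in> circuit_sem C}"

text \<open>A single-tape deterministic Turing machine: states 0..<nQ (0 start,
  1 accept, 2 reject), tape symbols 0..<nS (0 blank), transition function
  delta q a = (q', a', d) with move d in {-1,0,1}.\<close>
record tm =
  nQ :: nat
  nS :: nat
  delta :: "nat \<Rightarrow> nat \<Rightarrow> nat \<times> nat \<times> int"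

fun sym_code :: "sym \<Rightarrow> nat" where
  "sym_code B0 = 1" | "sym_code B1 = 2" | "sym_code LPar = 3" | "sym_code RPar = 4"
| "sym_code Comma = 5" | "sym_code SUnion = 6" | "sym_code SInter = 7"
| "sym_code SCompl = 8" | "sym_code SPlus = 9" | "sym_code STimes = 10"
| "sym_code SDiv = 11"

definition valid_tm :: "tm \<Rightarrow> bool" where
  "valid_tm M \<longleftrightarrow> nQ M \<ge> 3 \<and> nS M \<ge> 12 \<and>
     (\<forall>q < nQ M. \<forall>a < nS M. case delta M q a of (q', a', d) \<Rightarrow>
        q' < nQ M \<and> a' < nS M \<and> d \<in> {-1, 0, 1})"

type_synonym config = "nat \<times> (int \<Rightarrow> nat) \<times> int"

definition init_config :: "sym list \<Rightarrow> config" where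
  "init_config w = (0, (\<lambda>i. if 0 \<le> i \<and> i < int (length w)
                            then sym_code (w ! nat i) else 0), 0)"

definition tm_step :: "tm \<Rightarrow> config \<Rightarrow> config" where
  "tm_step M c = (case c of (q, t, h) \<Rightarrow>
     if q = 1 \<or> q = 2 then c
     else (case delta M q (t h) of (q', a, d) \<Rightarrow> (q', t(h := a), h + d)))"

definition run :: "tm \<Rightarrow> sym list \<Rightarrow> nat \<Rightarrow> config" where
  "run M w n = (tm_step M ^^ n) (init_config w)"

definition PSPACE :: "sym list set set" where
  "PSPACE = {L. \<exists>M c. valid_tm M \<and>
     (\<forall>w. (\<exists>n. fst (run M w n) \<in> {1, 2}) \<and>
          (w \<in> L \<longleftrightarrow> (\<exists>n. fst (run M w n) = 1)) \<and>
          (\<forall>n. \<bar>snd (snd (run M w n))\<bar> \<le> int ((length w + 2) ^ c)))}"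

end

theory Submission
  imports Defs
begin

text \<open>
  Without multiplication, every gate of a circuit with \<open>m\<close> gates and inputs below \<open>T\<close> computes a set
  that is constant from \<open>T * 2 ^ m\<close> on: addition doubles such a threshold, the other operations
  preserve it. Hence the quantifiers hidden in \<open>+\<close> and \<open>/\<close> can be restricted to numbers of
  polynomial length, and \<open>x \<in> I(g)\<close> turns into the question who wins a game of polynomially many moves,
  which is answered by a depth-first search storing one path. The syntax check needs no parser:
  guess a circuit in a convenient numerical format and compare its encoding with the input.

  To arrive at a Turing machine, everything is expressed by functions on natural numbers that are
  computable by register programs whose registers stay below \<open>2 ^ p(l)\<close>, for a polynomial \<open>p\<close>, when
  the arguments are below \<open>2 ^ l\<close>. Time being irrelevant, programs only need to increment, to
  decrement and to loop while a register is nonzero, and a Turing machine executes them by sweeping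
  over a tape that holds the digits of all registers in parallel.
\<close>

subsection \<open>Register programs\<close>

text \<open>Leaving out multiplication is what makes thresholds possible: the product of {2} and the
  set of all numbers is the set of even numbers, constant from no point on. A large sum has a
  summand above the threshold, which can absorb any change; and if x has reached the threshold of
  the numerator set, so has x * b for every divisor b, hence membership of x no longer depends on x.
  Inputs of n bits and at most n gates thus give thresholds of about 2n bits. Complements make the
  quantifiers alternate from gate to gate, so guessing witnesses is not enough; hence a game.
  Storing the set of a gate up to its threshold would take exponential space, so every membership
  query is answered afresh along its path. On the machine side one closure property carries
  everything: recursion whose number of rounds may be exponential, as long as all intermediate
  values have polynomial length. Arithmetic, exhaustive search and the game are instances of
  it.\<close>

datatype com = Inc nat | Dec nat | Seq com com (infixr ";;" 60) | While nat com

text \<open>Only \<open>exec_Inc\<close> checks the bound, since no other command enlarges a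
  register. As a big-step relation it certifies termination and the space bound at once.\<close>

inductive exec :: "nat \<Rightarrow> com \<Rightarrow> (nat \<Rightarrow> nat) \<Rightarrow> (nat \<Rightarrow> nat) \<Rightarrow> bool" for N where
  exec_Inc: "Suc (s r) \<le> N \<Longrightarrow> exec N (Inc r) s (s(r := Suc (s r)))"
| exec_Dec: "exec N (Dec r) s (s(r := s r - 1))"
| exec_Seq: "exec N p s s' \<Longrightarrow> exec N q s' s'' \<Longrightarrow> exec N (p ;; q) s s''"
| exec_WhileF: "s r = 0 \<Longrightarrow> exec N (While r p) s s"
| exec_WhileT: "0 < s r \<Longrightarrow> exec N p s s' \<Longrightarrow> exec N (While r p) s' s'' \<Longrightarrow> exec N (While r p) s s''"

fun regs :: "com \<Rightarrow> nat" where
  "regs (Inc r) = Suc r"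
| "regs (Dec r) = Suc r"
| "regs (p ;; q) = max (regs p) (regs q)"
| "regs (While r p) = max (Suc r) (regs p)"

datatype instr = IInc nat | IDec nat | IJz nat nat | IJmp nat | IHalt bool

fun csize :: "com \<Rightarrow> nat" where
  "csize (Inc r) = 1"
| "csize (Dec r) = 1"
| "csize (p ;; q) = csize p + csize q"
| "csize (While r p) = csize p + 2"

text \<open>\<open>b\<close> is the address at which the code will be placed, so jump targets are
  absolute. A loop costs two extra instructions: the test at its head and the jump back.\<close>

fun flat :: "nat \<Rightarrow> com \<Rightarrow> instr list" where
  "flat b (Inc r) = [IInc r]"
| "flat b (Dec r) = [IDec r]"
| "flat b (p ;; q) = flat b p @ flat (b + csize p) q"
| "flat b (While r p) = IJz r (b + csize p + 2) # flat (Suc b) p @ [IJmp b]"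

lemma length_flat [simp]: "length (flat b p) = csize p"
  by (induction p arbitrary: b) auto

subsection \<open>Simulating register programs by a Turing machine\<close>

text \<open>A tape cell \<open>\<Sum>\<^sub>j d\<^sub>j * 12 ^ j\<close> holds one base-12 digit of each register, so that
  the initial tape already stores a number in register 0. The used part of the tape is
  delimited by the markers \<open>12 ^ k\<close> (at position \<open>-1\<close>) and \<open>12 ^ k + 1\<close>.\<close>

definition digit :: "nat \<Rightarrow> nat \<Rightarrow> nat" where
  "digit j a = a div 12 ^ j mod 12"

fun reg :: "nat \<Rightarrow> nat list \<Rightarrow> nat" where
  "reg j [] = 0"
| "reg j (a # xs) = digit j a + 12 * reg j xs"

text \<open>The offset 4 skips the start, accept and reject states and state 3 of the initial
  pass.\<close>

definition state :: "nat \<Rightarrow> nat \<Rightarrow> nat" where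
  "state pc ph = 4 + (5 * pc + ph)"

text \<open>The sweep starts at the least significant digits, so carries and borrows travel right
  with the head. Meeting the right marker signals overflow for \<open>IInc\<close>, underflow for
  \<open>IDec\<close>, and value zero for \<open>IJz\<close>.\<close>

fun exec_delta :: "nat \<Rightarrow> instr \<Rightarrow> nat \<Rightarrow> nat \<Rightarrow> nat \<times> nat \<times> int" where
  "exec_delta k (IInc r) pc a =
     (if a = 12 ^ k + 1 then (state pc 1, 12 ^ r, 1)
      else if digit r a = 11 then (state pc 0, a - 11 * 12 ^ r, 1)
      else (state pc 2, a + 12 ^ r, 0))"
| "exec_delta k (IDec r) pc a =
     (if a = 12 ^ k + 1 then (state pc 4, a, -1)
      else if digit r a = 0 then (state pc 0, a + 11 * 12 ^ r, 1)
      else (state pc 2, a - 12 ^ r, 0))"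
| "exec_delta k (IJz r l) pc a =
     (if a = 12 ^ k + 1 then (state pc 3, a, 0)
      else if digit r a = 0 then (state pc 0, a, 1)
      else (state pc 2, a, 0))"
| "exec_delta k (IJmp l) pc a = (state l 0, a, 0)"
| "exec_delta k (IHalt b) pc a = (if b then 1 else 2, a, 0)"

fun jump :: "instr \<Rightarrow> nat" where
  "jump (IJz r l) = l"
| "jump _ = 0"

fun ireg :: "instr \<Rightarrow> nat" where
  "ireg (IDec r) = r"
| "ireg _ = 0"

text \<open>States 0 and 3 write the markers. Instruction \<open>pc\<close> is executed in the states \<open>state pc ph\<close>:
  phase 0 sweeps to the right, 1 rewrites the right marker after an overflow, 2 and 3 return to the
  left marker and continue with the next instruction or the jump target, and 4 returns while
  clearing a register.\<close>

definition raw_delta :: "nat \<Rightarrow> instr list \<Rightarrow> nat \<Rightarrow> nat \<Rightarrow> nat \<times> nat \<times> int" where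
  "raw_delta k prog q a =
     (if q = 0 then (if a = 0 then (3, 12 ^ k + 1, -1) else (0, a, 1))
      else if q = 3 then (if a = 0 then (state 0 0, 12 ^ k, 1) else (3, a, -1))
      else let pc = (q - 4) div 5; ph = (q - 4) mod 5 in
        if ph = 0 then exec_delta k (prog ! pc) pc a
        else if ph = 1 then (state pc 2, 12 ^ k + 1, 0)
        else if ph = 2 then (if a = 12 ^ k then (state (Suc pc) 0, a, 1) else (state pc 2, a, -1))
        else if ph = 3 then (if a = 12 ^ k then (state (jump (prog ! pc)) 0, a, 1) else (state pc 3, a, -1))
        else (if a = 12 ^ k then (state (Suc pc) 0, a, 1)
              else if a = 12 ^ k + 1 then (state pc 4, a, -1)
              else (state pc 4, a - digit (ireg (prog ! pc)) a * 12 ^ ireg (prog ! pc), -1)))"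

text \<open>The test of the produced transition only makes the machine valid by construction.\<close>

definition mach :: "nat \<Rightarrow> instr list \<Rightarrow> tm" where
  "mach k prog = \<lparr>nQ = state (length prog) 0, nS = 12 ^ k + 2,
     delta = \<lambda>q a. case raw_delta k prog q a of (q', a', d) \<Rightarrow>
       if q' < state (length prog) 0 \<and> a' < 12 ^ k + 2 \<and> d \<in> {-1, 0, 1} then (q', a', d)
       else (2, 0, 0)\<rparr>"

lemma valid_mach:
  assumes "0 < k"
  shows "valid_tm (mach k prog)"
proof -
  \<comment> \<open>\<open>valid_tm\<close> demands 12 symbols, the blank and the input codes 1 to
    11; one register already provides them.\<close>
  have "(12::nat) ^ 1 \<le> 12 ^ k"
    using assms by (intro power_increasing) auto
  then show ?thesis
    by (auto simp: valid_tm_def mach_def state_def Let_def split: prod.splits)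
qed

section \<open>Base-12 digits under addition and subtraction\<close>

lemma digit_add:
  assumes "digit r a + x < 12"
  shows "digit r (a + x * 12 ^ r) = digit r a + x"
proof -
  have "(a + x * 12 ^ r) div 12 ^ r = a div 12 ^ r + x"
    by simp
  then show ?thesis
    using assms unfolding digit_def by (metis mod_add_left_eq mod_less)
qed

text \<open>Below position \<open>r\<close> the added term is a multiple of
  \<open>12 ^ Suc j\<close>; above it nothing changes because digit \<open>r\<close> produces no
  carry.\<close>

lemma digit_add_other:
  assumes "digit r a + x < 12" "j \<noteq> r"
  shows "digit j (a + x * 12 ^ r) = digit j a"
proof (cases "j < r")
  case True
  then obtain e where r: "r = Suc (j + e)"
    using less_imp_Suc_add by blast
  have "a + x * 12 ^ r = a + (12 * (x * 12 ^ e)) * 12 ^ j"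
    by (simp add: r power_add)
  moreover have "(a + z * 12 ^ j) div 12 ^ j = a div 12 ^ j + z" for z
    by simp
  ultimately have "(a + x * 12 ^ r) div 12 ^ j = a div 12 ^ j + 12 * (x * 12 ^ e)"
    by (simp only:)
  then show ?thesis
    by (simp add: digit_def)
next
  case False
  with assms(2) obtain e where j: "j = Suc (r + e)"
    by (metis less_imp_Suc_add linorder_neqE_nat)
  have *: "b div 12 ^ j = b div 12 ^ r div 12 div 12 ^ e" for b :: nat
    by (simp add: j power_add div_mult2_eq[symmetric] mult.commute mult.left_commute)
  have "(q + x) div 12 = q div 12" if "q mod 12 + x < 12" for q
  proof -
    have "q + x = (q mod 12 + x) + 12 * (q div 12)"
      by simp
    then have "(q + x) div 12 = ((q mod 12 + x) + 12 * (q div 12)) div 12"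
      by presburger
    then show ?thesis
      using that by (simp only: div_mult_self2)
  qed
  moreover have **: "(a + x * 12 ^ r) div 12 ^ r = a div 12 ^ r + x"
    by simp
  ultimately have "(a div 12 ^ r + x) div 12 = a div 12 ^ r div 12"
    using assms(1) by (metis digit_def)
  then show ?thesis
    unfolding digit_def * by (simp only: div_mult_self3 **)
qed

text \<open>Turns a subtraction into an addition to the difference \<open>b\<close>, so that the
  facts about addition also serve decrements.\<close>

lemma digit_sub:
  assumes "x \<le> digit r a"
  obtains b where "a = b + x * 12 ^ r" "digit r b + x = digit r a" "digit r b + x < 12"
proof -
  let ?b = "a - x * 12 ^ r"
  have "x \<le> a div 12 ^ r"
    using assms unfolding digit_def by (metis le_trans mod_less_eq_dividend)
  then have "x * 12 ^ r \<le> a"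
    by (meson div_le_dividend le_trans mult_le_mono1 times_div_less_eq_dividend
        div_times_less_eq_dividend)
  then have a: "a = ?b + x * 12 ^ r"
    by simp
  then have "a div 12 ^ r = ?b div 12 ^ r + x"
    by (metis add.commute div_mult_self3 power_not_zero zero_neq_numeral)
  moreover have "q' mod 12 + x = q mod 12" if "q = q' + x" "x \<le> q mod 12" for q q'
  proof -
    have "q' = (q mod 12 - x) + 12 * (q div 12)"
      using that mult_div_mod_eq[of 12 q] by linarith
    then have "q' mod 12 = ((q mod 12 - x) + 12 * (q div 12)) mod 12"
      by (rule arg_cong)
    moreover have "q mod 12 - x < 12"
      by (simp add: less_imp_diff_less)
    ultimately have "q' mod 12 = q mod 12 - x"
      by (simp only: mod_mult_self2 mod_less)
    then show ?thesis
      using that(2) by linarith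
  qed
  ultimately have "digit r ?b + x = digit r a"
    using assms unfolding digit_def by metis
  moreover have "digit r a < 12"
    by (simp add: digit_def)
  ultimately show thesis
    using that a by metis
qed

lemma digit_bound:
  assumes "a < 12 ^ k" "r < k" "digit r a + x < 12"
  shows "a + x * 12 ^ r < 12 ^ k"
proof -
  obtain e where k: "k = Suc (r + e)"
    using assms(2) less_imp_Suc_add by blast
  let ?q = "a div 12 ^ r"
  have "?q < 12 * 12 ^ e"
    using assms(1) by (simp add: k power_add less_mult_imp_div_less mult.commute mult.left_commute)
  then have "?q div 12 < 12 ^ e"
    by (simp add: less_mult_imp_div_less mult.commute)
  moreover have "q + x < 12 * z" if "q div 12 < z" "q mod 12 + x < 12" for q z
    using that mult_div_mod_eq[of 12 q] by linarith
  ultimately have "?q + x < 12 * 12 ^ e"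
    using assms(3) unfolding digit_def by metis
  then have "Suc (?q + x) * 12 ^ r \<le> 12 * 12 ^ e * 12 ^ r"
    by (intro mult_right_mono) auto
  moreover have "a < Suc ?q * 12 ^ r"
    using dividend_less_div_times[of "12 ^ r" a] by simp
  ultimately show ?thesis
    by (simp add: k power_add algebra_simps)
qed

lemma digit_power: "digit r (12 ^ j) = (if r = j then 1 else 0)"
proof -
  have "digit j 0 + 1 < 12" "digit r 0 = 0" "digit j 0 = 0"
    by (auto simp: digit_def)
  then show ?thesis
    using digit_add[of j 0 1] digit_add_other[of j 0 1 r] by auto
qed

section \<open>Tape segments and space-bounded reachability\<close>

fun seg :: "(int \<Rightarrow> nat) \<Rightarrow> int \<Rightarrow> nat list \<Rightarrow> bool" where
  "seg t p [] = True"
| "seg t p (a # xs) = (t p = a \<and> seg t (p + 1) xs)"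

lemma seg_append [simp]: "seg t p (xs @ ys) = (seg t p xs \<and> seg t (p + int (length xs)) ys)"
  by (induction xs arbitrary: p) (auto simp: algebra_simps)

lemma seg_upd [simp]: "q < p \<Longrightarrow> seg (t(q := b)) p xs = seg t p xs"
  by (induction xs arbitrary: p) auto

lemma seg_nth: "seg t p xs \<longleftrightarrow> (\<forall>i < length xs. t (p + int i) = xs ! i)"
proof (induction xs arbitrary: p)
  case (Cons a xs)
  show ?case
    by (auto simp: Cons nth_Cons algebra_simps All_less_Suc2 split: nat.splits)
qed simp

text \<open>With the head bound built into each step, runs are chained by transitivity without
  counting steps, and all intermediate configurations stay bounded.\<close>

definition bstep :: "tm \<Rightarrow> nat \<Rightarrow> config \<Rightarrow> config \<Rightarrow> bool" where
  "bstep M H c c' \<longleftrightarrow> tm_step M c = c' \<and> \<bar>snd (snd c)\<bar> \<le> int H \<and> \<bar>snd (snd c')\<bar> \<le> int H"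

lemma bstep_funpow:
  assumes "(bstep M H)\<^sup>*\<^sup>* c c'" "\<bar>snd (snd c)\<bar> \<le> int H"
  shows "\<exists>n. (tm_step M ^^ n) c = c' \<and> (\<forall>m\<le>n. \<bar>snd (snd ((tm_step M ^^ m) c))\<bar> \<le> int H)"
  using assms
proof (induction rule: rtranclp_induct)
  case base
  then show ?case
    by (intro exI[of _ 0]) auto
next
  case (step y z)
  then obtain n where n: "(tm_step M ^^ n) c = y"
    "\<forall>m\<le>n. \<bar>snd (snd ((tm_step M ^^ m) c))\<bar> \<le> int H"
    by blast
  then have "(tm_step M ^^ Suc n) c = z"
    using step(2) by (simp add: bstep_def)
  moreover from this have "\<forall>m\<le>Suc n. \<bar>snd (snd ((tm_step M ^^ m) c))\<bar> \<le> int H"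
    using n(2) step(2) by (auto simp: bstep_def le_Suc_eq)
  ultimately show ?case
    by blast
qed

text \<open>This is the number that the initial tape stores in register 0. The codes 1 to 11 are
  nonzero base-12 digits, so even strings of different lengths get different numbers.\<close>

definition nv :: "sym list \<Rightarrow> nat" where
  "nv w = foldr (\<lambda>a r. sym_code a + 12 * r) w 0"

lemma nv_Nil [simp]: "nv [] = 0"
  by (simp add: nv_def)

lemma nv_Cons [simp]: "nv (a # w) = sym_code a + 12 * nv w"
  by (simp add: nv_def)

lemma sym_code_bounds: "0 < sym_code a" "sym_code a < 12"
  by (cases a; simp)+

lemma reg_sym_code: "reg j (map sym_code w) = (if j = 0 then nv w else 0)"
proof (induction w)
  case (Cons a w)
  have "digit j (sym_code a) = (if j = 0 then sym_code a else 0)"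
  proof (cases j)
    case (Suc i)
    have "sym_code a < 12 ^ j"
      using sym_code_bounds(2)[of a] less_le_trans[of "sym_code a" 12 "12 ^ j"] Suc by simp
    then show ?thesis
      using Suc by (simp add: digit_def)
  qed (use sym_code_bounds(2)[of a] in \<open>simp add: digit_def\<close>)
  then show ?case
    using Cons by simp
qed simp

section \<open>Correctness of the sweeps for a fixed program and tape bound\<close>

locale simulation =
  fixes k :: nat and prog :: "instr list" and H :: nat
  assumes k_pos: "0 < k" and H_pos: "0 < H"
begin

abbreviation "M \<equiv> mach k prog"
abbreviation "EE \<equiv> 12 ^ k + 1 :: nat"
abbreviation "LL \<equiv> 12 ^ k :: nat"
abbreviation reaches (infix "\<leadsto>" 50) where "reaches \<equiv> (bstep M H)\<^sup>*\<^sup>*"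

lemma step_exec:
  assumes "raw_delta k prog q (t h) = (q', a, d)" "q \<noteq> 1" "q \<noteq> 2"
    and "q' < state (length prog) 0" "a < 12 ^ k + 2" "d \<in> {-1, 0, 1}"
    and "\<bar>h\<bar> \<le> int H" "\<bar>h + d\<bar> \<le> int H"
  shows "(q, t, h) \<leadsto> (q', t(h := a), h + d)"
proof -
  have "bstep M H (q, t, h) (q', t(h := a), h + d)"
    using assms by (auto simp: bstep_def tm_step_def mach_def)
  then show ?thesis
    by blast
qed

lemma raw_delta_state:
  assumes "ph < 5"
  shows "raw_delta k prog (state pc ph) a =
     (if ph = 0 then exec_delta k (prog ! pc) pc a
        else if ph = 1 then (state pc 2, 12 ^ k + 1, 0)
        else if ph = 2 then (if a = 12 ^ k then (state (Suc pc) 0, a, 1) else (state pc 2, a, -1))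
        else if ph = 3 then (if a = 12 ^ k then (state (jump (prog ! pc)) 0, a, 1) else (state pc 3, a, -1))
        else (if a = 12 ^ k then (state (Suc pc) 0, a, 1)
              else if a = 12 ^ k + 1 then (state pc 4, a, -1)
              else (state pc 4, a - digit (ireg (prog ! pc)) a * 12 ^ ireg (prog ! pc), -1)))"
proof -
  have "state pc ph - 4 = ph + pc * 5" "state pc ph \<noteq> 0" "state pc ph \<noteq> 3"
    by (auto simp: state_def)
  moreover have "(ph + pc * 5) div 5 = pc" "(ph + pc * 5) mod 5 = ph"
    using assms by auto
  ultimately show ?thesis
    unfolding raw_delta_def by (simp only: if_False Let_def)
qed

lemma state_neq [simp]: "state pc ph \<noteq> 1" "state pc ph \<noteq> 2" "state pc ph \<noteq> Suc 0"
  by (auto simp: state_def)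

lemma state_less: "pc < length prog \<Longrightarrow> ph < 5 \<Longrightarrow> state pc ph < state (length prog) 0"
  by (simp add: state_def)

lemma return:
  assumes "ph = 2 \<or> ph = 3" "l = (if ph = 2 then Suc pc else jump (prog ! pc))"
    and "l < length prog" "pc < length prog"
    and "t (-1) = LL" "\<forall>i. 0 \<le> i \<and> i \<le> int p \<longrightarrow> t i \<noteq> LL \<and> t i < 12 ^ k + 2" "p \<le> H"
  shows "(state pc ph, t, int p) \<leadsto> (state l 0, t, 0)"
  using assms(6,7)
proof (induction p)
  case 0
  have "(state pc ph, t, 0) \<leadsto> (state pc ph, t(0 := t 0), 0 + -1)"
    using assms(1,4) 0 H_pos by (intro step_exec) (auto simp: raw_delta_state state_less)
  also have "t(0 := t 0) = t" by simp
  also have "(state pc ph, t, 0 + -1) \<leadsto> (state l 0, t(0 + -1 := t (-1)), 0 + -1 + 1)"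
    using assms(1-5) H_pos by (intro step_exec) (auto simp: raw_delta_state state_less)
  finally show ?case by simp
next
  case (Suc p)
  have "(state pc ph, t, int (Suc p)) \<leadsto> (state pc ph, t(int (Suc p) := t (int (Suc p))), int (Suc p) + -1)"
    using assms(1,4) Suc.prems(2) Suc.prems(1)[rule_format, of "int (Suc p)"]
    by (intro step_exec) (auto simp: raw_delta_state state_less)
  also have "t(int (Suc p) := t (int (Suc p))) = t" by simp
  also have "(state pc ph, t, int (Suc p) + -1) \<leadsto> (state l 0, t, 0)"
    using Suc by simp
  finally show ?case .
qed

text \<open>Cells to the right of the right marker are unconstrained: a growing tape overwrites
  them. \<open>xs\<close> may carry leading zeros, since decrements never shorten it.\<close>

definition at :: "nat \<Rightarrow> (nat \<Rightarrow> nat) \<Rightarrow> config \<Rightarrow> bool" where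
  "at pc s c \<longleftrightarrow> (\<exists>t xs. c = (state pc 0, t, 0) \<and> t (-1) = LL \<and> seg t 0 (xs @ [EE]) \<and>
     (\<forall>a\<in>set xs. a < 12 ^ k) \<and> (\<forall>r<k. reg r xs = s r) \<and> length xs \<le> H)"

definition go :: "nat \<Rightarrow> (nat \<Rightarrow> nat) \<Rightarrow> nat \<Rightarrow> (nat \<Rightarrow> nat) \<Rightarrow> bool" where
  "go pc s pc' s' \<longleftrightarrow> (\<forall>c. at pc s c \<longrightarrow> (\<exists>c'. c \<leadsto> c' \<and> at pc' s' c'))"

lemma go_trans: "go a s b s' \<Longrightarrow> go b s' d s'' \<Longrightarrow> go a s d s''"
  unfolding go_def by (meson rtranclp_trans)

lemma seg_not_LL:
  assumes "seg t 0 (xs @ [EE])" "\<forall>a\<in>set xs. a < 12 ^ k" "p \<le> length xs"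
  shows "\<forall>i. 0 \<le> i \<and> i \<le> int p \<longrightarrow> t i \<noteq> LL \<and> t i < 12 ^ k + 2"
proof (intro allI impI)
  fix i :: int
  assume "0 \<le> i \<and> i \<le> int p"
  then obtain j where j: "i = int j" "j \<le> length xs"
    using assms(3) by (metis nonneg_int_cases of_nat_le_iff order_trans)
  have "t i = (xs @ [EE]) ! j"
    using assms(1) j unfolding seg_nth by auto
  moreover have "j < length xs \<Longrightarrow> xs ! j < 12 ^ k"
    using assms(2) by simp
  ultimately show "t i \<noteq> LL \<and> t i < 12 ^ k + 2"
    using j by (cases "j < length xs") (auto simp: nth_append)
qed

fun incl :: "nat \<Rightarrow> nat list \<Rightarrow> nat list" where
  "incl r [] = [12 ^ r]"
| "incl r (a # xs) = (if digit r a = 11 then (a - 11 * 12 ^ r) # incl r xs else (a + 12 ^ r) # xs)"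

lemma reg_incl:
  "reg j (incl r xs) = (if j = r then Suc (reg r xs) else reg j xs)"
proof (induction xs)
  case Nil
  then show ?case by (auto simp: digit_power)
next
  case (Cons a xs)
  show ?case
  proof (cases "digit r a = 11")
    case True
    then obtain b where "a = b + 11 * 12 ^ r" "digit r b + 11 = digit r a" "digit r b + 11 < 12"
      using digit_sub[of 11 r a] by auto
    then show ?thesis
      using True Cons digit_add_other[of r b 11 j] by auto
  next
    case False
    moreover have "digit r a < 12"
      by (simp add: digit_def)
    ultimately have "digit r a + 1 < 12" by linarith
    then show ?thesis
      using False digit_add[of r a 1] digit_add_other[of r a 1 j] by auto
  qed
qed

lemma incl_less:
  assumes "\<forall>a\<in>set xs. a < 12 ^ k" "r < k"
  shows "\<forall>a\<in>set (incl r xs). a < 12 ^ k"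
  using assms(1)
proof (induction xs)
  case Nil
  show ?case using assms(2) by simp
next
  case (Cons a xs)
  have "digit r a < 12"
    by (simp add: digit_def)
  then have "digit r a \<noteq> 11 \<Longrightarrow> digit r a + 1 < 12" by linarith
  then show ?case
    using Cons digit_bound[of a k r 1] assms(2) by auto
qed

text \<open>A new cell is needed only if all digits of register \<open>r\<close> were 11, and then
  the new value is \<open>12 ^ length xs\<close>. So a bound on values bounds the tape.\<close>

lemma length_incl:
  "length (incl r xs) = length xs \<or>
   length (incl r xs) = Suc (length xs) \<and> Suc (reg r xs) = 12 ^ length xs"
  by (induction xs) auto

lemma carry:
  assumes "prog ! pc = IInc r" "r < k" "pc < length prog"
    and "seg t (int p) (xs @ [EE])" "\<forall>a\<in>set xs. a < 12 ^ k" "p + length (incl r xs) \<le> H"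
  shows "\<exists>t' p'. (state pc 0, t, int p) \<leadsto> (state pc 2, t', int p') \<and>
     seg t' (int p) (incl r xs @ [EE]) \<and> (\<forall>i < int p. t' i = t i) \<and> p' \<le> p + length (incl r xs)"
  using assms(4-6)
proof (induction xs arbitrary: t p)
  case Nil
  have "(12::nat) ^ r < 12 ^ k" using assms(2) by simp
  then have le: "(12::nat) ^ r < 12 ^ k + 2" by (rule trans_less_add1)
  \<comment> \<open>The overflowing digit replaces the marker, which phase 1 rewrites one cell
    further right.\<close>
  define t1 t2 where "t1 = t(int p := 12 ^ r)" and "t2 = t1(int p + 1 := EE)"
  have "(state pc 0, t, int p) \<leadsto> (state pc 1, t1, int p + 1)"
    unfolding t1_def
    using Nil assms(1,3) le by (intro step_exec) (auto simp: raw_delta_state state_less)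
  also have "\<dots> \<leadsto> (state pc 2, t2, int p + 1 + 0)"
    unfolding t2_def
    using Nil assms(3) by (intro step_exec) (auto simp: raw_delta_state state_less)
  also have "int p + 1 + 0 = int (Suc p)"
    by simp
  finally have "(state pc 0, t, int p) \<leadsto> (state pc 2, t2, int (Suc p))" .
  moreover have "seg t2 (int p) (incl r [] @ [EE])" "\<forall>i < int p. t2 i = t i"
    by (auto simp: t1_def t2_def)
  ultimately show ?case
    by (intro exI[of _ t2] exI[of _ "Suc p"] conjI) simp_all
next
  case (Cons a xs)
  have a: "t (int p) = a" "a < 12 ^ k" using Cons.prems by auto
  have da: "digit r a < 12"
    by (simp add: digit_def)
  show ?case
  proof (cases "digit r a = 11")
    case True
    define t1 where "t1 = t(int p := a - 11 * 12 ^ r)"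
    have 1: "(state pc 0, t, int p) \<leadsto> (state pc 0, t1, int p + 1)"
      unfolding t1_def
      using Cons.prems assms(1,3) a True by (intro step_exec) (auto simp: raw_delta_state state_less)
    have "seg t (int p + 1) (xs @ [EE])"
      using Cons.prems by simp
    then have "seg t1 (int (Suc p)) (xs @ [EE])"
      unfolding t1_def by (subst seg_upd) (auto simp: add.commute)
    then have "\<exists>t' p'. (state pc 0, t1, int (Suc p)) \<leadsto> (state pc 2, t', int p') \<and>
     seg t' (int (Suc p)) (incl r xs @ [EE]) \<and> (\<forall>i < int (Suc p). t' i = t1 i) \<and> p' \<le> Suc p + length (incl r xs)"
      by (rule Cons.IH) (use Cons.prems True in auto)
    then obtain t' p' where 2: "(state pc 0, t1, int (Suc p)) \<leadsto> (state pc 2, t', int p')"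
     "seg t' (int (Suc p)) (incl r xs @ [EE])" "\<forall>i < int (Suc p). t' i = t1 i"
     "p' \<le> Suc p + length (incl r xs)"
      by blast
    note 1
    also have "int p + 1 = int (Suc p)" by simp
    also note 2(1)
    finally have "(state pc 0, t, int p) \<leadsto> (state pc 2, t', int p')" .
    moreover have "seg t' (int p) (incl r (a # xs) @ [EE])" "\<forall>i < int p. t' i = t i"
      using 2(2,3) True by (auto simp: t1_def add.commute)
    ultimately show ?thesis
      using 2(4) True by (intro exI[of _ t'] exI[of _ p']) auto
  next
    case False
    define t1 where "t1 = t(int p := a + 12 ^ r)"
    have "a + 1 * 12 ^ r < 12 ^ k"
      using a da assms(2) False by (intro digit_bound) auto
    then have "(state pc 0, t, int p) \<leadsto> (state pc 2, t1, int p + 0)"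
      unfolding t1_def
      using Cons.prems assms(1,3) a False by (intro step_exec) (auto simp: raw_delta_state state_less)
    moreover have "seg t (int p + 1) (xs @ [EE])"
      using Cons.prems by simp
    then have "seg t1 (int p + 1) (xs @ [EE])"
      unfolding t1_def by (subst seg_upd) auto
    moreover have "t1 (int p) = a + 12 ^ r" "\<forall>i < int p. t1 i = t i"
      unfolding t1_def by auto
    ultimately show ?thesis
      using False by (intro exI[of _ t1] exI[of _ "p"]) auto
  qed
qed

lemma go_Inc:
  assumes "prog ! pc = IInc r" "r < k" "Suc pc < length prog" "Suc (s r) < 12 ^ H"
  shows "go pc s (Suc pc) (s(r := Suc (s r)))"
  unfolding go_def
proof (intro allI impI)
  fix c assume "at pc s c"
  then obtain t xs where c: "c = (state pc 0, t, 0)" "t (-1) = LL" "seg t 0 (xs @ [EE])"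
     "\<forall>a\<in>set xs. a < 12 ^ k" "\<forall>r<k. reg r xs = s r" "length xs \<le> H"
    unfolding at_def by blast
  have len: "length (incl r xs) \<le> H"
  proof -
    consider "length (incl r xs) = length xs"
      | "length (incl r xs) = Suc (length xs)" "Suc (reg r xs) = 12 ^ length xs"
      using length_incl by blast
    then show ?thesis
    proof cases
      case 2
      then have "(12::nat) ^ length xs < 12 ^ H"
        using assms(2,4) c(5) by simp
      then show ?thesis
        using 2(1) by simp
    qed (use c in simp)
  qed
  then obtain t' p' where t': "(state pc 0, t, 0) \<leadsto> (state pc 2, t', int p')"
     "seg t' 0 (incl r xs @ [EE])" "\<forall>i < 0. t' i = t i" "p' \<le> length (incl r xs)"
    using carry[of pc r t 0 xs] c assms by auto
  have less: "\<forall>a\<in>set (incl r xs). a < 12 ^ k"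
    using c(4) assms(2) by (rule incl_less)
  have tm: "t' (-1) = LL"
    using t'(3) c(2) by simp
  have "(state pc 2, t', int p') \<leadsto> (state (Suc pc) 0, t', 0)"
    using seg_not_LL[OF t'(2) less t'(4)] assms(3) tm t'(4) len by (intro return) auto
  with t'(1) have "c \<leadsto> (state (Suc pc) 0, t', 0)"
    unfolding c(1) by (rule rtranclp_trans)
  moreover have "at (Suc pc) (s(r := Suc (s r))) (state (Suc pc) 0, t', 0)"
    unfolding at_def using tm t'(2) less len c(5) assms(2)
    by (intro exI[of _ t'] exI[of _ "incl r xs"]) (auto simp: reg_incl)
  ultimately show "\<exists>c'. c \<leadsto> c' \<and> at (Suc pc) (s(r := Suc (s r))) c'"
    by blast
qed

fun decl :: "nat \<Rightarrow> nat list \<Rightarrow> nat list" where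
  "decl r [] = []"
| "decl r (a # xs) = (if digit r a = 0 then (a + 11 * 12 ^ r) # decl r xs else (a - 12 ^ r) # xs)"

lemma length_decl [simp]: "length (decl r xs) = length xs"
  by (induction xs) auto

text \<open>A nonzero value has a nonzero digit where the borrow stops; for value 0,
  \<open>decl\<close> would turn every digit into 11.\<close>

lemma reg_decl:
  assumes "reg r xs \<noteq> 0"
  shows "reg j (decl r xs) = (if j = r then reg r xs - 1 else reg j xs)"
  using assms
proof (induction xs)
  case (Cons a xs)
  show ?case
  proof (cases "digit r a = 0")
    case True
    then show ?thesis
      using Cons digit_add_other[of r a 11 j] digit_add[of r a 11] by auto
  next
    case False
    then obtain b where "a = b + 1 * 12 ^ r" "digit r b + 1 = digit r a" "digit r b + 1 < 12"
      using digit_sub[of 1 r a] by auto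
    then show ?thesis
      using False digit_add_other[of r b 1 j] by auto
  qed
qed simp

lemma decl_less:
  assumes "\<forall>a\<in>set xs. a < 12 ^ k" "r < k"
  shows "\<forall>a\<in>set (decl r xs). a < 12 ^ k"
  using assms(1)
proof (induction xs)
  case (Cons a xs)
  have "a - 12 ^ r < 12 ^ k" using Cons.prems by (meson less_imp_diff_less list.set_intros(1))
  then show ?case
    using Cons digit_bound[of a k r 11] assms(2) by auto
qed simp

lemma borrow:
  assumes "prog ! pc = IDec r" "r < k" "pc < length prog"
    and "seg t (int p) (xs @ [EE])" "\<forall>a\<in>set xs. a < 12 ^ k" "p + length xs \<le> H" "reg r xs \<noteq> 0"
  shows "\<exists>t' p'. (state pc 0, t, int p) \<leadsto> (state pc 2, t', int p') \<and>
     seg t' (int p) (decl r xs @ [EE]) \<and> (\<forall>i < int p. t' i = t i) \<and> p' \<le> p + length xs"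
  using assms(4-7)
proof (induction xs arbitrary: t p)
  case Nil
  then show ?case by simp
next
  case (Cons a xs)
  have a: "t (int p) = a" "a < 12 ^ k" using Cons.prems by auto
  show ?case
  proof (cases "digit r a = 0")
    case True
    let ?t = "t(int p := a + 11 * 12 ^ r)"
    have "a + 11 * 12 ^ r < 12 ^ k"
      using a True assms(2) by (intro digit_bound) auto
    then have 1: "(state pc 0, t, int p) \<leadsto> (state pc 0, ?t, int p + 1)"
      using Cons.prems assms(1,3) a True by (intro step_exec) (auto simp: raw_delta_state state_less)
    have "seg t (int (Suc p)) (xs @ [EE])"
      using Cons.prems by (simp add: algebra_simps)
    then have sg: "seg ?t (int (Suc p)) (xs @ [EE])"
      by (subst seg_upd) auto
    have "\<exists>t' p'. (state pc 0, ?t, int (Suc p)) \<leadsto> (state pc 2, t', int p') \<and>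
     seg t' (int (Suc p)) (decl r xs @ [EE]) \<and> (\<forall>i < int (Suc p). t' i = ?t i) \<and> p' \<le> Suc p + length xs"
      by (rule Cons.IH[OF sg]) (use Cons.prems True in auto)
    then obtain t' p' where 2: "(state pc 0, ?t, int (Suc p)) \<leadsto> (state pc 2, t', int p')"
     "seg t' (int (Suc p)) (decl r xs @ [EE])" "\<forall>i < int (Suc p). t' i = ?t i"
     "p' \<le> Suc p + length xs"
      by blast
    note 1
    also have "int p + 1 = int (Suc p)" by simp
    also note 2(1)
    finally have "(state pc 0, t, int p) \<leadsto> (state pc 2, t', int p')" .
    moreover have "seg t' (int p) (decl r (a # xs) @ [EE])"
      using 2(2,3) True by (auto simp: algebra_simps)
    ultimately show ?thesis
      using 2(3,4) True by (intro exI[of _ t'] exI[of _ p']) auto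
  next
    case False
    define t1 where "t1 = t(int p := a - 12 ^ r)"
    have "(state pc 0, t, int p) \<leadsto> (state pc 2, t1, int p + 0)"
      unfolding t1_def
      using Cons.prems assms(1,3) a False by (intro step_exec) (auto simp: raw_delta_state state_less)
    moreover have "seg t (int p + 1) (xs @ [EE])"
      using Cons.prems by simp
    then have "seg t1 (int p + 1) (xs @ [EE])"
      unfolding t1_def by (subst seg_upd) auto
    moreover have "t1 (int p) = a - 12 ^ r" "\<forall>i < int p. t1 i = t i"
      unfolding t1_def by auto
    ultimately show ?thesis
      using False by (intro exI[of _ t1] exI[of _ "p"]) auto
  qed
qed

text \<open>Decrementing a register with value 0 turns all its digits into 11 on the way to the right
  and repairs them on the way back, so the tape is unchanged in the end.\<close>
lemma underflow:
  assumes "prog ! pc = IDec r" "r < k" "pc < length prog"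
    and "seg t (int p) (xs @ [EE])" "\<forall>a\<in>set xs. a < 12 ^ k" "p + length xs \<le> H" "reg r xs = 0"
  shows "(state pc 0, t, int p) \<leadsto> (state pc 4, t, int p - 1)"
  using assms(4-7)
proof (induction xs arbitrary: t p)
  case Nil
  then have "(state pc 0, t, int p) \<leadsto> (state pc 4, t(int p := EE), int p + -1)"
    using assms(1,3) H_pos by (intro step_exec) (auto simp: raw_delta_state state_less)
  moreover have "t(int p := EE) = t" using Nil by auto
  ultimately show ?case by simp
next
  case (Cons a xs)
  define b where "b = a + 11 * 12 ^ r"
  define t1 where "t1 = t(int p := b)"
  have a: "t (int p) = a" "a < 12 ^ k" "digit r a = 0" using Cons.prems by auto
  then have b: "b < 12 ^ k" "digit r b = 11"
    unfolding b_def using assms(2) digit_add[of r a 11] by (auto intro: digit_bound)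
  have "(state pc 0, t, int p) \<leadsto> (state pc 0, t1, int p + 1)"
    unfolding t1_def using Cons.prems assms(1,3) a b
    by (intro step_exec) (auto simp: raw_delta_state state_less b_def)
  also have "int p + 1 = int (Suc p)"
    by simp
  also have "seg t (int p + 1) (xs @ [EE])"
    using Cons.prems by simp
  then have "seg t1 (int (Suc p)) (xs @ [EE])"
    unfolding t1_def by (subst seg_upd) (auto simp: add.commute)
  then have "(state pc 0, t1, int (Suc p)) \<leadsto> (state pc 4, t1, int (Suc p) - 1)"
    by (rule Cons.IH) (use Cons.prems in auto)
  also have "int (Suc p) - 1 = int p"
    by simp
  also have "(state pc 4, t1, int p) \<leadsto> (state pc 4, t1(int p := a), int p + -1)"
  proof (rule step_exec)
    show "raw_delta k prog (state pc 4) (t1 (int p)) = (state pc 4, a, -1)"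
      using b by (simp add: raw_delta_state t1_def assms(1) b_def)
  qed (use Cons.prems assms(3) a H_pos in \<open>auto simp: state_less\<close>)
  also have "t1(int p := a) = t"
    using a by (auto simp: t1_def)
  finally show ?case
    by simp
qed

lemma go_Dec:
  assumes "prog ! pc = IDec r" "r < k" "Suc pc < length prog"
  shows "go pc s (Suc pc) (s(r := s r - 1))"
  unfolding go_def
proof (intro allI impI)
  fix c assume "at pc s c"
  then obtain t xs where c: "c = (state pc 0, t, 0)" "t (-1) = LL" "seg t 0 (xs @ [EE])"
     "\<forall>a\<in>set xs. a < 12 ^ k" "\<forall>r<k. reg r xs = s r" "length xs \<le> H"
    unfolding at_def by blast
  show "\<exists>c'. c \<leadsto> c' \<and> at (Suc pc) (s(r := s r - 1)) c'"
  proof (cases "reg r xs = 0")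
    case True
    then have "c \<leadsto> (state pc 4, t, -1)"
      using underflow[of pc r t 0 xs] c assms by simp
    also have "\<dots> \<leadsto> (state (Suc pc) 0, t(-1 := LL), -1 + 1)"
      using c assms H_pos by (intro step_exec) (auto simp: raw_delta_state state_less)
    finally have "c \<leadsto> (state (Suc pc) 0, t, 0)"
      using c by (auto simp: fun_upd_idem)
    moreover have "s(r := s r - 1) = s"
      using True c assms by auto
    ultimately show ?thesis
      unfolding at_def using c by auto
  next
    case False
    then obtain t' p' where t': "(state pc 0, t, 0) \<leadsto> (state pc 2, t', int p')"
     "seg t' 0 (decl r xs @ [EE])" "\<forall>i < 0. t' i = t i" "p' \<le> length xs"
      using borrow[of pc r t 0 xs] c assms by auto
    have less: "\<forall>a\<in>set (decl r xs). a < 12 ^ k"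
      using c(4) assms(2) by (rule decl_less)
    have tm: "t' (-1) = LL"
      using t'(3) c(2) by simp
    have "(state pc 2, t', int p') \<leadsto> (state (Suc pc) 0, t', 0)"
      using seg_not_LL[OF t'(2) less] assms(3) tm t'(4) c(6) by (intro return) auto
    with t'(1) have "c \<leadsto> (state (Suc pc) 0, t', 0)"
      unfolding c(1) by (rule rtranclp_trans)
    moreover have "at (Suc pc) (s(r := s r - 1)) (state (Suc pc) 0, t', 0)"
      unfolding at_def using tm t'(2) less c(5,6) assms(2) False
      by (intro exI[of _ t'] exI[of _ "decl r xs"]) (auto simp: reg_decl)
    ultimately show ?thesis
      by blast
  qed
qed

lemma test_zero:
  assumes "prog ! pc = IJz r l" "pc < length prog"
    and "seg t (int p) (xs @ [EE])" "\<forall>a\<in>set xs. a < 12 ^ k" "p + length xs \<le> H"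
  shows "\<exists>p'. (state pc 0, t, int p) \<leadsto> (state pc (if reg r xs = 0 then 3 else 2), t, int p') \<and>
     p' \<le> p + length xs"
  using assms(3-5)
proof (induction xs arbitrary: p)
  case Nil
  then have "(state pc 0, t, int p) \<leadsto> (state pc 3, t(int p := t (int p)), int p + 0)"
    using assms(1,2) by (intro step_exec) (auto simp: raw_delta_state state_less)
  then show ?case
    by (intro exI[of _ p]) simp
next
  case (Cons a xs)
  have a: "t (int p) = a" "a < 12 ^ k" using Cons.prems by auto
  show ?case
  proof (cases "digit r a = 0")
    case True
    then have 1: "(state pc 0, t, int p) \<leadsto> (state pc 0, t(int p := t (int p)), int p + 1)"
      using Cons.prems assms(1,2) a by (intro step_exec) (auto simp: raw_delta_state state_less)
    obtain p' where 2: "(state pc 0, t, int (Suc p)) \<leadsto> (state pc (if reg r xs = 0 then 3 else 2), t, int p')"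
     "p' \<le> Suc p + length xs"
      using Cons.IH[of "Suc p"] Cons.prems by (auto simp: algebra_simps)
    note 1
    also have "t(int p := t (int p)) = t" by simp
    also have "int p + 1 = int (Suc p)" by simp
    also note 2(1)
    finally have "(state pc 0, t, int p) \<leadsto> (state pc (if reg r xs = 0 then 3 else 2), t, int p')" .
    then show ?thesis
      using 2(2) True by (intro exI[of _ p']) auto
  next
    case False
    have "(state pc 0, t, int p) \<leadsto> (state pc 2, t(int p := t (int p)), int p + 0)"
      using Cons.prems assms(1,2) a False by (intro step_exec) (auto simp: raw_delta_state state_less)
    then show ?thesis
      using False by (intro exI[of _ p]) auto
  qed
qed

lemma go_Jz:
  assumes "prog ! pc = IJz r l" "r < k" "Suc pc < length prog" "l < length prog"
  shows "go pc s (if s r = 0 then l else Suc pc) s"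
  unfolding go_def
proof (intro allI impI)
  fix c assume "at pc s c"
  then obtain t xs where c: "c = (state pc 0, t, 0)" "t (-1) = LL" "seg t 0 (xs @ [EE])"
     "\<forall>a\<in>set xs. a < 12 ^ k" "\<forall>r<k. reg r xs = s r" "length xs \<le> H"
    unfolding at_def by blast
  obtain p' where p': "(state pc 0, t, 0) \<leadsto> (state pc (if s r = 0 then 3 else 2), t, int p')"
     "p' \<le> length xs"
    using test_zero[of pc r l t 0 xs] c assms by auto
  have "(state pc (if s r = 0 then 3 else 2), t, int p') \<leadsto> (state (if s r = 0 then l else Suc pc) 0, t, 0)"
    using seg_not_LL[OF c(3,4) p'(2)] assms c(2,6) p'(2) by (intro return) auto
  with p'(1) have "c \<leadsto> (state (if s r = 0 then l else Suc pc) 0, t, 0)"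
    unfolding c(1) by (rule rtranclp_trans)
  then show "\<exists>c'. c \<leadsto> c' \<and> at (if s r = 0 then l else Suc pc) s c'"
    unfolding at_def using c by blast
qed

lemma go_Jmp:
  assumes "prog ! pc = IJmp l" "pc < length prog" "l < length prog"
  shows "go pc s l s"
  unfolding go_def
proof (intro allI impI)
  fix c assume "at pc s c"
  then obtain t xs where c: "c = (state pc 0, t, 0)" "t (-1) = LL" "seg t 0 (xs @ [EE])"
     "\<forall>a\<in>set xs. a < 12 ^ k" "\<forall>r<k. reg r xs = s r" "length xs \<le> H"
    unfolding at_def by blast
  have "t 0 < 12 ^ k + 2"
    using seg_not_LL[OF c(3,4), of 0] by simp
  then have "(state pc 0, t, 0) \<leadsto> (state l 0, t(0 := t 0), 0 + 0)"
    using assms by (intro step_exec) (auto simp: raw_delta_state state_less)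
  then have "c \<leadsto> (state l 0, t, 0)"
    by (simp add: c(1))
  then show "\<exists>c'. c \<leadsto> c' \<and> at l s c'"
    unfolding at_def using c by blast
qed

lemma halt:
  assumes "prog ! pc = IHalt b" "pc < length prog" "at pc s c"
  shows "\<exists>t h. c \<leadsto> (if b then 1 else 2, t, h)"
proof -
  obtain t xs where c: "c = (state pc 0, t, 0)" "t (-1) = LL" "seg t 0 (xs @ [EE])"
     "\<forall>a\<in>set xs. a < 12 ^ k"
    using assms unfolding at_def by blast
  have "t 0 < 12 ^ k + 2"
    using seg_not_LL[OF c(3,4), of 0] by simp
  moreover have "(if b then 1 else 2) < state (length prog) 0"
    by (simp add: state_def)
  ultimately have "(state pc 0, t, 0) \<leadsto> (if b then 1 else 2, t(0 := t 0), 0 + 0)"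
    using assms by (intro step_exec) (auto simp: raw_delta_state)
  then show ?thesis
    unfolding c(1) by blast
qed

text \<open>\<open>N < 12 ^ H\<close> converts the bound on values into the tape bound that
  \<open>go_Inc\<close> needs. The strict inequality for \<open>length prog\<close> guarantees an
  instruction behind the code, where control arrives.\<close>

lemma go_com:
  assumes "exec N p s s'" "N < 12 ^ H" "regs p \<le> k"
    and "b + csize p < length prog" "\<forall>i < csize p. prog ! (b + i) = flat b p ! i"
  shows "go b s (b + csize p) s'"
  using assms(1,3-)
proof (induction arbitrary: b rule: exec.induct)
  case (exec_Inc s r)
  then show ?case
    using go_Inc[of b r s] assms(2) by (simp add: fun_upd_def)
next
  case (exec_Dec r s)
  then show ?case
    using go_Dec[of b r s] by (simp add: fun_upd_def)
next
  case (exec_Seq p s s' q s'')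
  have "go b s (b + csize p) s'"
    using exec_Seq.prems by (intro exec_Seq.IH(1)) (auto simp: nth_append split: if_splits)
  moreover have "prog ! (b + csize p + i) = flat (b + csize p) q ! i" if "i < csize q" for i
    using exec_Seq.prems(3)[rule_format, of "csize p + i"] that by (simp add: nth_append add.assoc)
  then have "go (b + csize p) s' (b + csize p + csize q) s''"
    using exec_Seq.prems by (intro exec_Seq.IH(2)) auto
  ultimately show ?case
    by (metis add.assoc csize.simps(3) go_trans)
next
  case (exec_WhileF s r p)
  have "prog ! b = IJz r (b + csize p + 2)"
    using exec_WhileF.prems(3)[rule_format, of 0] by simp
  then show ?case
    using go_Jz[of b r "b + csize p + 2" s] exec_WhileF by (simp add: add.assoc)
next
  case (exec_WhileT s r p s' s'')
  have "prog ! b = IJz r (b + csize p + 2)"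
    using exec_WhileT.prems(3)[rule_format, of 0] by simp
  then have "go b s (Suc b) s"
    using go_Jz[of b r "b + csize p + 2" s] exec_WhileT by simp
  moreover have "prog ! (Suc b + i) = flat (Suc b) p ! i" if "i < csize p" for i
    using exec_WhileT.prems(3)[rule_format, of "Suc i"] that by (simp add: nth_append)
  then have "go (Suc b) s (Suc b + csize p) s'"
    using exec_WhileT.prems by (intro exec_WhileT.IH(1)) auto
  moreover have "prog ! (Suc b + csize p) = IJmp b"
    using exec_WhileT.prems(3)[rule_format, of "Suc (csize p)"] by (simp add: nth_append)
  then have "go (Suc b + csize p) s' b s'"
    using exec_WhileT.prems by (intro go_Jmp) auto
  moreover have "go b s' (b + csize (While r p)) s''"
    using exec_WhileT.prems by (intro exec_WhileT.IH(2)) auto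
  ultimately show ?case
    using go_trans by blast
qed

text \<open>Symbol codes are nonzero, so the first blanks met on either side delimit the input;
  there the two markers are written.\<close>

lemma reaches_start:
  assumes "length w \<le> H" "0 < length prog"
  shows "\<exists>c. init_config w \<leadsto> c \<and> at 0 ((\<lambda>_. 0)(0 := nv w)) c"
proof -
  define t where "t = (\<lambda>i. if 0 \<le> i \<and> i < int (length w) then sym_code (w ! nat i) else 0)"
  have init: "init_config w = (0, t, 0)"
    by (simp add: init_config_def t_def)
  have k12: "(12::nat) ^ 1 \<le> 12 ^ k"
    using k_pos by (intro power_increasing) auto
  have code: "t (int p) \<noteq> 0 \<and> t (int p) < 12 ^ k" if "p < length w" for p
    using that k12 sym_code_bounds[of "w ! p"] by (simp add: t_def)
  have right: "(0, t, 0) \<leadsto> (0, t, int p)" if "p \<le> length w" for p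
    using that
  proof (induction p)
    case (Suc p)
    then have "(0, t, 0) \<leadsto> (0, t, int p)"
      by simp
    also have "\<dots> \<leadsto> (0, t(int p := t (int p)), int p + 1)"
      using Suc.prems assms(1) code[of p] by (intro step_exec) (auto simp: raw_delta_def state_def)
    also have "t(int p := t (int p)) = t"
      by simp
    also have "int p + 1 = int (Suc p)"
      by simp
    finally show ?case .
  qed simp
  define t1 where "t1 = t(int (length w) := EE)"
  define t2 where "t2 = t1(-1 := LL)"
  have left: "(3, t1, int p) \<leadsto> (3, t1, -1)" if "p \<le> length w" for p
    using that
  proof (induction p)
    case 0
    have "t1 0 \<noteq> 0 \<and> t1 0 < 12 ^ k + 2"
      using code[of 0] by (cases "w = []") (auto simp: t1_def)
    then have "(3, t1, 0) \<leadsto> (3, t1(0 := t1 0), 0 + -1)"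
      using H_pos by (intro step_exec) (auto simp: raw_delta_def state_def)
    then show ?case by simp
  next
    case (Suc p)
    have "t1 (int (Suc p)) \<noteq> 0 \<and> t1 (int (Suc p)) < 12 ^ k + 2"
      using code[of "Suc p"] Suc.prems by (cases "Suc p = length w") (auto simp: t1_def)
    then have "(3, t1, int (Suc p)) \<leadsto> (3, t1(int (Suc p) := t1 (int (Suc p))), int (Suc p) + -1)"
      using Suc.prems assms(1) by (intro step_exec) (auto simp: raw_delta_def state_def)
    also have "t1(int (Suc p) := t1 (int (Suc p))) = t1"
      by simp
    also have "int (Suc p) + -1 = int p"
      by simp
    also have "(3, t1, int p) \<leadsto> (3, t1, -1)"
      using Suc by simp
    finally show ?case .
  qed
  have "(0, t, 0) \<leadsto> (0, t, int (length w))"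
    by (rule right) simp
  also have "\<dots> \<leadsto> (3, t1, int (length w) + -1)"
    unfolding t1_def using assms(1) H_pos
    by (intro step_exec) (auto simp: raw_delta_def state_def t_def)
  also have "(3, t1, int (length w) + -1) \<leadsto> (3, t1, -1)"
  \<comment> \<open>For the empty word, writing the right marker at 0 already moves the head to
    -1.\<close>
  proof (cases "length w")
    case (Suc p)
    then show ?thesis
      using left[of p] by simp
  qed simp
  also have "\<dots> \<leadsto> (state 0 0, t2, -1 + 1)"
    unfolding t2_def using assms H_pos
    by (intro step_exec) (auto simp: raw_delta_def state_def t_def t1_def)
  finally have "init_config w \<leadsto> (state 0 0, t2, 0)"
    by (simp add: init)
  moreover have "seg t2 0 (map sym_code w @ [EE])"
    unfolding seg_nth by (auto simp: t2_def t1_def t_def nth_append less_Suc_eq)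
  then have "at 0 ((\<lambda>_. 0)(0 := nv w)) (state 0 0, t2, 0)"
    unfolding at_def using assms(1) k12 sym_code_bounds(2)
    by (intro exI[of _ t2] exI[of _ "map sym_code w"])
      (force simp: t2_def reg_sym_code intro: less_le_trans)
  ultimately show ?thesis
    by blast
qed

end

section \<open>From register programs to PSPACE\<close>

lemma funpow_tm_step_halted:
  assumes "fst ((tm_step M ^^ n) c) \<in> {1, 2}" "n \<le> m"
  shows "(tm_step M ^^ m) c = (tm_step M ^^ n) c"
  using assms(2)
proof (induction m rule: dec_induct)
  case (step m)
  have "tm_step M ((tm_step M ^^ n) c) = (tm_step M ^^ n) c"
    using assms(1) by (auto simp: tm_step_def split: prod.splits)
  then show ?case
    using step by simp
qed simp

lemma PSPACE_if_com:
  assumes "\<And>w. \<exists>s'. exec (2 ^ ((length w + 2) ^ c)) P ((\<lambda>_. 0)(0 := nv w)) s' \<and>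
    (w \<in> L \<longleftrightarrow> s' r \<noteq> 0)"
  shows "L \<in> PSPACE"
proof -
  define k where "k = max (regs P) (Suc r)"
  define n where "n = csize P"
  define prog where "prog = flat 0 P @ [IJz r (n + 2), IHalt True, IHalt False]"
  have len: "length prog = n + 3"
    by (simp add: prog_def n_def)
  have nth: "prog ! n = IJz r (n + 2)" "prog ! Suc n = IHalt True" "prog ! (n + 2) = IHalt False"
    by (auto simp: prog_def n_def nth_append)
  have *: "(\<exists>m. fst (run (mach k prog) w m) \<in> {1, 2}) \<and>
          (w \<in> L \<longleftrightarrow> (\<exists>m. fst (run (mach k prog) w m) = 1)) \<and>
          (\<forall>m. \<bar>snd (snd (run (mach k prog) w m))\<bar> \<le> int ((length w + 2) ^ (c + 2)))" for w
  proof -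
    \<comment> \<open>The two extra factors make \<open>H\<close> at least the input length even if
      \<open>c = 0\<close>.\<close>
    define H where "H = (length w + 2) ^ (c + 2)"
    have c: "(length w + 2) ^ c \<ge> 1" by simp
    have H_eq: "H = (length w + 2) ^ c * ((length w + 2) * (length w + 2))"
      by (simp only: H_def power_add power2_eq_square)
    have sq: "length w \<le> (length w + 2) * (length w + 2)" "1 \<le> (length w + 2) * (length w + 2)"
      by (simp_all add: algebra_simps)
    have H1: "length w \<le> H" "0 < H" "(length w + 2) ^ c \<le> H"
      unfolding H_eq using mult_le_mono[OF c sq(1)]
        mult_le_mono[OF order_refl[of "(length w + 2) ^ c"] sq(2)]
      by (simp_all only: mult_1 mult_1_right) simp
    have "(2::nat) ^ ((length w + 2) ^ c) \<le> 2 ^ H"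
      using H1(3) by simp
    also have "\<dots> < 12 ^ H"
      using H1(2) by (intro power_strict_mono) auto
    finally have N: "(2::nat) ^ ((length w + 2) ^ c) < 12 ^ H" .
    interpret simulation k prog H
      by unfold_locales (use H1 in \<open>auto simp: k_def\<close>)
    let ?M = "mach k prog"
    let ?R = "(bstep ?M H)\<^sup>*\<^sup>*"
    obtain s' where s': "exec (2 ^ ((length w + 2) ^ c)) P ((\<lambda>_. 0)(0 := nv w)) s'"
        "w \<in> L \<longleftrightarrow> s' r \<noteq> 0"
      using assms by blast
    have "go 0 ((\<lambda>_. 0)(0 := nv w)) (0 + csize P) s'"
      using s'(1) N by (rule go_com) (auto simp: k_def prog_def nth_append)
    moreover have "go (0 + csize P) s' (if s' r = 0 then n + 2 else Suc n) s'"
      using go_Jz[of n r "n + 2" s'] nth len by (simp add: n_def k_def)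
    ultimately have g: "go 0 ((\<lambda>_. 0)(0 := nv w)) (if s' r = 0 then n + 2 else Suc n) s'"
      by (rule go_trans)
    obtain c0 where c0: "?R (init_config w) c0" "at 0 ((\<lambda>_. 0)(0 := nv w)) c0"
      using reaches_start[of w] H1(1) len by auto
    obtain c1 where c1: "?R c0 c1" "at (if s' r = 0 then n + 2 else Suc n) s' c1"
      using g c0(2) unfolding go_def by blast
    obtain t h where "?R c1 (if s' r \<noteq> 0 then 1 else 2, t, h)"
    proof (cases "s' r = 0")
      case True
      with halt[OF nth(3) _ c1(2)[unfolded if_P[OF True]]] len that show thesis by auto
    next
      case False
      with halt[OF nth(2) _ c1(2)[unfolded if_not_P[OF False]]] len that show thesis by auto
    qed
    with c0(1) c1(1) have "?R (init_config w) (if s' r \<noteq> 0 then 1 else 2, t, h)"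
      by (meson rtranclp_trans)
    moreover have "\<bar>snd (snd (init_config w))\<bar> \<le> int H"
      by (simp add: init_config_def)
    ultimately obtain m where m: "(tm_step ?M ^^ m) (init_config w) = (if s' r \<noteq> 0 then 1 else 2, t, h)"
      "\<forall>i\<le>m. \<bar>snd (snd ((tm_step ?M ^^ i) (init_config w)))\<bar> \<le> int H"
      using bstep_funpow by blast
    have run_m: "fst (run ?M w m) = (if s' r \<noteq> 0 then 1 else 2)"
      using m(1) by (simp add: run_def)
    then have halted: "fst (run ?M w m) \<in> {1, 2}"
      by simp
    have late: "run ?M w i = run ?M w m" if "m \<le> i" for i
      using funpow_tm_step_halted[OF halted[unfolded run_def] that] by (simp add: run_def)
    have "\<bar>snd (snd (run ?M w i))\<bar> \<le> int H" for i
      using m(2) late[of i] by (cases "i \<le> m") (auto simp: run_def)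
    then have bounded: "\<forall>i. \<bar>snd (snd (run ?M w i))\<bar> \<le> int ((length w + 2) ^ (c + 2))"
      unfolding H_def by blast
    \<comment> \<open>Halting configurations are fixed points, so acceptance at any time agrees with
      the outcome at time \<open>m\<close>.\<close>
    have accept: "s' r \<noteq> 0" if "fst (run ?M w i) = 1" for i
    proof -
      have "run ?M w m = run ?M w i"
        using that late[of i] funpow_tm_step_halted[of i ?M "init_config w" m]
        unfolding run_def by (cases "i \<le> m") (simp, metis nat_le_linear)
      with that have "fst (run ?M w m) = 1"
        by simp
      with run_m show ?thesis
        by (metis one_eq_numeral_iff num.distinct(1))
    qed
    have "w \<in> L \<longleftrightarrow> (\<exists>i. fst (run ?M w i) = 1)"
      unfolding s'(2) using accept run_m by metis
    with bounded halted show ?thesis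
      by blast
  qed
  show ?thesis
    unfolding PSPACE_def
    by (rule CollectI, rule exI[of _ "mach k prog"], rule exI[of _ "c + 2"])
      (use * in \<open>simp add: valid_mach k_def\<close>)
qed

subsection \<open>Functions computable with registers of polynomial length\<close>

lemma exec_mono: "exec N p s s' \<Longrightarrow> N \<le> N' \<Longrightarrow> exec N' p s s'"
  by (induction rule: exec.induct) (auto intro: exec.intros simp del: One_nat_def)

text \<open>A loop is verified by naming the state \<open>S j\<close> after \<open>j\<close> rounds.
  The proof runs backwards, by induction on the number of rounds still to come.\<close>

lemma exec_While_chain:
  assumes "\<And>j. j < n \<Longrightarrow> exec N p (S j) (S (Suc j))" "\<And>j. j \<le> n \<Longrightarrow> S j r = n - j"
  shows "exec N (While r p) (S 0) (S n)"
proof -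
  have "exec N (While r p) (S (n - i)) (S n)" if "i \<le> n" for i
    using that
  proof (induction i)
    case 0
    then show ?case
      using assms(2)[of n] by (auto intro: exec_WhileF)
  next
    case (Suc i)
    then have eq: "Suc (n - Suc i) = n - i"
      by simp
    show ?case
    proof (rule exec_WhileT)
      show "0 < S (n - Suc i) r"
        using assms(2)[of "n - Suc i"] Suc.prems by simp
      show "exec N p (S (n - Suc i)) (S (n - i))"
        using assms(1)[of "n - Suc i"] Suc.prems unfolding eq by simp
      show "exec N (While r p) (S (n - i)) (S n)"
        using Suc by simp
    qed
  qed
  from this[of n] show ?thesis by simp
qed

abbreviation Clear :: "nat \<Rightarrow> com" where
  "Clear r \<equiv> While r (Dec r)"

lemma exec_Clear: "exec N (Clear r) s (s(r := 0))"
proof -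
  let ?S = "\<lambda>j. s(r := s r - j)"
  have "exec N (Clear r) (?S 0) (?S (s r))"
  proof (rule exec_While_chain)
    show "exec N (Dec r) (?S j) (?S (Suc j))" for j
      using exec_Dec[of N r "?S j"] by simp
  qed simp
  then show ?thesis by simp
qed

definition Move :: "nat \<Rightarrow> nat \<Rightarrow> com" where
  "Move a b = While a (Dec a ;; Inc b)"

lemma exec_Move:
  assumes "a \<noteq> b" "s b = 0" "s a \<le> N"
  shows "exec N (Move a b) s (s(a := 0, b := s a))"
proof -
  let ?S = "\<lambda>j. s(a := s a - j, b := j)"
  have "exec N (Move a b) (?S 0) (?S (s a))"
    unfolding Move_def
  proof (rule exec_While_chain)
    fix j assume j: "j < s a"
    have "exec N (Dec a) (?S j) (s(a := s a - Suc j, b := j))"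
      using exec_Dec[of N a "?S j"] assms(1) by (simp add: fun_upd_twist)
    moreover have "exec N (Inc b) (s(a := s a - Suc j, b := j)) (?S (Suc j))"
      using exec_Inc[of "s(a := s a - Suc j, b := j)" b N] j assms(3) by simp
    ultimately show "exec N (Dec a ;; Inc b) (?S j) (?S (Suc j))"
      by (rule exec_Seq)
  qed (use assms(1) in simp)
  moreover have "?S 0 = s"
    using assms(2) by auto
  ultimately show ?thesis by simp
qed

definition Copy :: "nat \<Rightarrow> nat \<Rightarrow> nat \<Rightarrow> com" where
  "Copy a b t = While a (Dec a ;; Inc b ;; Inc t) ;; Move t a"

lemma exec_Copy:
  assumes "a \<noteq> b" "a \<noteq> t" "b \<noteq> t" "s b = 0" "s t = 0" "s a \<le> N"
  shows "exec N (Copy a b t) s (s(b := s a))"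
proof -
  let ?S = "\<lambda>j. s(a := s a - j, b := j, t := j)"
  have "exec N (While a (Dec a ;; Inc b ;; Inc t)) (?S 0) (?S (s a))"
  proof (rule exec_While_chain)
    fix j assume j: "j < s a"
    have "exec N (Dec a) (?S j) (s(a := s a - Suc j, b := j, t := j))"
      using exec_Dec[of N a "?S j"] assms(1,2) by (simp add: fun_upd_twist)
    moreover have "exec N (Inc b) (s(a := s a - Suc j, b := j, t := j))
        (s(a := s a - Suc j, b := Suc j, t := j))"
      using exec_Inc[of "s(a := s a - Suc j, b := j, t := j)" b N] j assms(3,6)
      by (simp add: fun_upd_twist)
    moreover have "exec N (Inc t) (s(a := s a - Suc j, b := Suc j, t := j)) (?S (Suc j))"
      using exec_Inc[of "s(a := s a - Suc j, b := Suc j, t := j)" t N] j assms(6) by simp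
    ultimately show "exec N (Dec a ;; Inc b ;; Inc t) (?S j) (?S (Suc j))"
      by (blast intro: exec_Seq)
  qed (use assms(1,2) in simp)
  moreover have "?S 0 = s"
    using assms(4,5) by auto
  moreover have "exec N (Move t a) (?S (s a)) (s(b := s a))"
  proof -
    have "(?S (s a))(t := 0, a := s a) = s(b := s a)"
      using assms(2,3,5,1) by auto
    then show ?thesis
      using exec_Move[of t a "?S (s a)" N] assms by (simp add: fun_upd_def[symmetric])
  qed
  ultimately show ?thesis
    unfolding Copy_def by (simp only: exec_Seq)
qed

text \<open>An environment assigns values to de Bruijn indices. \<open>computable_within c f\<close>: whenever \<open>\<rho>\<close> maps the
  indices to registers below \<open>d\<close>, some program puts the value of \<open>f\<close> into register \<open>d\<close>, using the
  registers from \<open>d\<close> on as work space and needing numbers of polynomial length only.\<close>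

definition bounded :: "nat \<Rightarrow> ((nat \<Rightarrow> nat) \<Rightarrow> nat) \<Rightarrow> bool" where
  "bounded c f \<longleftrightarrow> (\<forall>v l. (\<forall>i. v i < 2 ^ l) \<longrightarrow> f v < 2 ^ ((l + 2) ^ c))"

text \<open>The final state differs from \<open>s\<close> at most in register \<open>d\<close>: the
  work space is handed back empty, which lets programs be put in sequence.\<close>

definition runs :: "nat \<Rightarrow> com \<Rightarrow> ((nat \<Rightarrow> nat) \<Rightarrow> nat) \<Rightarrow> (nat \<Rightarrow> nat) \<Rightarrow> nat \<Rightarrow> bool" where
  "runs c P f \<rho> d \<longleftrightarrow> (\<forall>s l. (\<forall>i\<ge>d. s i = 0) \<longrightarrow> (\<forall>i. s (\<rho> i) < 2 ^ l) \<longrightarrow>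
     exec (2 ^ ((l + 2) ^ c)) P s (s(d := f (\<lambda>i. s (\<rho> i)))))"

definition computable_within :: "nat \<Rightarrow> ((nat \<Rightarrow> nat) \<Rightarrow> nat) \<Rightarrow> bool" where
  "computable_within c f \<longleftrightarrow> bounded c f \<and> (\<forall>\<rho> d. (\<forall>i. \<rho> i < d) \<longrightarrow> (\<exists>P. runs c P f \<rho> d))"

definition quasipoly :: "((nat \<Rightarrow> nat) \<Rightarrow> nat) \<Rightarrow> bool" where
  "quasipoly f \<longleftrightarrow> (\<exists>c. bounded c f)"

definition computable :: "((nat \<Rightarrow> nat) \<Rightarrow> nat) \<Rightarrow> bool" where
  "computable f \<longleftrightarrow> (\<exists>c. computable_within c f)"

lemma tower_le: "a \<le> b \<Longrightarrow> (2::nat) ^ ((l + 2) ^ a) \<le> 2 ^ ((l + 2) ^ b)"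
  by (intro power_increasing) auto

text \<open>The base \<open>l + 2\<close> is at least 2, so a larger exponent absorbs constants and
  factors, and one number \<open>c\<close> describes a polynomial bound. Such bounds are therefore
  closed under composition.\<close>

lemma comp_exponent: "((l + 2) ^ a + 2) ^ b \<le> (l + 2 :: nat) ^ ((a + 2) * b)"
proof -
  have "1 \<le> (l + 2) ^ a"
    by simp
  moreover have "(l + 2) ^ (a + 2) = (l + 2) ^ a * ((l + 2) * (l + 2))"
    by (simp only: power_add power2_eq_square)
  moreover have "(l + 2) ^ a * 4 \<le> (l + 2) ^ a * ((l + 2) * (l + 2))"
    by (intro mult_le_mono2) simp
  ultimately have "(l + 2) ^ a + 2 \<le> (l + 2) ^ (a + 2)"
    by linarith
  then show ?thesis
    unfolding power_mult by (rule power_mono) simp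
qed

lemma comp_tower: "(2::nat) ^ (((l + 2) ^ a + 2) ^ b) \<le> 2 ^ ((l + 2) ^ ((a + 2) * b))"
  by (intro power_increasing comp_exponent) simp

lemma bounded_mono: "bounded c f \<Longrightarrow> c \<le> c' \<Longrightarrow> bounded c' f"
  unfolding bounded_def using tower_le less_le_trans by meson

lemma computable_within_mono: "computable_within c f \<Longrightarrow> c \<le> c' \<Longrightarrow> computable_within c' f"
  unfolding computable_within_def runs_def using bounded_mono exec_mono tower_le by meson

lemma boundedD: "bounded c f \<Longrightarrow> (\<And>i. v i < 2 ^ l) \<Longrightarrow> f v < 2 ^ ((l + 2) ^ c)"
  unfolding bounded_def by blast

lemma computable_within_prog:
  assumes "computable_within c f" "\<And>i. \<rho> i < d"
  shows "\<exists>P. runs c P f \<rho> d"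
  using assms unfolding computable_within_def by blast

lemma runsD:
  "runs c P f \<rho> d \<Longrightarrow> (\<And>i. i \<ge> d \<Longrightarrow> s i = 0) \<Longrightarrow> (\<And>i. s (\<rho> i) < 2 ^ l) \<Longrightarrow>
    exec (2 ^ ((l + 2) ^ c)) P s (s(d := f (\<lambda>i. s (\<rho> i))))"
  unfolding runs_def by blast

lemma cfI:
  assumes "bounded c f" and "\<And>\<rho> d. (\<And>i. \<rho> i < d) \<Longrightarrow> \<exists>P. runs c P f \<rho> d"
  shows "computable f"
  using assms unfolding computable_def computable_within_def by blast

lemma computable_imp_quasipoly: "computable f \<Longrightarrow> quasipoly f"
  by (auto simp: computable_def computable_within_def quasipoly_def)

lemma le_tower: "l \<le> (l + 2 :: nat) ^ Suc c"
proof -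
  have "(l + 2) * 1 \<le> (l + 2) * (l + 2) ^ c"
    by (intro mult_le_mono2) simp
  then show ?thesis by simp
qed

lemma env_le_tower: "x < 2 ^ l \<Longrightarrow> x < 2 ^ ((l + 2) ^ Suc c)" for x :: nat
  by (erule less_le_trans) (intro power_increasing le_tower, simp)

named_theorems computable_intros

lemma computable_var [computable_intros]: "computable (\<lambda>v. v j)"
proof (rule cfI)
  show "bounded 1 (\<lambda>v. v j)"
    unfolding bounded_def using env_le_tower[of _ _ 0] by (simp only: One_nat_def) blast
  fix \<rho> :: "nat \<Rightarrow> nat" and d
  assume \<rho>: "\<And>i. \<rho> i < d"
  have "exec (2 ^ ((l + 2) ^ 1)) (Copy (\<rho> j) d (Suc d)) s (s(d := s (\<rho> j)))"
    if "\<forall>i\<ge>d. s i = 0" "\<forall>i. s (\<rho> i) < 2 ^ l" for s l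
    using that \<rho>[of j] env_le_tower[of "s (\<rho> j)" l 0] by (intro exec_Copy) auto
  then show "\<exists>P. runs 1 P (\<lambda>v. v j) \<rho> d"
    unfolding runs_def by blast
qed

lemma computable_0: "computable (\<lambda>v. 0)"
proof (rule cfI)
  show "bounded 0 (\<lambda>v. 0)"
    by (simp add: bounded_def)
qed (use exec_Clear in \<open>unfold runs_def, blast\<close>)

lemma computable_Suc [computable_intros]:
  assumes "computable f"
  shows "computable (\<lambda>v. Suc (f v))"
proof -
  obtain c where c: "computable_within c f"
    using assms unfolding computable_def by blast
  have le: "Suc (f v) < 2 ^ ((l + 2) ^ Suc c)" if "\<And>i. v i < 2 ^ l" for v l
  proof -
    have "f v < 2 ^ ((l + 2) ^ c)"
      using c that unfolding computable_within_def bounded_def by blast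
    then have "Suc (f v) < 2 * 2 ^ ((l + 2) ^ c)"
      using one_le_power[of "2::nat" "(l + 2) ^ c"] by linarith
    also have "\<dots> = 2 ^ Suc ((l + 2) ^ c)"
      by simp
    also have "Suc ((l + 2) ^ c) \<le> (l + 2) ^ Suc c"
    proof -
      have "1 \<le> (l + 2) ^ c" by simp
      moreover have "2 * (l + 2) ^ c \<le> (l + 2) * (l + 2) ^ c"
        by (intro mult_le_mono1) simp
      ultimately show ?thesis
        by (simp only: power_Suc)
    qed
    then have "(2::nat) ^ Suc ((l + 2) ^ c) \<le> 2 ^ ((l + 2) ^ Suc c)"
      by (intro power_increasing) auto
    finally show ?thesis .
  qed
  show ?thesis
  proof (rule cfI)
    show "bounded (Suc c) (\<lambda>v. Suc (f v))"
      using le unfolding bounded_def by blast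
    fix \<rho> :: "nat \<Rightarrow> nat" and d
    assume \<rho>: "\<And>i. \<rho> i < d"
    obtain P where "runs (Suc c) P f \<rho> d"
      using computable_within_prog[where \<rho> = \<rho> and d = d, OF computable_within_mono[OF c le_SucI[OF order_refl]] \<rho>] by blast
    note P = runsD[OF this]
    have "exec (2 ^ ((l + 2) ^ Suc c)) (P ;; Inc d) s (s(d := Suc (f (\<lambda>i. s (\<rho> i)))))"
      if "\<forall>i\<ge>d. s i = 0" "\<forall>i. s (\<rho> i) < 2 ^ l" for s l
    proof (rule exec_Seq)
      show "exec (2 ^ ((l + 2) ^ Suc c)) P s (s(d := f (\<lambda>i. s (\<rho> i))))"
        using that by (intro P) auto
      show "exec (2 ^ ((l + 2) ^ Suc c)) (Inc d) (s(d := f (\<lambda>i. s (\<rho> i))))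
          (s(d := Suc (f (\<lambda>i. s (\<rho> i)))))"
        using exec_Inc[of "s(d := f (\<lambda>i. s (\<rho> i)))" d "2 ^ ((l + 2) ^ Suc c)"]
          le[of "\<lambda>i. s (\<rho> i)" l] that by simp
    qed
    then show "\<exists>P. runs (Suc c) P (\<lambda>v. Suc (f v)) \<rho> d"
      unfolding runs_def by blast
  qed
qed

lemma computable_rename:
  assumes "computable f"
  shows "computable (\<lambda>v. f (\<lambda>i. v (\<sigma> i)))"
proof -
  obtain c where c: "computable_within c f"
    using assms unfolding computable_def by blast
  show ?thesis
  proof (rule cfI)
    show "bounded c (\<lambda>v. f (\<lambda>i. v (\<sigma> i)))"
      unfolding bounded_def
    proof (intro allI impI)
      fix v :: "nat \<Rightarrow> nat" and l
      assume "\<forall>i. v i < 2 ^ l"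
      then show "f (\<lambda>i. v (\<sigma> i)) < 2 ^ ((l + 2) ^ c)"
        using c boundedD[of c f "\<lambda>i. v (\<sigma> i)" l] unfolding computable_within_def by simp
    qed
    fix \<rho> :: "nat \<Rightarrow> nat" and d
    assume "\<And>i. \<rho> i < d"
    then obtain P where P: "runs c P f (\<lambda>i. \<rho> (\<sigma> i)) d"
      using computable_within_prog[OF c, of "\<lambda>i. \<rho> (\<sigma> i)" d] by blast
    have "runs c P (\<lambda>v. f (\<lambda>i. v (\<sigma> i))) \<rho> d"
      unfolding runs_def
    proof (intro allI impI)
      fix s :: "nat \<Rightarrow> nat" and l
      assume "\<forall>i\<ge>d. s i = 0" "\<forall>i. s (\<rho> i) < 2 ^ l"
      then show "exec (2 ^ ((l + 2) ^ c)) P s (s(d := f (\<lambda>i. s (\<rho> (\<sigma> i)))))"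
        using runsD[OF P, of s l] by simp
    qed
    then show "\<exists>P. runs c P (\<lambda>v. f (\<lambda>i. v (\<sigma> i))) \<rho> d"
      by blast
  qed
qed

lemma computable_shift: "computable f \<Longrightarrow> computable (\<lambda>v. f (\<lambda>i. v (Suc i)))"
  by (rule computable_rename)

text \<open>The number \<open>n v\<close> of rounds may be exponential since time is free. Only the
  values along the way must be of polynomial length, so \<open>b\<close> needs a bound but not a
  program. The step reads the accumulator at index 0 and the round at index 1.\<close>

lemma computable_rec:
  assumes n: "computable n" and z: "computable z"
    and s: "computable (\<lambda>v. s (\<lambda>i. v (Suc (Suc i))) (v 0) (v (Suc 0)))" and b: "quasipoly b"
    and F0: "\<And>v. F v 0 = z v"
    and FS: "\<And>v k. k < n v \<Longrightarrow> F v (Suc k) = s v (F v k) k"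
    and Fb: "\<And>v k. k \<le> n v \<Longrightarrow> F v k \<le> b v"
  shows "computable (\<lambda>v. F v (n v))"
proof -
  let ?s = "\<lambda>v. s (\<lambda>i. v (Suc (Suc i))) (v 0) (v (Suc 0))"
  obtain cn cz cs cb where c0: "computable_within cn n" "computable_within cz z" "computable_within cs ?s" "bounded cb b"
    using n z s b unfolding computable_def quasipoly_def by blast
  define c where "c = cn + cz + cb + 1"
  \<comment> \<open>The step function sees arguments up to \<open>2 ^ ((l + 2) ^ c)\<close>, which
    by \<open>comp_tower\<close> costs the exponent \<open>(c + 2) * cs\<close>; the summand
    \<open>c\<close> covers the other programs.\<close>
  define C where "C = (c + 2) * cs + c"
  have c: "computable_within c n" "computable_within c z" "bounded c b" "bounded c n"
    using c0 computable_within_mono[of _ _ c] bounded_mono[of _ _ c] unfolding c_def computable_within_def by auto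
  have c1: "\<exists>c'. c = Suc c'"
    by (simp add: c_def)
  show ?thesis
  proof (rule cfI)
    show "bounded C (\<lambda>v. F v (n v))"
      unfolding bounded_def
    proof (intro allI impI)
      fix v :: "nat \<Rightarrow> nat" and l
      assume v: "\<forall>i. v i < 2 ^ l"
      have "F v (n v) \<le> b v"
        by (rule Fb) simp
      also have "\<dots> < 2 ^ ((l + 2) ^ c)"
        using c(3) v unfolding bounded_def by blast
      also have "\<dots> \<le> 2 ^ ((l + 2) ^ C)"
        by (rule tower_le) (simp add: C_def)
      finally show "F v (n v) < 2 ^ ((l + 2) ^ C)" .
    qed
    fix \<rho> :: "nat \<Rightarrow> nat" and d
    assume \<rho>: "\<And>i. \<rho> i < d"
    let ?\<rho> = "case_nat (Suc d) (case_nat (Suc (Suc d)) \<rho>)"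
    have \<rho>1: "\<And>i. \<rho> i < Suc d" "\<And>i. ?\<rho> i < d + 3"
      using \<rho> by (auto split: nat.splits simp: less_SucI trans_less_add1)
    obtain Pn where "runs c Pn n \<rho> d"
      using computable_within_prog[where \<rho> = \<rho> and d = d, OF c(1) \<rho>] by blast
    note Pn = runsD[OF this]
    obtain Pz where "runs c Pz z \<rho> (Suc d)"
      using computable_within_prog[where \<rho> = \<rho> and d = "Suc d", OF c(2) \<rho>1(1)] by blast
    note Pz = runsD[OF this]
    obtain Ps where "runs cs Ps ?s ?\<rho> (d + 3)"
      using computable_within_prog[where \<rho> = ?\<rho> and d = "d + 3", OF c0(3) \<rho>1(2)] by blast
    note Ps = runsD[OF this]
    \<comment> \<open>Register \<open>d\<close> counts the remaining rounds, \<open>d + 1\<close> is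
      the accumulator, \<open>d + 2\<close> counts the finished rounds, and \<open>d + 3\<close>
      receives the new value.\<close>
    define B where
      "B = Ps ;; Clear (Suc d) ;; Move (d + 3) (Suc d) ;; Inc (Suc (Suc d)) ;; Dec d"
    have "exec (2 ^ ((l + 2) ^ C)) (Pn ;; Pz ;; While d B ;; Clear (Suc (Suc d)) ;; Move (Suc d) d) s
        (s(d := F (\<lambda>i. s (\<rho> i)) (n (\<lambda>i. s (\<rho> i)))))"
      if s0: "\<forall>i\<ge>d. s i = 0" and sl: "\<forall>i. s (\<rho> i) < 2 ^ l" for s l
    proof -
      define v where "v = (\<lambda>i. s (\<rho> i))"
      define N :: nat where "N = 2 ^ ((l + 2) ^ C)"
      define S where "S j = s(d := n v - j, Suc d := F v j, Suc (Suc d) := j)" for j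
      have N1: "(2::nat) ^ ((l + 2) ^ c) \<le> N"
        unfolding N_def by (rule tower_le) (simp add: C_def)
      have N2: "2 ^ (((l + 2) ^ c + 2) ^ cs) \<le> N"
        unfolding N_def by (rule order_trans[OF comp_tower tower_le]) (simp add: C_def)
      have v: "v i < 2 ^ l" "v i < 2 ^ ((l + 2) ^ c)" for i
        using sl env_le_tower c1 unfolding v_def by metis+
      have nv: "n v < 2 ^ ((l + 2) ^ c)"
        using c(4) v(1) by (rule boundedD)
      have Fv: "F v j < 2 ^ ((l + 2) ^ c)" if "j \<le> n v" for j
        using Fb[OF that] boundedD[OF c(3) v(1)] by (rule le_less_trans)
      have A: "exec N Pn s (s(d := n v))"
        using Pn[of s l] s0 sl unfolding v_def by (intro exec_mono[OF _ N1]) auto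
      have B: "exec N Pz (s(d := n v)) (S 0)"
      proof -
        have env: "(\<lambda>i. (s(d := n v)) (\<rho> i)) = v"
          using \<rho> unfolding v_def by (metis fun_upd_other nat_neq_iff)
        moreover have "S 0 = s(d := n v, Suc d := z v)"
          using s0 by (auto simp: S_def F0)
        moreover have "\<And>i. Suc d \<le> i \<Longrightarrow> (s(d := n v)) i = 0"
          using s0 by simp
        ultimately show ?thesis
          using Pz[of "s(d := n v)" l] s0 v(1) fun_cong[OF env] env
          by (intro exec_mono[OF _ N1]) (simp del: fun_upd_apply)
      qed
      have C: "exec N (While d B) (S 0) (S (n v))"
      proof (rule exec_While_chain)
        fix j assume j: "j < n v"
        have env: "(\<lambda>i. S j (?\<rho> i)) = case_nat (F v j) (case_nat j v)"
        proof
          fix i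
          have "\<rho> i' \<noteq> d" "\<rho> i' \<noteq> Suc d" "\<rho> i' \<noteq> Suc (Suc d)" for i'
            using \<rho>[of i'] by auto
          then show "S j (?\<rho> i) = case_nat (F v j) (case_nat j v) i"
            by (auto simp: S_def v_def split: nat.splits)
        qed
        have lt: "case_nat (F v j) (case_nat j v) i < 2 ^ ((l + 2) ^ c)" for i
          using Fv[of j] nv j v(2) by (auto split: nat.splits)
        have "?s (\<lambda>i. S j (?\<rho> i)) = ?s (case_nat (F v j) (case_nat j v))"
          by (rule arg_cong[OF env])
        also have "\<dots> = F v (Suc j)"
          using FS[OF j] by simp
        finally have eq: "?s (\<lambda>i. S j (?\<rho> i)) = F v (Suc j)" .
        have "exec (2 ^ (((l + 2) ^ c + 2) ^ cs)) Ps (S j) ((S j)(d + 3 := ?s (\<lambda>i. S j (?\<rho> i))))"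
        proof (rule Ps)
          show "S j i = 0" if "d + 3 \<le> i" for i
            using s0 that by (simp add: S_def)
          show "S j (?\<rho> i) < 2 ^ ((l + 2) ^ c)" for i
            using lt[of i] fun_cong[OF env, of i] by (simp only:)
        qed
        then have 1: "exec N Ps (S j) ((S j)(d + 3 := F v (Suc j)))"
          unfolding eq by (rule exec_mono[OF _ N2])
        have 2: "exec N (Clear (Suc d)) ((S j)(d + 3 := F v (Suc j)))
            ((S j)(d + 3 := F v (Suc j), Suc d := 0))"
          by (rule exec_Clear)
        have "((S j)(d + 3 := F v (Suc j), Suc d := 0)) (d + 3) \<le> N"
          using Fv[of "Suc j"] j N1 by simp
        then have "exec N (Move (d + 3) (Suc d)) ((S j)(d + 3 := F v (Suc j), Suc d := 0))
            ((S j)(d + 3 := F v (Suc j), Suc d := 0, d + 3 := 0, Suc d := F v (Suc j)))"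
          using exec_Move[of "d + 3" "Suc d" "(S j)(d + 3 := F v (Suc j), Suc d := 0)" N] by simp
        moreover have "(S j)(d + 3 := F v (Suc j), Suc d := 0, d + 3 := 0, Suc d := F v (Suc j)) =
            (S j)(Suc d := F v (Suc j))"
          using s0 by (auto simp: S_def)
        ultimately have 3: "exec N (Move (d + 3) (Suc d)) ((S j)(d + 3 := F v (Suc j), Suc d := 0))
            ((S j)(Suc d := F v (Suc j)))"
          by simp
        have "Suc j \<le> N"
          using j nv N1 by simp
        then have 4: "exec N (Inc (Suc (Suc d))) ((S j)(Suc d := F v (Suc j)))
            ((S j)(Suc d := F v (Suc j), Suc (Suc d) := Suc j))"
          using exec_Inc[of "(S j)(Suc d := F v (Suc j))" "Suc (Suc d)" N] by (simp add: S_def)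
        have 5: "exec N (Dec d) ((S j)(Suc d := F v (Suc j), Suc (Suc d) := Suc j)) (S (Suc j))"
        proof -
          have "S (Suc j) = (S j)(Suc d := F v (Suc j), Suc (Suc d) := Suc j, d := n v - j - 1)"
            by (auto simp: S_def)
          then show ?thesis
            using exec_Dec[of N d "(S j)(Suc d := F v (Suc j), Suc (Suc d) := Suc j)"]
            by (simp add: S_def)
        qed
        show "exec N B (S j) (S (Suc j))"
          unfolding B_def by (rule exec_Seq[OF 1 exec_Seq[OF 2 exec_Seq[OF 3 exec_Seq[OF 4 5]]]])
      qed (simp add: S_def)
      have D: "exec N (Clear (Suc (Suc d))) (S (n v)) (s(Suc d := F v (n v)))"
      proof -
        have "s(Suc d := F v (n v)) = (S (n v))(Suc (Suc d) := 0)"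
          using s0 by (auto simp: S_def)
        then show ?thesis
          using exec_Clear by simp
      qed
      have E: "exec N (Move (Suc d) d) (s(Suc d := F v (n v))) (s(d := F v (n v)))"
      proof -
        have "s(d := F v (n v)) = s(Suc d := F v (n v), Suc d := 0, d := F v (n v))"
          using s0 by auto
        then show ?thesis
          using exec_Move[of "Suc d" d "s(Suc d := F v (n v))" N] s0 Fv[of "n v"] N1 by simp
      qed
      show ?thesis
        unfolding v_def[symmetric] N_def[symmetric]
        by (rule exec_Seq[OF A exec_Seq[OF B exec_Seq[OF C exec_Seq[OF D E]]]])
    qed
    then show "\<exists>P. runs C P (\<lambda>v. F v (n v)) \<rho> d"
      unfolding runs_def by blast
  qed
qed

section \<open>Arithmetic and logic from bounded recursion\<close>

lemma quasipoly_max: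
  assumes "quasipoly f" "quasipoly g"
  obtains c where "bounded c f" "bounded c g"
  using assms bounded_mono[of _ _ "max _ _"] unfolding quasipoly_def
  by (metis max.cobounded1 max.cobounded2)

lemma double_tower: "2 * (l + 2) ^ c \<le> (l + 2 :: nat) ^ Suc c"
proof -
  have "2 * (l + 2) ^ c \<le> (l + 2) * (l + 2) ^ c"
    by (intro mult_le_mono1) simp
  then show ?thesis by simp
qed

lemma quasipoly_mult:
  assumes "quasipoly f" "quasipoly g"
  shows "quasipoly (\<lambda>v. f v * g v)"
proof -
  obtain c where c: "bounded c f" "bounded c g"
    using assms by (rule quasipoly_max)
  have "bounded (Suc c) (\<lambda>v. f v * g v)"
    unfolding bounded_def
  proof (intro allI impI)
    fix v :: "nat \<Rightarrow> nat" and l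
    assume "\<forall>i. v i < 2 ^ l"
    then have "f v < 2 ^ ((l + 2) ^ c)" "g v < 2 ^ ((l + 2) ^ c)"
      using c unfolding bounded_def by blast+
    then have "f v * g v < 2 ^ ((l + 2) ^ c) * 2 ^ ((l + 2) ^ c)"
      by (intro mult_strict_mono) auto
    also have "\<dots> = 2 ^ (2 * (l + 2) ^ c)"
      by (simp only: power_add[symmetric] mult_2)
    also have "\<dots> \<le> 2 ^ ((l + 2) ^ Suc c)"
      by (intro power_increasing double_tower) simp
    finally show "f v * g v < 2 ^ ((l + 2) ^ Suc c)" .
  qed
  then show ?thesis
    unfolding quasipoly_def by blast
qed

lemma quasipoly_add:
  assumes "quasipoly f" "quasipoly g"
  shows "quasipoly (\<lambda>v. f v + g v)"
proof -
  obtain c where c: "bounded c f" "bounded c g"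
    using assms by (rule quasipoly_max)
  have "bounded (Suc c) (\<lambda>v. f v + g v)"
    unfolding bounded_def
  proof (intro allI impI)
    fix v :: "nat \<Rightarrow> nat" and l
    assume "\<forall>i. v i < 2 ^ l"
    then have "f v < 2 ^ ((l + 2) ^ c)" "g v < 2 ^ ((l + 2) ^ c)"
      using c unfolding bounded_def by blast+
    then have "f v + g v < 2 ^ Suc ((l + 2) ^ c)"
      by simp
    also have "\<dots> \<le> 2 ^ ((l + 2) ^ Suc c)"
      using double_tower[of l c] one_le_power[of "l + 2" c] by (intro power_increasing) linarith+
    finally show "f v + g v < 2 ^ ((l + 2) ^ Suc c)" .
  qed
  then show ?thesis
    unfolding quasipoly_def by blast
qed

lemma computable_shift2: "computable f \<Longrightarrow> computable (\<lambda>v. f (\<lambda>i. v (Suc (Suc i))))"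
  by (rule computable_rename)

lemma computable_const [computable_intros]: "computable (\<lambda>v. c)"
  by (induction c) (auto intro: computable_0 computable_Suc)

lemma computable_add [computable_intros]:
  assumes "computable f" "computable g"
  shows "computable (\<lambda>v. f v + g v)"
  by (rule computable_rec[where F = "\<lambda>v k. f v + k" and n = g and z = f and s = "\<lambda>v acc k. Suc acc" and b = "\<lambda>v. f v + g v"])
    (auto intro: assms computable_intros quasipoly_add[OF assms[THEN computable_imp_quasipoly]])

lemma computable_mult [computable_intros]:
  assumes "computable f" "computable g"
  shows "computable (\<lambda>v. f v * g v)"
proof (rule computable_rec[where F = "\<lambda>v k. f v * k" and n = g and z = "\<lambda>v. 0"
      and s = "\<lambda>v acc k. acc + f v" and b = "\<lambda>v. f v * g v"])
  show "computable (\<lambda>v. v 0 + f (\<lambda>i. v (Suc (Suc i))))"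
    by (intro computable_add computable_var computable_shift2 assms)
  show "quasipoly (\<lambda>v. f v * g v)"
    by (intro quasipoly_mult computable_imp_quasipoly assms)
qed (use assms in \<open>auto intro: computable_const\<close>)

text \<open>Substitution is a recursion with a single round, started with accumulator
  \<open>f v\<close>; the work lies in bounding the composition.\<close>

lemma computable_let:
  assumes g: "computable (\<lambda>v. g (\<lambda>i. v (Suc i)) (v 0))" and f: "computable f"
  shows "computable (\<lambda>v. g v (f v))"
proof -
  let ?g = "\<lambda>v. g (\<lambda>i. v (Suc i)) (v 0)"
  have b: "quasipoly (\<lambda>v. g v (f v))"
  proof -
    obtain a c where a: "bounded a f" and c: "bounded c ?g"
      using computable_imp_quasipoly[OF f] computable_imp_quasipoly[OF g] unfolding quasipoly_def by blast
    have "bounded ((Suc a + 2) * c) (\<lambda>v. g v (f v))"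
      unfolding bounded_def
    proof (intro allI impI)
      fix v :: "nat \<Rightarrow> nat" and l
      assume v: "\<forall>i. v i < 2 ^ l"
      have "f v < 2 ^ ((l + 2) ^ Suc a)"
        using boundedD[OF bounded_mono[OF a, of "Suc a"], of v l] v by simp
      then have "case_nat (f v) v i < 2 ^ ((l + 2) ^ Suc a)" for i
        using v env_le_tower by (auto split: nat.splits simp del: power_Suc)
      then have "?g (case_nat (f v) v) < 2 ^ (((l + 2) ^ Suc a + 2) ^ c)"
        by (rule boundedD[OF c])
      then have "g v (f v) < 2 ^ (((l + 2) ^ Suc a + 2) ^ c)"
        by (simp only: nat.case)
      also have "\<dots> \<le> 2 ^ ((l + 2) ^ ((Suc a + 2) * c))"
        by (rule comp_tower)
      finally show "g v (f v) < 2 ^ ((l + 2) ^ ((Suc a + 2) * c))" .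
    qed
    then show ?thesis
      unfolding quasipoly_def by blast
  qed
  \<comment> \<open>The renaming skips index 1, where the recursion keeps its round number.\<close>
  have "computable (\<lambda>v. g (\<lambda>i. v (Suc (Suc i))) (v 0))"
    using computable_rename[OF g, of "case_nat 0 (\<lambda>i. Suc (Suc i))"] by simp
  then show ?thesis
    by (intro computable_rec[where F = "\<lambda>v k. if k = 0 then f v else g v (f v)" and n = "\<lambda>v. 1" and z = f
          and s = "\<lambda>v acc k. g v acc" and b = "\<lambda>v. f v + g v (f v)", simplified if_False one_neq_zero])
      (auto intro: f computable_const quasipoly_add[OF computable_imp_quasipoly[OF f] b])
qed

text \<open>The step ignores the accumulator and returns the round number, which lags one
  behind.\<close>

lemma computable_pred: "computable f \<Longrightarrow> computable (\<lambda>v. f v - Suc 0)"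
  by (rule computable_rec[where F = "\<lambda>v k. k - Suc 0" and n = f and z = "\<lambda>v. 0" and s = "\<lambda>v acc k. k" and b = f])
    (auto intro!: computable_intros computable_imp_quasipoly)

lemma computable_diff [computable_intros]:
  assumes "computable f" "computable g"
  shows "computable (\<lambda>v. f v - g v)"
  by (rule computable_rec[where F = "\<lambda>v k. f v - k" and n = g and z = f and s = "\<lambda>v acc k. acc - Suc 0" and b = f])
    (auto intro!: assms computable_intros computable_pred computable_imp_quasipoly)

lemma computable_not [computable_intros]:
  assumes "computable (\<lambda>v. of_bool (P v))"
  shows "computable (\<lambda>v. of_bool (\<not> P v))"
proof -
  have "computable (\<lambda>v. 1 - of_bool (P v))"
    by (intro computable_intros assms)
  also have "(\<lambda>v. 1 - of_bool (P v)) = (\<lambda>v. of_bool (\<not> P v) :: nat)"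
    by auto
  finally show ?thesis .
qed

lemma computable_conj [computable_intros]:
  assumes "computable (\<lambda>v. of_bool (P v))" "computable (\<lambda>v. of_bool (Q v))"
  shows "computable (\<lambda>v. of_bool (P v \<and> Q v))"
proof -
  have "computable (\<lambda>v. of_bool (P v) * of_bool (Q v))"
    by (intro computable_intros assms)
  also have "(\<lambda>v. of_bool (P v) * of_bool (Q v)) = (\<lambda>v. of_bool (P v \<and> Q v) :: nat)"
    by auto
  finally show ?thesis .
qed

lemma computable_disj [computable_intros]:
  assumes "computable (\<lambda>v. of_bool (P v))" "computable (\<lambda>v. of_bool (Q v))"
  shows "computable (\<lambda>v. of_bool (P v \<or> Q v))"
proof -
  have "computable (\<lambda>v. of_bool (\<not> (\<not> P v \<and> \<not> Q v)))"
    by (intro computable_not computable_conj assms)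
  then show ?thesis
    by (simp only: de_Morgan_conj not_not)
qed

lemma computable_imp [computable_intros]:
  assumes "computable (\<lambda>v. of_bool (P v))" "computable (\<lambda>v. of_bool (Q v))"
  shows "computable (\<lambda>v. of_bool (P v \<longrightarrow> Q v))"
proof -
  have "computable (\<lambda>v. of_bool (\<not> P v \<or> Q v))"
    by (intro computable_not computable_disj assms)
  then show ?thesis
    by (simp only: imp_conv_disj)
qed

lemma computable_le [computable_intros]:
  assumes "computable f" "computable g"
  shows "computable (\<lambda>v. of_bool (f v \<le> g v))"
proof -
  have "computable (\<lambda>v. 1 - (f v - g v))"
    by (intro computable_intros assms)
  also have "(\<lambda>v. 1 - (f v - g v)) = (\<lambda>v. of_bool (f v \<le> g v) :: nat)"
    by auto
  finally show ?thesis .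
qed

lemma computable_less [computable_intros]:
  assumes "computable f" "computable g"
  shows "computable (\<lambda>v. of_bool (f v < g v))"
  using computable_le[OF computable_Suc[OF assms(1)] assms(2)] by (simp add: Suc_le_eq)

lemma computable_eq [computable_intros]:
  assumes "computable f" "computable g"
  shows "computable (\<lambda>v. of_bool (f v = g v))"
  unfolding eq_iff by (intro computable_intros assms)

lemma computable_if [computable_intros]:
  assumes "computable (\<lambda>v. of_bool (P v))" "computable f" "computable g"
  shows "computable (\<lambda>v. if P v then f v else g v)"
proof -
  have "computable (\<lambda>v. of_bool (P v) * f v + of_bool (\<not> P v) * g v)"
    by (intro computable_intros assms)
  also have "(\<lambda>v. of_bool (P v) * f v + of_bool (\<not> P v) * g v) = (\<lambda>v. if P v then f v else g v)"
    by auto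
  finally show ?thesis .
qed

lemma computable_min [computable_intros]: "computable f \<Longrightarrow> computable g \<Longrightarrow> computable (\<lambda>v. min (f v) (g v))"
  unfolding min_def by (intro computable_intros)

text \<open>The range \<open>n v\<close> may be exponential: the search keeps a single bit. This is
  how guesses are made deterministic.\<close>

lemma computable_ex [computable_intros]:
  assumes "computable n" "computable (\<lambda>v. of_bool (P (\<lambda>i. v (Suc i)) (v 0)))"
  shows "computable (\<lambda>v. of_bool (\<exists>x<n v. P v x))"
proof -
  have s: "computable (\<lambda>v. of_bool (1 \<le> v 0 \<or> P (\<lambda>i. v (Suc (Suc i))) (v (Suc 0))))"
    by (intro computable_disj computable_le computable_const computable_var computable_shift[OF assms(2)])
  show ?thesis
    by (rule computable_rec[where F = "\<lambda>v k. of_bool (\<exists>x<k. P v x)" and n = n and z = "\<lambda>v. 0"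
          and s = "\<lambda>v acc k. of_bool (1 \<le> acc \<or> P v k)" and b = "\<lambda>v. 1"])
      (use assms(1) s in \<open>auto intro: computable_const computable_imp_quasipoly[OF computable_const]
        simp: less_Suc_eq simp del: of_bool_or_iff\<close>)
qed

lemma computable_all [computable_intros]:
  assumes "computable n" "computable (\<lambda>v. of_bool (P (\<lambda>i. v (Suc i)) (v 0)))"
  shows "computable (\<lambda>v. of_bool (\<forall>x<n v. P v x))"
proof -
  have "computable (\<lambda>v. of_bool (\<not> (\<exists>x<n v. \<not> P v x)))"
    by (intro computable_not computable_ex assms)
  then show ?thesis
    by (simp only: not_ex de_Morgan_conj not_not imp_conv_disj)
qed

text \<open>Counting with a reset at \<open>g v\<close>; for \<open>g v = 0\<close> the reset never
  happens, in accordance with \<open>k mod 0 = k\<close>.\<close>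

lemma computable_mod [computable_intros]:
  assumes "computable f" "computable g"
  shows "computable (\<lambda>v. f v mod g v)"
proof -
  note g = computable_shift2[OF assms(2)]
  show ?thesis
    by (rule computable_rec[where F = "\<lambda>v k. k mod g v" and n = f and z = "\<lambda>v. 0" and b = f
          and s = "\<lambda>v acc k. if Suc acc = g v then 0 else Suc acc"])
      (auto intro!: assms g computable_intros computable_imp_quasipoly simp: mod_Suc intro: le_trans[OF mod_less_eq_dividend])
qed

lemma computable_div [computable_intros]:
  assumes "computable f" "computable g"
  shows "computable (\<lambda>v. f v div g v)"
proof -
  note g = computable_shift2[OF assms(2)]
  show ?thesis
    by (rule computable_rec[where F = "\<lambda>v k. k div g v" and n = f and z = "\<lambda>v. 0" and b = f
          and s = "\<lambda>v acc k. if Suc k mod g v = 0 then Suc acc else acc"])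
      (auto intro!: assms g computable_intros computable_imp_quasipoly simp: div_Suc intro: le_trans[OF div_le_dividend])
qed

text \<open>The power itself may be too long to be written down; dividing repeatedly never exceeds
  \<open>f v\<close>.\<close>

lemma computable_div_power:
  assumes "computable f" "computable g" "computable h"
  shows "computable (\<lambda>v. f v div g v ^ h v)"
proof -
  note g = computable_shift2[OF assms(2)]
  show ?thesis
    by (rule computable_rec[where F = "\<lambda>v k. f v div g v ^ k" and n = h and z = f and b = f and s = "\<lambda>v acc k. acc div g v"])
      (auto intro!: assms g computable_intros computable_imp_quasipoly simp: div_mult2_eq[symmetric] mult.commute)
qed

section \<open>Polynomially bounded quantities\<close>

text \<open>The growth permitted for exponents, string lengths and the depth of games.\<close>

definition polylog :: "((nat \<Rightarrow> nat) \<Rightarrow> nat) \<Rightarrow> bool" where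
  "polylog f \<longleftrightarrow> (\<exists>c. \<forall>v l. (\<forall>i. v i < 2 ^ l) \<longrightarrow> f v \<le> (l + 2) ^ c)"

named_theorems polylog_intros

lemma polylog_mono:
  assumes "polylog g" "\<And>v. f v \<le> g v"
  shows "polylog f"
  using assms le_trans unfolding polylog_def by meson

lemma polylog_const [polylog_intros]: "polylog (\<lambda>v. n)"
proof -
  have "n \<le> (l + 2) ^ n" for l
    using less_exp[of n] power_mono[of 2 "l + 2" n] by simp
  then show ?thesis
    unfolding polylog_def by blast
qed

lemma polylog_mult [polylog_intros]:
  assumes "polylog f" "polylog g"
  shows "polylog (\<lambda>v. f v * g v)"
proof -
  obtain a b where "\<And>v l. (\<forall>i. v i < 2 ^ l) \<Longrightarrow> f v \<le> (l + 2) ^ a"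
    "\<And>v l. (\<forall>i. v i < 2 ^ l) \<Longrightarrow> g v \<le> (l + 2) ^ b"
    using assms unfolding polylog_def by metis
  then have "(\<forall>i. v i < 2 ^ l) \<longrightarrow> f v * g v \<le> (l + 2) ^ (a + b)" for v l
    unfolding power_add by (auto intro!: mult_le_mono)
  then show ?thesis
    unfolding polylog_def by blast
qed

lemma polylog_add [polylog_intros]:
  assumes "polylog f" "polylog g"
  shows "polylog (\<lambda>v. f v + g v)"
proof -
  \<comment> \<open>Sums reduce to products, since \<open>f v + g v\<close> is at most
    \<open>(f v + 1) * (g v + 1)\<close>.\<close>
  have "polylog (\<lambda>v. (f v + 1) * (g v + 1))" if "polylog (\<lambda>v. f v + 1)" "polylog (\<lambda>v. g v + 1)"
    using that by (rule polylog_mult)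
  moreover have "polylog (\<lambda>v. h v + 1)" if h: "polylog h" for h
  proof -
    obtain c where c: "\<And>v l. (\<forall>i. v i < 2 ^ l) \<Longrightarrow> h v \<le> (l + 2) ^ c"
      using h unfolding polylog_def by metis
    have "h v + 1 \<le> (l + 2) ^ Suc c" if "\<forall>i. v i < 2 ^ l" for v l
      using c[OF that] double_tower[of l c] one_le_power[of "l + 2" c] by linarith
    then show ?thesis
      unfolding polylog_def by blast
  qed
  ultimately have "polylog (\<lambda>v. (f v + 1) * (g v + 1))"
    using assms by blast
  then show ?thesis
    by (rule polylog_mono) simp
qed

lemma quasipoly_power:
  assumes "quasipoly f" "polylog g"
  shows "quasipoly (\<lambda>v. f v ^ g v)"
proof -
  obtain a b where a: "bounded a f" and b: "\<And>v l. (\<forall>i. v i < 2 ^ l) \<Longrightarrow> g v \<le> (l + 2) ^ b"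
    using assms unfolding quasipoly_def polylog_def by metis
  have "bounded (Suc (a + b)) (\<lambda>v. f v ^ g v)"
    unfolding bounded_def
  proof (intro allI impI)
    fix v :: "nat \<Rightarrow> nat" and l
    assume v: "\<forall>i. v i < 2 ^ l"
    then have "f v \<le> 2 ^ ((l + 2) ^ a)"
      using a unfolding bounded_def by (blast intro: less_imp_le)
    then have "f v ^ g v \<le> (2 ^ ((l + 2) ^ a)) ^ g v"
      by (intro power_mono) auto
    also have "\<dots> \<le> (2 ^ ((l + 2) ^ a)) ^ ((l + 2) ^ b)"
      using b[OF v] by (intro power_increasing) auto
    also have "\<dots> = 2 ^ ((l + 2) ^ (a + b))"
      by (simp only: power_mult[symmetric] power_add)
    also have "\<dots> < 2 ^ ((l + 2) ^ Suc (a + b))"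
    proof (rule power_strict_increasing)
      show "(l + 2) ^ (a + b) < (l + 2) ^ Suc (a + b)"
        by (rule power_strict_increasing) auto
    qed simp
    finally show "f v ^ g v < 2 ^ ((l + 2) ^ Suc (a + b))" .
  qed
  then show ?thesis
    unfolding quasipoly_def by blast
qed

lemma computable_power [computable_intros]:
  assumes "computable f" "computable g" "polylog g"
  shows "computable (\<lambda>v. f v ^ g v)"
proof -
  note f = computable_shift2[OF assms(1)]
  \<comment> \<open>Raising the base by one keeps powers monotone in the exponent when
    \<open>f v = 0\<close>.\<close>
  have "f v ^ k \<le> (f v + 1) ^ g v" if "k \<le> g v" for v k
  proof -
    have "f v ^ k \<le> (f v + 1) ^ k"
      by (intro power_mono) auto
    also have "\<dots> \<le> (f v + 1) ^ g v"
      using that by (intro power_increasing) auto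
    finally show ?thesis .
  qed
  then show ?thesis
    by (intro computable_rec[where F = "\<lambda>v k. f v ^ k" and n = g and z = "\<lambda>v. 1" and b = "\<lambda>v. (f v + 1) ^ g v"
          and s = "\<lambda>v acc k. f v * acc"])
      (use quasipoly_power[OF computable_imp_quasipoly[OF computable_Suc[OF assms(1)]] assms(3)] in
        \<open>auto intro: assms f computable_const computable_mult computable_var\<close>)
qed

subsection \<open>Computing with strings\<close>

declare bin.simps [simp del]

lemma bin_small: "n < 2 \<Longrightarrow> bin n = [if n = 0 then B0 else B1]"
  by (simp add: bin.simps)

lemma bin_large: "2 \<le> n \<Longrightarrow> bin n = bin (n div 2) @ [if n mod 2 = 0 then B0 else B1]"
  by (simp add: bin.simps[of n])

lemma length_bin_pos [simp]: "0 < length (bin n)"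
  by (cases "n < 2") (auto simp: bin_small bin_large)

lemma less_two_power_length_bin: "n < 2 ^ length (bin n)"
proof (induction n rule: less_induct)
  case (less n)
  show ?case
  proof (cases "n < 2")
    case False
    then have "n div 2 < 2 ^ length (bin (n div 2))"
      by (intro less) simp
    then have "n < 2 * 2 ^ length (bin (n div 2))"
      by linarith
    then show ?thesis
      using False by (simp add: bin_large)
  qed (simp add: bin_small)
qed

lemma two_power_length_bin_le: "0 < n \<Longrightarrow> 2 ^ length (bin n) \<le> 2 * n"
proof (induction n rule: less_induct)
  case (less n)
  show ?case
  proof (cases "n < 2")
    case False
    then have "2 ^ length (bin (n div 2)) \<le> 2 * (n div 2)"
      by (intro less) auto
    then have "2 * 2 ^ length (bin (n div 2)) \<le> 2 * n"
      by linarith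
    then show ?thesis
      using False by (simp add: bin_large)
  qed (use less.prems in \<open>simp add: bin_small\<close>)
qed

lemma two_power_less_length_bin:
  assumes "0 < k" "k < length (bin n)"
  shows "2 ^ k \<le> n"
proof -
  have "0 < n"
    using assms by (cases "n = 0") (auto simp: bin_small)
  have "2 * 2 ^ k \<le> (2::nat) ^ length (bin n)"
    using assms(2) power_increasing[of "Suc k" "length (bin n)" "2::nat"] by simp
  then show ?thesis
    using two_power_length_bin_le[OF \<open>0 < n\<close>] by linarith
qed

lemma length_bin_le: "n < 2 ^ l \<Longrightarrow> length (bin n) \<le> l + 1"
  using two_power_less_length_bin[of "Suc l" n] by (cases "Suc l < length (bin n)") auto

lemma polylog_length_bin [polylog_intros]:
  assumes "quasipoly f"
  shows "polylog (\<lambda>v. length (bin (f v)))"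
proof -
  obtain c where c: "bounded c f"
    using assms unfolding quasipoly_def by blast
  have "length (bin (f v)) \<le> (l + 2) ^ Suc c" if "\<forall>i. v i < 2 ^ l" for v l
  proof -
    have "f v < 2 ^ ((l + 2) ^ c)"
      using c that unfolding bounded_def by blast
    then show ?thesis
      using length_bin_le[of "f v" "(l + 2) ^ c"] double_tower[of l c] one_le_power[of "l + 2" c]
      by linarith
  qed
  then show ?thesis
    unfolding polylog_def by blast
qed

lemma computable_length_bin [computable_intros]:
  assumes "computable f"
  shows "computable (\<lambda>v. length (bin (f v)))"
proof -
  note f = computable_shift2[OF assms]
  let ?L = "\<lambda>v. length (bin (f v))"
  \<comment> \<open>The accumulator climbs from 1 and stops at the first exponent whose power of two
    exceeds \<open>f v\<close>. This is the length, and \<open>f v\<close> rounds are enough to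
    reach it.\<close>
  have "computable (\<lambda>v. min (Suc (f v)) (?L v))"
  proof (rule computable_rec[where F = "\<lambda>v k. min (Suc k) (?L v)" and n = f and z = "\<lambda>v. 1" and b = "\<lambda>v. Suc (f v)"
        and s = "\<lambda>v acc k. if f v div 2 ^ acc = 0 then acc else Suc acc"])
    show "min (Suc 0) (?L v) = 1" for v
      using length_bin_pos[of "f v"] by linarith
    show "min (Suc (Suc k)) (?L v) =
        (if f v div 2 ^ min (Suc k) (?L v) = 0 then min (Suc k) (?L v) else Suc (min (Suc k) (?L v)))"
      for v k
    proof (cases "Suc k < ?L v")
      case True
      then have "2 ^ Suc k \<le> f v"
        by (intro two_power_less_length_bin) auto
      then show ?thesis
        using True by (simp add: div_eq_0_iff)
    next
      case False
      then show ?thesis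
        using less_two_power_length_bin[of "f v"] by simp
    qed
    show "computable (\<lambda>v. if f (\<lambda>i. v (Suc (Suc i))) div 2 ^ v 0 = 0 then v 0 else Suc (v 0))"
      by (intro f computable_if computable_eq computable_div_power computable_const computable_Suc computable_var)
  qed (use assms in \<open>auto intro: computable_const computable_imp_quasipoly[OF computable_Suc]\<close>)
  moreover have "?L v \<le> Suc (f v)" for v
    using length_bin_le[of "f v" "f v"] less_exp[of "f v"] by simp
  ultimately show ?thesis
    by (simp add: min_absorb2)
qed

lemma nv_append [simp]: "nv (s @ t) = nv s + 12 ^ length s * nv t"
  by (induction s) (auto simp: algebra_simps)

lemma nv_less: "nv s < 12 ^ length s"
  
proof (induction s)
  case (Cons a s)
  then show ?case
    using sym_code_bounds(2)[of a] by simp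
qed simp

lemma nv_inject: "nv s = nv t \<longleftrightarrow> s = t"
proof
  show "s = t" if "nv s = nv t"
    using that
  proof (induction s arbitrary: t)
    case Nil
    then show ?case
      using sym_code_bounds by (cases t) (auto, metis less_irrefl)
  next
    case (Cons a s)
    then obtain b u where t: "t = b # u"
      using sym_code_bounds(1)[of a] by (cases t) auto
    have "nv (a # s) mod 12 = sym_code a" "nv (b # u) mod 12 = sym_code b"
      using sym_code_bounds(2) by simp_all
    then have "sym_code a = sym_code b"
      using Cons.prems unfolding t by (simp only:)
    moreover from this have "a = b"
      by (cases a; cases b) auto
    ultimately show ?case
      using Cons t by simp
  qed
qed simp

lemma two_power_length_le_nv: "2 ^ length s \<le> nv s + 1"
proof (induction s)
  case (Cons a s)
  then show ?case
    using sym_code_bounds(1)[of a] by simp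
qed simp

text \<open>A fixed number of low-order bits, highest first. Increasing \<open>k\<close> prepends a
  symbol, which is simple on \<open>nv\<close> values, whereas \<open>bin\<close> recurs by
  appending.\<close>

definition bits :: "nat \<Rightarrow> nat \<Rightarrow> sym list" where
  "bits n k = map (\<lambda>i. if n div 2 ^ i mod 2 = 0 then B0 else B1) (rev [0..<k])"

lemma bits_Suc: "bits n (Suc k) = (if n div 2 ^ k mod 2 = 0 then B0 else B1) # bits n k"
  by (simp add: bits_def)

lemma bits_Suc_half: "bits n (Suc k) = bits (n div 2) k @ [if n mod 2 = 0 then B0 else B1]"
  by (induction k) (auto simp: bits_Suc div_mult2_eq[symmetric], simp_all add: bits_def)

lemma bin_eq_bits: "bin n = bits n (length (bin n))"
proof (induction n rule: less_induct)
  case (less n)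
  show ?case
  proof (cases "n < 2")
    case True
    then show ?thesis
      by (auto simp: bin_small bits_def less_2_cases_iff)
  next
    case False
    then have "bin (n div 2) = bits (n div 2) (length (bin (n div 2)))"
      by (intro less) simp
    then show ?thesis
      using False by (simp add: bin_large bits_Suc_half)
  qed
qed

lemma computable_nv_bin:
  assumes "computable f"
  shows "computable (\<lambda>v. nv (bin (f v)))"
proof -
  note f = computable_shift2[OF assms]
  have "computable (\<lambda>v. nv (bits (f v) (length (bin (f v)))))"
  proof (rule computable_rec[where F = "\<lambda>v k. nv (bits (f v) k)"
        and n = "\<lambda>v. length (bin (f v))" and z = "\<lambda>v. 0"
        and b = "\<lambda>v. 12 ^ length (bin (f v))"
        and s = "\<lambda>v acc k. (if f v div 2 ^ k mod 2 = 0 then 1 else 2) + 12 * acc"])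
    show "nv (bits (f v) k) \<le> 12 ^ length (bin (f v))" if "k \<le> length (bin (f v))" for v k
    proof -
      have "nv (bits (f v) k) < 12 ^ k"
        using nv_less[of "bits (f v) k"] by (simp add: bits_def)
      also have "\<dots> \<le> 12 ^ length (bin (f v))"
        using that by (intro power_increasing) auto
      finally show ?thesis by simp
    qed
    show "quasipoly (\<lambda>v. 12 ^ length (bin (f v)))"
      by (intro quasipoly_power polylog_intros computable_imp_quasipoly computable_const assms)
    show "computable (\<lambda>v. (if f (\<lambda>i. v (Suc (Suc i))) div 2 ^ v (Suc 0) mod 2 = 0 then 1 else 2) + 12 * v 0)"
      by (intro computable_add computable_mult computable_if computable_eq computable_mod computable_div_power computable_const computable_var f)
  qed (auto intro: assms computable_const computable_length_bin simp: bits_Suc, simp add: bits_def)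
  then show ?thesis
    by (simp only: bin_eq_bits[symmetric])
qed

text \<open>Appending multiplies a code by 12 to the length of the first string: the length must be
  computable, and \<open>polylog\<close> for that power to be computable.\<close>

definition string_computable :: "((nat \<Rightarrow> nat) \<Rightarrow> sym list) \<Rightarrow> bool" where
  "string_computable f \<longleftrightarrow> computable (\<lambda>v. nv (f v)) \<and> computable (\<lambda>v. length (f v)) \<and> polylog (\<lambda>v. length (f v))"

lemma string_computable_const: "string_computable (\<lambda>v. s)"
  unfolding string_computable_def by (intro conjI computable_intros polylog_intros)

lemma string_computable_bin: "computable f \<Longrightarrow> string_computable (\<lambda>v. bin (f v))"
  unfolding string_computable_def by (intro conjI computable_intros polylog_intros computable_nv_bin computable_imp_quasipoly)

lemma string_computable_append:
  assumes "string_computable f" "string_computable g"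
  shows "string_computable (\<lambda>v. f v @ g v)"
  using assms unfolding string_computable_def nv_append length_append
  by (elim conjE) (intro conjI computable_intros polylog_intros)

lemma string_computable_if:
  assumes "computable (\<lambda>v. of_bool (P v))" "string_computable f" "string_computable g"
  shows "string_computable (\<lambda>v. if P v then f v else g v)"
proof -
  have "polylog (\<lambda>v. length (f v) + length (g v))"
    using assms unfolding string_computable_def by (intro polylog_intros) auto
  then have "polylog (\<lambda>v. if P v then length (f v) else length (g v))"
    by (rule polylog_mono) simp
  moreover have "computable (\<lambda>v. if P v then nv (f v) else nv (g v))"
    "computable (\<lambda>v. if P v then length (f v) else length (g v))"
    using assms unfolding string_computable_def by (intro computable_intros; simp)+
  ultimately show ?thesis
    unfolding string_computable_def by (simp add: if_distrib)
qed

lemma length_concat_le: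
  "(\<And>x. x \<in> set xs \<Longrightarrow> length (g x) \<le> L) \<Longrightarrow> length (concat (map g xs)) \<le> length xs * L"
  by (induction xs) (auto simp: add_mono)

lemma string_computable_concat:
  assumes g: "string_computable (\<lambda>v. g (\<lambda>i. v (Suc i)) (v 0))" and m: "computable m" "polylog m"
    and L: "polylog L" "\<And>v i. length (g v i) \<le> L v"
  shows "string_computable (\<lambda>v. concat (map (g v) [0..<m v]))"
proof -
  \<comment> \<open>Pieces are prepended, last one first, so the shift needs only the length of the
    new piece and not that of the accumulated string.\<close>
  define h where "h v k = concat (map (g v) [m v - k..<m v])" for v k
  have h0: "h v 0 = []" for v
    by (simp add: h_def)
  have hS: "h v (Suc k) = g v (m v - Suc k) @ h v k" if "k < m v" for v k
  proof -
    have "[m v - Suc k..<m v] = (m v - Suc k) # [m v - k..<m v]"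
      using that by (simp add: upt_conv_Cons Suc_diff_Suc)
    then show ?thesis
      by (simp add: h_def)
  qed
  have hL: "length (h v k) \<le> m v * L v" for v k
  proof -
    have "length (h v k) \<le> length [m v - k..<m v] * L v"
      unfolding h_def by (rule length_concat_le) (rule L)
    also have "\<dots> \<le> m v * L v"
      by (rule mult_le_mono1) simp
    finally show ?thesis .
  qed
  have mL: "polylog (\<lambda>v. m v * L v)"
    by (intro polylog_intros m L)
  then have pL: "quasipoly (\<lambda>v. 12 ^ (m v * L v))"
    by (intro quasipoly_power computable_imp_quasipoly computable_const)
  have sub: "computable (\<lambda>v. a (\<lambda>i. v (Suc (Suc i))) (m (\<lambda>i. v (Suc (Suc i))) - Suc (v (Suc 0))))"
    if "computable (\<lambda>v. a (\<lambda>i. v (Suc i)) (v 0))" for a :: "(nat \<Rightarrow> nat) \<Rightarrow> nat \<Rightarrow> nat"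
  proof -
    have "computable (\<lambda>v. a (\<lambda>i. v (Suc (Suc (Suc i)))) (v 0))"
      using computable_rename[OF that, of "case_nat 0 (\<lambda>i. Suc (Suc (Suc i)))"] by simp
    then show ?thesis
      by (rule computable_let) (intro computable_intros computable_shift2 m)
  qed
  have gn: "computable (\<lambda>v. nv (g (\<lambda>i. v (Suc i)) (v 0)))" "computable (\<lambda>v. length (g (\<lambda>i. v (Suc i)) (v 0)))"
    "polylog (\<lambda>v. length (g (\<lambda>i. v (Suc i)) (v 0)))"
    using g unfolding string_computable_def by auto
  have pw: "computable (\<lambda>v. 12 ^ length (g (\<lambda>i. v (Suc i)) (v 0)))"
    by (intro computable_intros gn)
  have len: "computable (\<lambda>v. length (h v (m v)))"
  proof (rule computable_rec[where F = "\<lambda>v k. length (h v k)" and n = m and z = "\<lambda>v. 0" and b = "\<lambda>v. 12 ^ (m v * L v)"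
        and s = "\<lambda>v acc k. length (g v (m v - Suc k)) + acc"])
    show "computable (\<lambda>v. length (g (\<lambda>i. v (Suc (Suc i))) (m (\<lambda>i. v (Suc (Suc i))) - Suc (v (Suc 0)))) + v 0)"
      by (intro computable_add computable_var sub[where a = "\<lambda>v i. length (g v i)"] gn)
    show "length (h v k) \<le> 12 ^ (m v * L v)" for v k
      using hL[of v k] power_gt_expt[of 12 "m v * L v"] by simp
  qed (auto intro: m computable_const pL simp: h0 hS)
  have "computable (\<lambda>v. nv (h v (m v)))"
  proof (rule computable_rec[where F = "\<lambda>v k. nv (h v k)" and n = m and z = "\<lambda>v. 0" and b = "\<lambda>v. 12 ^ (m v * L v)"
        and s = "\<lambda>v acc k. nv (g v (m v - Suc k)) + 12 ^ length (g v (m v - Suc k)) * acc"])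
    show "computable (\<lambda>v. nv (g (\<lambda>i. v (Suc (Suc i))) (m (\<lambda>i. v (Suc (Suc i))) - Suc (v (Suc 0)))) +
        12 ^ length (g (\<lambda>i. v (Suc (Suc i))) (m (\<lambda>i. v (Suc (Suc i))) - Suc (v (Suc 0)))) * v 0)"
      by (intro computable_add computable_mult computable_var sub[where a = "\<lambda>v i. nv (g v i)"]
          sub[where a = "\<lambda>v i. 12 ^ length (g v i)"] gn pw)
    show "nv (h v k) \<le> 12 ^ (m v * L v)" for v k
    proof -
      have "nv (h v k) < 12 ^ length (h v k)"
        by (rule nv_less)
      also have "\<dots> \<le> 12 ^ (m v * L v)"
        by (intro power_increasing hL) simp
      finally show ?thesis by simp
    qed
  qed (auto intro: m computable_const pL simp: h0 hS)
  moreover have "polylog (\<lambda>v. length (h v (m v)))"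
    by (rule polylog_mono[OF mL hL])
  ultimately have "string_computable (\<lambda>v. h v (m v))"
    using len unfolding string_computable_def by blast
  then show ?thesis
    by (simp add: h_def)
qed

subsection \<open>Games of polynomial length\<close>

text \<open>The player who cannot move loses. The budget \<open>k\<close> makes this well-founded
  whatever \<open>R\<close> is; once it is spent, the player to move loses.\<close>

fun wins :: "(nat \<Rightarrow> nat \<Rightarrow> bool) \<Rightarrow> nat \<Rightarrow> nat \<Rightarrow> nat \<Rightarrow> bool" where
  "wins R B 0 p = False"
| "wins R B (Suc k) p = (\<exists>q<B. R p q \<and> \<not> wins R B k q)"

text \<open>Depth-first search of the game tree: a state \<open>c # p # ps\<close> is the path \<open>p # ps\<close> from the
  current position back to the root, together with the next candidate move \<open>c\<close> at \<open>p\<close>;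
  the final states are \<open>[0]\<close> and \<open>[1]\<close>.\<close>

fun won :: "nat \<Rightarrow> nat list \<Rightarrow> nat list" where
  "won p [] = [1]"
| "won p (q # ps) = Suc p # q # ps"

text \<open>If the top position is lost, moving there wins for its predecessor \<open>q\<close>,
  whose other candidates need not be tried: two levels are popped.\<close>

fun lost :: "nat list \<Rightarrow> nat list" where
  "lost [] = [0]"
| "lost (q # ps) = won q ps"

text \<open>The path replaces a move counter: \<open>k - length ps\<close> moves are left at
  \<open>p\<close>.\<close>

fun dfs_step :: "(nat \<Rightarrow> nat \<Rightarrow> bool) \<Rightarrow> nat \<Rightarrow> nat \<Rightarrow> nat list \<Rightarrow> nat list" where
  "dfs_step R B k (c # p # ps) =
     (if B \<le> c \<or> k \<le> length ps then lost ps
      else if R p c then 0 # c # p # ps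
      else Suc c # p # ps)"
| "dfs_step R B k xs = xs"

lemma funpow_trans:
  "(f ^^ m) x = y \<Longrightarrow> (f ^^ n) y = z \<Longrightarrow> (f ^^ (n + m)) x = z"
  by (simp add: funpow_add)

text \<open>Outer induction on the number \<open>d\<close> of moves left, inner induction downwards
  on the next candidate \<open>c\<close>. Writing \<open>d = Suc e\<close> under the quantifier
  makes \<open>d = 0\<close> a loss without a separate statement.\<close>

lemma dfs_run:
  assumes "length ps + d = k" "c \<le> B"
  shows "\<exists>n \<le> (B - c + 1) * (B + 2) ^ d. (dfs_step R B k ^^ n) (c # p # ps) =
    (if \<exists>e q. d = Suc e \<and> c \<le> q \<and> q < B \<and> R p q \<and> \<not> wins R B e q then won p ps else lost ps)"
  using assms
proof (induction d arbitrary: c p ps)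
  case 0
  then show ?case
    by (intro exI[of _ 1]) simp
next
  case (Suc e)
  let ?f = "dfs_step R B k"
  from Suc.prems(2) show ?case
  proof (induction c rule: inc_induct)
    case base
    have "1 \<le> (B + 2) ^ Suc e"
      by (rule one_le_power) simp
    then show ?case
      by (intro exI[of _ 1]) (auto simp del: power_Suc)
  next
    case (step c)
    let ?t = "(B - Suc c + 1) * (B + 2) ^ Suc e"
    obtain n where n: "n \<le> ?t" "(?f ^^ n) (Suc c # p # ps) =
      (if \<exists>q. Suc c \<le> q \<and> q < B \<and> R p q \<and> \<not> wins R B e q then won p ps else lost ps)"
      using step by auto
    have t: "(B - c + 1) * (B + 2) ^ Suc e = ?t + (B + 2) ^ Suc e"
      using step by (simp add: Suc_diff_Suc[symmetric] algebra_simps)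
    \<comment> \<open>Treating one candidate costs one step plus, if it is a legal move, the full
      search below it starting from candidate 0.\<close>
    have one: "1 + (B + 1) * (B + 2) ^ e \<le> (B + 2) ^ Suc e"
      using one_le_power[of "B + 2" e] by simp
    have ex: "(\<exists>q. c \<le> q \<and> q < B \<and> R p q \<and> \<not> wins R B e q) \<longleftrightarrow>
      R p c \<and> \<not> wins R B e c \<or> (\<exists>q. Suc c \<le> q \<and> q < B \<and> R p q \<and> \<not> wins R B e q)"
      using step(2) by (metis Suc_leD Suc_leI le_neq_implies_less order_refl)
    have ge: "(\<exists>e' q. Suc e = Suc e' \<and> c \<le> q \<and> q < B \<and> R p q \<and> \<not> wins R B e' q) \<longleftrightarrow>
        (\<exists>q. c \<le> q \<and> q < B \<and> R p q \<and> \<not> wins R B e q)"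
      by auto
    show ?case
    proof (cases "R p c")
      case False
      then have "(?f ^^ 1) (c # p # ps) = Suc c # p # ps"
        using step(2) Suc.prems(1) by simp
      then have "(?f ^^ (n + 1)) (c # p # ps) =
        (if \<exists>q. c \<le> q \<and> q < B \<and> R p q \<and> \<not> wins R B e q then won p ps else lost ps)"
        using n(2) False unfolding ex by (metis (no_types, lifting) funpow_trans)
      moreover have "n + 1 \<le> (B - c + 1) * (B + 2) ^ Suc e"
        unfolding t using n(1) one by linarith
      ultimately show ?thesis
        unfolding ge by blast
    next
      case True
      then have 1: "(?f ^^ 1) (c # p # ps) = 0 # c # p # ps"
        using step(2) Suc.prems(1) by simp
      have "wins R B e c \<longleftrightarrow> (\<exists>e' q. e = Suc e' \<and> 0 \<le> q \<and> q < B \<and> R c q \<and> \<not> wins R B e' q)"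
        by (cases e) auto
      then obtain m where m: "m \<le> (B + 1) * (B + 2) ^ e"
        "(?f ^^ m) (0 # c # p # ps) = (if wins R B e c then won c (p # ps) else lost (p # ps))"
        using Suc.IH[of "p # ps" 0 c] Suc.prems(1) by auto
      show ?thesis
      proof (cases "wins R B e c")
        case w: True
        have "(?f ^^ (n + (m + 1))) (c # p # ps) =
          (if \<exists>q. c \<le> q \<and> q < B \<and> R p q \<and> \<not> wins R B e q then won p ps else lost ps)"
          using funpow_trans[OF funpow_trans[OF 1 m(2)], unfolded if_P[OF w] won.simps, OF n(2)] w
          unfolding ex by simp
        moreover have "n + (m + 1) \<le> (B - c + 1) * (B + 2) ^ Suc e"
          unfolding t using n(1) m(1) one by linarith
        ultimately show ?thesis
          unfolding ge by blast
      next
        case w: False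
        have "(?f ^^ (m + 1)) (c # p # ps) =
          (if \<exists>q. c \<le> q \<and> q < B \<and> R p q \<and> \<not> wins R B e q then won p ps else lost ps)"
          using funpow_trans[OF 1 m(2)] w True unfolding ex by simp
        moreover have "m + 1 \<le> (B - c + 1) * (B + 2) ^ Suc e"
          unfolding t using m(1) one by linarith
        ultimately show ?thesis
          unfolding ge by blast
      qed
    qed
  qed
qed

text \<open>Final states are fixed points, so a prescribed number of iterations replaces a
  termination test, as \<open>computable_rec\<close> requires.\<close>

lemma dfs_correct:
  "(dfs_step R B k ^^ ((B + 2) ^ Suc k)) [0, p] = [of_bool (wins R B k p)]"
proof -
  let ?f = "dfs_step R B k"
  have "wins R B k p \<longleftrightarrow> (\<exists>e q. k = Suc e \<and> 0 \<le> q \<and> q < B \<and> R p q \<and> \<not> wins R B e q)"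
    by (cases k) auto
  then obtain n where n: "n \<le> (B + 1) * (B + 2) ^ k" "(?f ^^ n) [0, p] = [of_bool (wins R B k p)]"
    using dfs_run[of "[]" k k 0 B R p] by auto
  have "(B + 1) * (B + 2) ^ k \<le> (B + 2) * (B + 2) ^ k"
    by (intro mult_le_mono1) simp
  with n(1) have "n \<le> (B + 2) ^ Suc k"
    by simp
  moreover have "(?f ^^ m) [x] = [x]" for m x
    by (induction m) auto
  ultimately show ?thesis
    using n(2) by (metis funpow_trans le_add_diff_inverse add.commute)
qed

text \<open>The bound \<open>B + 1\<close> on the head admits the final state \<open>[1]\<close>
  even for \<open>B = 0\<close>. It leads to the base \<open>B + 3\<close> below, in which
  \<open>Suc a\<close> is a digit for every entry \<open>a\<close>.\<close>

definition dfs_ok :: "nat \<Rightarrow> nat \<Rightarrow> nat list \<Rightarrow> bool" where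
  "dfs_ok B k xs \<longleftrightarrow> xs \<noteq> [] \<and> hd xs \<le> B + 1 \<and> (\<forall>a\<in>set (tl xs). a < B) \<and> length xs \<le> k + 2"

lemma dfs_ok_step: "dfs_ok B k xs \<Longrightarrow> dfs_ok B k (dfs_step R B k xs)"
proof (induction R B k xs rule: dfs_step.induct)
  case (1 R B k c p ps)
  have "dfs_ok B k (lost ps)"
    using 1 by (cases ps; cases "tl ps") (auto simp: dfs_ok_def)
  then show ?case
    using 1 by (auto simp: dfs_ok_def)
qed auto

text \<open>The entries are shifted by one to make the number of entries visible.\<close>
fun stack_code :: "nat \<Rightarrow> nat list \<Rightarrow> nat" where
  "stack_code b [] = 0"
| "stack_code b (a # xs) = Suc a + b * stack_code b xs"

lemma stack_code_less: "(\<forall>a\<in>set xs. Suc a < b) \<Longrightarrow> stack_code b xs < b ^ length xs"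
proof (induction xs)
  case (Cons a xs)
  then have "Suc (stack_code b xs) \<le> b ^ length xs"
    by simp
  then have "b * Suc (stack_code b xs) \<le> b * b ^ length xs"
    by (rule mult_le_mono2)
  then show ?case
    using Cons.prems by simp
qed simp

lemma stack_code_div_mod:
  assumes "Suc a < b"
  shows "stack_code b (a # xs) div b = stack_code b xs" "stack_code b (a # xs) mod b = Suc a"
proof -
  have "(Suc a + b * stack_code b xs) div b = stack_code b xs + Suc a div b"
    using assms by (intro div_mult_self2) simp
  then show "stack_code b (a # xs) div b = stack_code b xs"
    using assms by simp
  have "(Suc a + b * stack_code b xs) mod b = Suc a mod b"
    by (rule mod_mult_self2)
  then show "stack_code b (a # xs) mod b = Suc a"
    using assms by simp
qed

lemma stack_code_div_power_eq_0:
  assumes "\<forall>a\<in>set xs. Suc a < b"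
  shows "stack_code b xs div b ^ k = 0 \<longleftrightarrow> length xs \<le> k"
  using assms
proof (induction xs arbitrary: k)
  case (Cons a xs)
  show ?case
  proof (cases k)
    case (Suc k')
    then show ?thesis
      using Cons stack_code_div_mod(1)[of a b xs] by (simp add: div_mult2_eq del: stack_code.simps)
  qed simp
qed simp

text \<open>\<open>dfs_step\<close> on codes: 1 and 2 encode \<open>[0]\<close> and
  \<open>[1]\<close>, \<open>1 + b * s\<close> pushes candidate 0, and adding 1 advances the
  candidate on top. The latter also implements \<open>won\<close> on a longer path, where the old
  top becomes the candidate.\<close>

definition dfs_num :: "(nat \<Rightarrow> nat \<Rightarrow> bool) \<Rightarrow> nat \<Rightarrow> nat \<Rightarrow> nat \<Rightarrow> nat \<Rightarrow> nat" where
  "dfs_num R B k b s =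
     (if s div b = 0 then s
      else if B \<le> s mod b - 1 \<or> \<not> s div b div b ^ k = 0
        then (if s div b div b = 0 then 1 else if s div b div b div b = 0 then 2 else Suc (s div b div b))
      else if R (s div b mod b - 1) (s mod b - 1) then 1 + b * s
      else Suc s)"

lemma stack_code_0_iff: "stack_code b xs = 0 \<longleftrightarrow> xs = []"
  by (cases xs) auto

lemma dfs_num_stack_code:
  assumes "dfs_ok B k xs"
  shows "dfs_num R B k (B + 3) (stack_code (B + 3) xs) = stack_code (B + 3) (dfs_step R B k xs)"
proof -
  let ?b = "B + 3"
  consider c where "xs = [c]" | c p ps where "xs = c # p # ps"
    using assms by (cases xs; cases "tl xs") (auto simp: dfs_ok_def)
  then show ?thesis
  proof cases
    case 1
    then show ?thesis
      using assms by (simp add: dfs_num_def dfs_ok_def)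
  next
    case 2
    have small: "Suc c < ?b" "Suc p < ?b" "\<forall>a\<in>set (p # ps). Suc a < ?b" "\<forall>a\<in>set ps. Suc a < ?b"
      using assms 2 by (auto simp: dfs_ok_def)
    have div: "stack_code ?b (a # ys) div ?b = stack_code ?b ys" "stack_code ?b (a # ys) mod ?b = Suc a"
      if "Suc a < ?b" for a ys
      using that by (rule stack_code_div_mod)+
    have len: "stack_code ?b (p # ps) div ?b ^ k = 0 \<longleftrightarrow> \<not> k \<le> length ps"
      using stack_code_div_power_eq_0[OF small(3), of k] by auto
    have lost: "(if stack_code ?b ps = 0 then 1 else if stack_code ?b ps div ?b = 0 then 2 else Suc (stack_code ?b ps)) =
      stack_code ?b (lost ps)"
    proof (cases ps)
      case (Cons q qs)
      then show ?thesis
        using small(4) div(1)[of q qs] by (cases qs) (auto simp: stack_code_0_iff)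
    qed simp
    show ?thesis
      unfolding 2 dfs_num_def div[OF small(1)] div[OF small(2)] len lost
      by (auto simp: stack_code_0_iff)
  qed
qed

lemma computable_subst2:
  assumes "computable (\<lambda>v. g (\<lambda>i. v (Suc (Suc i))) (v 0) (v (Suc 0)))" "computable a" "computable b"
  shows "computable (\<lambda>v. g v (a v) (b v))"
proof -
  have "computable (\<lambda>v. g (\<lambda>i. v (Suc i)) (a (\<lambda>i. v (Suc i))) (v 0))"
    using assms(1) computable_shift[OF assms(2)]
    by (rule computable_let[where g = "\<lambda>v x. g (\<lambda>i. v (Suc i)) x (v 0)"])
  then show ?thesis
    using assms(3) by (rule computable_let[where g = "\<lambda>v y. g v (a v) y"])
qed

lemma computable_wins:
  assumes R: "computable (\<lambda>v. of_bool (R (\<lambda>i. v (Suc (Suc i))) (v 0) (v (Suc 0))))"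
    and B: "computable B" and k: "computable k" "polylog k" and p: "computable p" and p_less: "\<And>v. p v < B v"
  shows "computable (\<lambda>v. of_bool (wins (R v) (B v) (k v) (p v)))"
proof -
  let ?s = "\<lambda>v x. dfs_num (R v) (B v) (k v) (B v + 3) x"
  define F where "F v t = (?s v ^^ t) (stack_code (B v + 3) [0, p v])" for v t
  define n where "n v = (B v + 2) ^ Suc (k v)" for v
  have F: "F v t = stack_code (B v + 3) ((dfs_step (R v) (B v) (k v) ^^ t) [0, p v]) \<and>
      dfs_ok (B v) (k v) ((dfs_step (R v) (B v) (k v) ^^ t) [0, p v])" for v t
  proof (induction t)
    case 0
    then show ?case
      using p_less[of v] by (simp add: F_def dfs_ok_def)
  next
    case (Suc t)
    then show ?case
      by (simp add: F_def dfs_num_stack_code dfs_ok_step)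
  qed
  have "computable (\<lambda>v. F v (n v))"
  proof (rule computable_rec[where F = F and n = n and z = "\<lambda>v. stack_code (B v + 3) [0, p v]"
        and b = "\<lambda>v. (B v + 3) ^ (k v + 2)" and s = "\<lambda>v acc t. ?s v acc"])
    show "computable n"
      unfolding n_def by (intro computable_intros B k polylog_intros polylog_mono[OF polylog_add[OF k(2) polylog_const[of 1]]]) simp
    show "computable (\<lambda>v. stack_code (B v + 3) [0, p v])"
      unfolding stack_code.simps by (intro computable_intros B p)
    show "quasipoly (\<lambda>v. (B v + 3) ^ (k v + 2))"
      by (intro quasipoly_power computable_imp_quasipoly computable_intros B polylog_intros k)
    show "F v 0 = stack_code (B v + 3) [0, p v]" "F v (Suc t) = ?s v (F v t)" for v t
      by (simp_all add: F_def)
    show "F v t \<le> (B v + 3) ^ (k v + 2)" for v t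
    proof -
      let ?xs = "(dfs_step (R v) (B v) (k v) ^^ t) [0, p v]"
      have ok: "dfs_ok (B v) (k v) ?xs" "F v t = stack_code (B v + 3) ?xs"
        using F by auto
      then have "F v t < (B v + 3) ^ length ?xs"
        unfolding ok(2) by (intro stack_code_less) (cases ?xs; force simp: dfs_ok_def)
      also have "\<dots> \<le> (B v + 3) ^ (k v + 2)"
        using ok(1) by (intro power_increasing) (auto simp: dfs_ok_def)
      finally show ?thesis by simp
    qed
    have R': "computable (\<lambda>v. of_bool (R (\<lambda>i. v (Suc (Suc i))) (a v) (b v)))" if "computable a" "computable b" for a b
    proof (rule computable_subst2[where g = "\<lambda>v x y. of_bool (R (\<lambda>i. v (Suc (Suc i))) x y)", OF _ that])
      show "computable (\<lambda>v. of_bool (R (\<lambda>i. v (Suc (Suc (Suc (Suc i))))) (v 0) (v (Suc 0))))"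
        using computable_rename[OF R, of "case_nat 0 (case_nat 1 (\<lambda>i. Suc (Suc (Suc (Suc i)))))"] by simp
    qed
    show "computable (\<lambda>v. ?s (\<lambda>i. v (Suc (Suc i))) (v 0))"
      unfolding dfs_num_def
      by (intro computable_if computable_eq computable_disj computable_not computable_le computable_div_power computable_div computable_mod computable_diff computable_add computable_mult
          computable_Suc computable_const computable_var R' computable_shift2[OF B] computable_shift2[OF k(1)])
  qed
  then have "computable (\<lambda>v. F v (n v) - 1)"
    by (intro computable_intros)
  \<comment> \<open>A one-element stack \<open>[a]\<close> has code \<open>Suc a\<close>.\<close>
  moreover have "F v (n v) - 1 = of_bool (wins (R v) (B v) (k v) (p v))" for v
    unfolding F[THEN conjunct1] n_def dfs_correct by simp
  ultimately show ?thesis by simp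
qed

subsection \<open>Circuits given by columns\<close>

text \<open>A circuit with gates \<open>0..<m\<close> is given by the names \<open>N\<close>, the labels \<open>G\<close> (0 for an input),
  and columns \<open>U\<close>, \<open>V\<close> holding the input value or the indices (not the names) of the predecessors.\<close>

type_synonym column = "nat \<Rightarrow> nat"

text \<open>Every number from 5 on means division, so arbitrary guessed columns can be decoded
  without checking \<open>G\<close>.\<close>

definition op_of :: "nat \<Rightarrow> op" where
  "op_of g = (if g = 1 then Union else if g = 2 then Inter else if g = 3 then Compl
     else if g = 4 then Plus else Div)"

definition gate_of :: "column \<Rightarrow> column \<Rightarrow> column \<Rightarrow> column \<Rightarrow> nat \<Rightarrow> gate" where
  "gate_of N G U V i =
     (if G i = 0 then (N i, Input (U i), [])
      else if G i = 3 then (N i, Oper Compl, [N (U i)])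
      else (N i, Oper (op_of (G i)), [N (U i), N (V i)]))"

definition valid_columns :: "nat \<Rightarrow> column \<Rightarrow> column \<Rightarrow> column \<Rightarrow> column \<Rightarrow> bool" where
  "valid_columns m N G U V \<longleftrightarrow> (\<forall>i<m. (\<forall>j<i. N i \<noteq> N j) \<and>
     (G i \<noteq> 0 \<longrightarrow> i < U i \<and> U i < m \<and> (G i \<noteq> 3 \<longrightarrow> i < V i \<and> V i < m)))"

abbreviation (input) Ops where
  "Ops \<equiv> {Union, Inter, Compl, Plus, Div}"

lemma gname_gate_of [simp]: "gname (gate_of N G U V i) = N i"
  by (simp add: gate_of_def gname_def)

lemma op_of_cases: "G \<noteq> 3 \<Longrightarrow> op_of G \<in> {Union, Inter, Plus, Div}"
  by (auto simp: op_of_def)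

lemma gate_ok_bin: "s \<in> {Union, Inter, Plus, Div} \<Longrightarrow> gate_ok Ops (Oper s) [p, q]"
  by auto

lemma is_circuit_gate_of:
  assumes "valid_columns m N G U V" "k < m"
  shows "is_circuit Ops (N k, map (gate_of N G U V) [0..<m])"
proof -
  have inj: "inj_on N {0..<m}"
    using assms(1) unfolding valid_columns_def inj_on_def
    by (metis atLeastLessThan_iff linorder_neqE_nat)
  have "map gname (map (gate_of N G U V) [0..<m]) = map N [0..<m]"
    by simp
  moreover have "gate_ok Ops (glab (gate_of N G U V i)) (gpreds (gate_of N G U V i)) \<and>
     (\<forall>p\<in>set (gpreds (gate_of N G U V i)). \<exists>j. i < j \<and> j < m \<and> N j = p)" if "i < m" for i
  proof -
    have wf: "G i \<noteq> 0 \<longrightarrow> i < U i \<and> U i < m \<and> (G i \<noteq> 3 \<longrightarrow> i < V i \<and> V i < m)"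
      using assms(1) that unfolding valid_columns_def by blast
    show ?thesis
      using wf gate_ok_bin[OF op_of_cases[of "G i"]]
      by (auto simp: gate_of_def glab_def gpreds_def)
  qed
  ultimately show ?thesis
    using assms(2) inj by (auto simp: is_circuit_def distinct_map comp_def cong: conj_cong)
qed

definition gate_set :: "nat \<Rightarrow> column \<Rightarrow> column \<Rightarrow> column \<Rightarrow> column \<Rightarrow> nat \<Rightarrow> nat set" where
  "gate_set m N G U V i = gate_sem (map (gate_of N G U V) [0..<m]) (N i)"

text \<open>\<open>gate_sem\<close> updates by name, and distinct names protect a value from the
  gates listed earlier. Operands are ordered by name and not by index, which matters for
  division.\<close>

lemma gate_set_eq:
  assumes wf: "valid_columns m N G U V" and i: "i < m"
  shows "gate_set m N G U V i =
    (if G i = 0 then {U i}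
     else if G i = 3 then - gate_set m N G U V (U i)
     else apply_bin (op_of (G i))
       (gate_set m N G U V (if N (U i) \<le> N (V i) then U i else V i))
       (gate_set m N G U V (if N (U i) \<le> N (V i) then V i else U i)))"
proof -
  define gs where "gs k = map (gate_of N G U V) [k..<m]" for k
  have Suc: "gate_sem (gs k) = (gate_sem (gs (Suc k)))
      (N k := gate_val (gate_of N G U V k) (gate_sem (gs (Suc k))))" if "k < m" for k
    using that by (simp add: gs_def upt_conv_Cons Let_def)
  have inj: "N a \<noteq> N b" if "a < b" "b < m" for a b
    using wf that unfolding valid_columns_def by metis
  have drop: "gate_sem (gs k) (N j) = gate_sem (gs j) (N j)" if "k \<le> j" "j < m" for k j
    using that
  proof (induction k rule: inc_induct)
    case (step k)
    then show ?case
      using inj[of k j] by (simp add: Suc)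
  qed simp
  have S: "gate_set m N G U V j = gate_sem (gs k) (N j)" if "k \<le> j" "j < m" for j k
    using drop[of 0 j] drop[of k j] that by (simp add: gate_set_def gs_def)
  have U: "G i \<noteq> 0 \<Longrightarrow> gate_sem (gs (Suc i)) (N (U i)) = gate_set m N G U V (U i)"
    using wf i unfolding valid_columns_def by (intro S[symmetric]) auto
  have V: "G i \<noteq> 0 \<Longrightarrow> G i \<noteq> 3 \<Longrightarrow> gate_sem (gs (Suc i)) (N (V i)) = gate_set m N G U V (V i)"
    using wf i unfolding valid_columns_def by (intro S[symmetric]) auto
  have val: "gate_val (a, Oper s, [p, q]) f = apply_bin s (f (min p q)) (f (max p q))"
    if "s \<in> {Union, Inter, Plus, Div}" for a s p q f
    using that by auto
  have "gate_set m N G U V i = gate_val (gate_of N G U V i) (gate_sem (gs (Suc i)))"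
    using S[of i i] Suc[OF i] i by simp
  also have "\<dots> = (if G i = 0 then {U i}
     else if G i = 3 then - gate_set m N G U V (U i)
     else apply_bin (op_of (G i))
       (gate_set m N G U V (if N (U i) \<le> N (V i) then U i else V i))
       (gate_set m N G U V (if N (U i) \<le> N (V i) then V i else U i)))"
    using U V val[OF op_of_cases[of "G i"]] by (auto simp: gate_of_def min_def max_def)
  finally show ?thesis .
qed

section \<open>Eventually constant sets\<close>

definition constant_from :: "nat set \<Rightarrow> nat \<Rightarrow> bool" where
  "constant_from A t \<longleftrightarrow> (\<forall>x\<ge>t. x \<in> A \<longleftrightarrow> t \<in> A)"

lemma constant_from_mono: "constant_from A t \<Longrightarrow> t \<le> t' \<Longrightarrow> constant_from A t'"
  unfolding constant_from_def by (meson le_trans)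

lemma constant_from_min: "constant_from A t \<Longrightarrow> min x t \<in> A \<longleftrightarrow> x \<in> A"
  unfolding constant_from_def by (metis min_def nat_le_linear)

lemma constant_from_ge: "constant_from A t \<Longrightarrow> x \<in> A \<Longrightarrow> t \<le> x \<Longrightarrow> t \<le> y \<Longrightarrow> y \<in> A"
  unfolding constant_from_def by blast

lemma constant_from_boolean:
  assumes "constant_from A t" "constant_from B t"
  shows "constant_from (- A) t" "constant_from (A \<union> B) t" "constant_from (A \<inter> B) t"
  using assms unfolding constant_from_def by blast+

lemma mem_set_plus: "x \<in> set_plus A B \<longleftrightarrow> (\<exists>a b. x = a + b \<and> a \<in> A \<and> b \<in> B)"
  by (auto simp: set_plus_def)

lemma mem_set_div: "x \<in> set_div A B \<longleftrightarrow> (\<exists>b. b \<in> B \<and> b \<noteq> 0 \<and> x * b \<in> A)"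
  by (auto simp: set_div_def)

lemma set_plus_commute: "set_plus A B = set_plus B A"
  by (auto simp: mem_set_plus) (metis add.commute)+

text \<open>If \<open>a + b\<close> is at least \<open>2 * t\<close>, one summand is at least
  \<open>t\<close> and can be changed freely above \<open>t\<close>; should the other exceed
  \<open>t\<close>, it is first lowered to \<open>t\<close>.\<close>

lemma constant_from_set_plus:
  assumes "constant_from A t" "constant_from B t"
  shows "constant_from (set_plus A B) (2 * t)"
proof -
  have move: "y \<in> set_plus C D"
    if "constant_from C t" "constant_from D t" "c \<in> C" "d \<in> D" "t \<le> d" "2 * t \<le> y" for C D c d y
  proof (cases "c \<le> t")
    case True
    then have "y - c \<in> D"
      using that by (intro constant_from_ge[OF that(2,4,5)]) auto
    then show ?thesis
      unfolding mem_set_plus using that True by (intro exI[of _ c] exI[of _ "y - c"]) auto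
  next
    case False
    then have "t \<in> C" "y - t \<in> D"
      using that by (auto intro: constant_from_ge[OF that(2,4,5)] constant_from_ge[OF that(1,3)])
    then show ?thesis
      unfolding mem_set_plus using that by (intro exI[of _ t] exI[of _ "y - t"]) auto
  qed
  have "y \<in> set_plus A B" if x: "x \<in> set_plus A B" "2 * t \<le> x" "2 * t \<le> y" for x y
  proof -
    obtain a b where ab: "x = a + b" "a \<in> A" "b \<in> B"
      using x(1) unfolding mem_set_plus by blast
    then consider "t \<le> a" | "t \<le> b"
      using x(2) by linarith
    then show ?thesis
      using move[OF assms ab(2,3) _ x(3)] move[OF assms(2,1) ab(3,2) _ x(3)]
      by cases (auto simp: set_plus_commute)
  qed
  then show ?thesis
    unfolding constant_from_def by blast
qed

text \<open>For a divisor \<open>b\<close> at least 1 both \<open>x * b\<close> and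
  \<open>t * b\<close> lie beyond \<open>t\<close>, so the same divisors work for \<open>x\<close>
  and \<open>t\<close>. No assumption on \<open>B\<close> is involved.\<close>

lemma constant_from_set_div:
  assumes "constant_from A t"
  shows "constant_from (set_div A B) t"
  unfolding constant_from_def
proof (intro allI impI)
  fix x assume x: "t \<le> x"
  have "x * b \<in> A \<longleftrightarrow> t * b \<in> A" if "b \<noteq> 0" for b
  proof -
    have "t * 1 \<le> t * b" "x * 1 \<le> x * b"
      using that by (intro mult_le_mono2; simp)+
    then show ?thesis
      using x constant_from_ge[OF assms] by (metis mult_1_right le_trans)
  qed
  then show "x \<in> set_div A B \<longleftrightarrow> t \<in> set_div A B"
    unfolding mem_set_div by blast
qed

text \<open>One doubling per gate suffices: predecessors have larger indices, so all of them share
  the threshold \<open>T * 2 ^ (m - Suc i)\<close>.\<close>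

lemma constant_from_gate_set:
  assumes wf: "valid_columns m N G U V" and inp: "\<And>i. i < m \<Longrightarrow> G i = 0 \<Longrightarrow> U i < T" and i: "i < m"
  shows "constant_from (gate_set m N G U V i) (T * 2 ^ (m - i))"
  using i
proof (induction "m - i" arbitrary: i rule: less_induct)
  case less
  let ?S = "gate_set m N G U V"
  have dbl: "T * 2 ^ (m - j) * 2 \<le> T * 2 ^ (m - i)" if "i < j" for j
  proof -
    have "(2::nat) ^ Suc (m - j) \<le> 2 ^ (m - i)"
      using that less.prems by (intro power_increasing) auto
    then show ?thesis
      by simp
  qed
  define t where "t = T * 2 ^ (m - Suc i)"
  have t2: "2 * t \<le> T * 2 ^ (m - i)"
    using dbl[of "Suc i"] by (simp add: t_def mult.commute)
  have IH: "constant_from (?S j) t" if "i < j" "j < m" for j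
  proof -
    have "constant_from (?S j) (T * 2 ^ (m - j))"
      using that by (intro less) auto
    moreover have "T * 2 ^ (m - j) \<le> t"
      unfolding t_def using that by (intro mult_le_mono2 power_increasing) auto
    ultimately show ?thesis
      by (rule constant_from_mono)
  qed
  have wfi: "G i \<noteq> 0 \<longrightarrow> i < U i \<and> U i < m \<and> (G i \<noteq> 3 \<longrightarrow> i < V i \<and> V i < m)"
    using wf less.prems unfolding valid_columns_def by blast
  consider "G i = 0" | "G i = 3" | "G i \<noteq> 0" "G i \<noteq> 3"
    by blast
  then show ?case
  proof cases
    case 1
    then have "U i < T"
      using inp less.prems by simp
    moreover have "T * 1 \<le> T * 2 ^ (m - i)"
      by (intro mult_le_mono2) simp
    ultimately have "U i < T * 2 ^ (m - i)"
      by linarith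
    then have "constant_from {U i} (T * 2 ^ (m - i))"
      by (auto simp: constant_from_def)
    then show ?thesis
      using 1 by (simp add: gate_set_eq[OF wf less.prems])
  next
    case 2
    then have "constant_from (?S (U i)) t"
      using IH[of "U i"] wfi by simp
    then have "constant_from (- ?S (U i)) t"
      using constant_from_boolean(1) by blast
    then have "constant_from (- ?S (U i)) (T * 2 ^ (m - i))"
      by (rule constant_from_mono) (use t2 in linarith)
    then show ?thesis
      using 2 by (simp add: gate_set_eq[OF wf less.prems])
  next
    case 3
    define a b where "a = (if N (U i) \<le> N (V i) then U i else V i)"
      and "b = (if N (U i) \<le> N (V i) then V i else U i)"
    have ab: "constant_from (?S a) t" "constant_from (?S b) t"
      using IH wfi 3 unfolding a_def b_def by auto
    have "constant_from (?S a \<union> ?S b) t" "constant_from (?S a \<inter> ?S b) t"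
      using ab by (rule constant_from_boolean)+
    moreover have "constant_from (set_div (?S a) (?S b)) t"
      using ab(1) by (rule constant_from_set_div)
    moreover have "constant_from (set_plus (?S a) (?S b)) (2 * t)"
      using ab by (rule constant_from_set_plus)
    moreover have "t \<le> T * 2 ^ (m - i)"
      using t2 by linarith
    ultimately have "constant_from (apply_bin s (?S a) (?S b)) (T * 2 ^ (m - i))"
      if "s \<in> {Union, Inter, Plus, Div}" for s
      using that t2 constant_from_mono by auto
    then show ?thesis
      using 3 op_of_cases[of "G i"] by (simp add: gate_set_eq[OF wf less.prems] a_def b_def)
  qed
qed

subsection \<open>Membership as a game\<close>

text \<open>Positions are quadruples \<open>(i, x, j, y)\<close> of numbers below \<open>Q\<close>. The player to move wins at
  \<open>(i, x, m, _)\<close> iff \<open>x\<close> belongs to gate \<open>i\<close>; at \<open>(i, x, j, y)\<close> with \<open>j < m\<close> he wins iff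
  \<open>x\<close> does not belong to gate \<open>i\<close> or \<open>y\<close> does not belong to gate \<open>j\<close>.
  All numbers are capped at a common threshold \<open>t = Q - 1\<close> of the gates.\<close>

definition component0 :: "nat \<Rightarrow> nat \<Rightarrow> nat" where "component0 Q p = p mod Q"
definition component1 :: "nat \<Rightarrow> nat \<Rightarrow> nat" where "component1 Q p = p div Q mod Q"
definition component2 :: "nat \<Rightarrow> nat \<Rightarrow> nat" where "component2 Q p = p div Q div Q mod Q"
definition component3 :: "nat \<Rightarrow> nat \<Rightarrow> nat" where "component3 Q p = p div Q div Q div Q mod Q"

definition quad :: "nat \<Rightarrow> nat \<Rightarrow> nat \<Rightarrow> nat \<Rightarrow> nat \<Rightarrow> nat" where
  "quad Q i x j y = i + Q * (x + Q * (j + Q * y))"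

lemma div_mod_digit: "a < Q \<Longrightarrow> (a + Q * r) div Q = r" "a < Q \<Longrightarrow> (a + Q * r) mod Q = a" for a :: nat
proof -
  assume a: "a < Q"
  have "(a + Q * r) div Q = r + a div Q"
    using a by (intro div_mult_self2) simp
  then show "(a + Q * r) div Q = r"
    using a by simp
  have "(a + Q * r) mod Q = a mod Q"
    by (rule mod_mult_self2)
  then show "(a + Q * r) mod Q = a"
    using a by simp
qed

lemma quad_less:
  assumes "i < Q" "x < Q" "j < Q" "y < Q"
  shows "quad Q i x j y < Q * Q * Q * Q"
proof -
  have digit: "a + Q * r < Q * s" if "a < Q" "r < s" for a r s :: nat
  proof -
    have "Q * Suc r \<le> Q * s"
      using that(2) by (intro mult_le_mono2) simp
    then show ?thesis
      using that(1) by simp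
  qed
  have "j + Q * y < Q * Q"
    using assms by (intro digit)
  then have "quad Q i x j y < Q * (Q * (Q * Q))"
    unfolding quad_def using assms by (intro digit)
  then show ?thesis
    by (simp add: mult.assoc)
qed

lemma component_quad:
  assumes "i < Q" "x < Q" "j < Q" "y < Q"
  shows "component0 Q (quad Q i x j y) = i" "component1 Q (quad Q i x j y) = x"
    "component2 Q (quad Q i x j y) = j" "component3 Q (quad Q i x j y) = y"
  using assms unfolding quad_def component0_def component1_def component2_def component3_def
  by (simp_all only: div_mod_digit mod_less)

lemma component_less: "0 < Q \<Longrightarrow> component0 Q p < Q" "0 < Q \<Longrightarrow> component1 Q p < Q" "0 < Q \<Longrightarrow> component2 Q p < Q" "0 < Q \<Longrightarrow> component3 Q p < Q"
  by (simp_all add: component0_def component1_def component2_def component3_def)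

lemma ex_quad:
  assumes "0 < Q"
  shows "(\<exists>q < Q * Q * Q * Q. P (component0 Q q) (component1 Q q) (component2 Q q) (component3 Q q)) \<longleftrightarrow>
    (\<exists>i<Q. \<exists>x<Q. \<exists>j<Q. \<exists>y<Q. P i x j y)"
proof
  assume "\<exists>q < Q * Q * Q * Q. P (component0 Q q) (component1 Q q) (component2 Q q) (component3 Q q)"
  then show "\<exists>i<Q. \<exists>x<Q. \<exists>j<Q. \<exists>y<Q. P i x j y"
    using component_less[OF assms] by blast
next
  assume "\<exists>i<Q. \<exists>x<Q. \<exists>j<Q. \<exists>y<Q. P i x j y"
  then obtain i x j y where *: "i < Q" "x < Q" "j < Q" "y < Q" "P i x j y"
    by blast
  then show "\<exists>q < Q * Q * Q * Q. P (component0 Q q) (component1 Q q) (component2 Q q) (component3 Q q)"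
    by (intro exI[of _ "quad Q i x j y"]) (simp add: component_quad quad_less)
qed

text \<open>At a pair, the mover challenges one of the two claims. At a single gate, the mover names
  claims for the opponent to challenge: a union claims one fact twice, a complement hands
  \<open>x\<close> over to its predecessor, and a correct input leads to a position without moves.
  The index \<open>m\<close> stands for no gate.\<close>

definition move4 :: "nat \<Rightarrow> nat \<Rightarrow> column \<Rightarrow> column \<Rightarrow> column \<Rightarrow> column \<Rightarrow>
    nat \<Rightarrow> nat \<Rightarrow> nat \<Rightarrow> nat \<Rightarrow> nat \<Rightarrow> nat \<Rightarrow> nat \<Rightarrow> nat \<Rightarrow> bool" where
  "move4 m t N G U V i x j y i' x' j' y' \<longleftrightarrow>
     (j < m \<and> j' = m \<and> (i' = i \<and> x' = x \<or> i' = j \<and> x' = y)) \<or>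
     (m \<le> j \<and> i < m \<and>
       (G i = 0 \<and> x = U i \<and> i' = m \<and> j' = m \<or>
        G i = 3 \<and> i' = U i \<and> x' = x \<and> j' = m \<or>
        G i = 1 \<and> x' = x \<and> y' = x \<and> i' = j' \<and> (i' = U i \<or> i' = V i) \<or>
        G i = 2 \<and> x' = x \<and> y' = x \<and> i' = U i \<and> j' = V i \<or>
        G i = 4 \<and> x' + y' = x \<and> i' = U i \<and> j' = V i \<or>
        5 \<le> G i \<and> 1 \<le> y' \<and> x' = min (x * y') t \<and>
          i' = (if N (U i) \<le> N (V i) then U i else V i) \<and>
          j' = (if N (U i) \<le> N (V i) then V i else U i)))"

definition move :: "nat \<Rightarrow> nat \<Rightarrow> column \<Rightarrow> column \<Rightarrow> column \<Rightarrow> column \<Rightarrow> nat \<Rightarrow> nat \<Rightarrow> bool" where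
  "move m t N G U V p q \<longleftrightarrow>
     move4 m t N G U V (component0 (t + 1) p) (component1 (t + 1) p) (component2 (t + 1) p) (component3 (t + 1) p)
       (component0 (t + 1) q) (component1 (t + 1) q) (component2 (t + 1) q) (component3 (t + 1) q)"

text \<open>A divisor beyond \<open>t\<close> can be replaced by \<open>t\<close>: it shows that
  \<open>t\<close> is in \<open>B\<close>, and the two products lie both beyond \<open>t\<close> or,
  for \<open>x = 0\<close>, coincide.\<close>

lemma set_div_capped:
  assumes "constant_from A t" "constant_from B t" "0 < t"
  shows "x \<in> set_div A B \<longleftrightarrow> (\<exists>b\<le>t. 1 \<le> b \<and> min (x * b) t \<in> A \<and> b \<in> B)"
proof
  assume "x \<in> set_div A B"
  then obtain b where b: "b \<in> B" "b \<noteq> 0" "x * b \<in> A"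
    unfolding mem_set_div by blast
  show "\<exists>b\<le>t. 1 \<le> b \<and> min (x * b) t \<in> A \<and> b \<in> B"
  proof (cases "b \<le> t")
    case True
    then show ?thesis
      using b constant_from_min[OF assms(1)] by (intro exI[of _ b]) auto
  next
    case False
    then have tB: "t \<in> B"
      using b by (intro constant_from_ge[OF assms(2) b(1)]) auto
    have "x * t \<in> A"
    proof (cases "x = 0")
      case False
      then have "1 * b \<le> x * b" "1 * t \<le> x * t"
        by (intro mult_le_mono1; simp)+
      then have "t \<le> x * b" "t \<le> x * t"
        using \<open>\<not> b \<le> t\<close> by linarith+
      then show ?thesis
        by (rule constant_from_ge[OF assms(1) b(3)])
    qed (use b in simp)
    then show ?thesis
      using tB assms(3) constant_from_min[OF assms(1)] by (intro exI[of _ t]) auto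
  qed
next
  assume "\<exists>b\<le>t. 1 \<le> b \<and> min (x * b) t \<in> A \<and> b \<in> B"
  then show "x \<in> set_div A B"
    unfolding mem_set_div using constant_from_min[OF assms(1)] by auto
qed

text \<open>A gate consumes at most two moves, claim and challenge, and indices strictly increase;
  hence the budget \<open>2 * (m - i)\<close> for gate \<open>i\<close>.\<close>

lemma wins_iff_mem:
  fixes t :: nat
  defines "Q \<equiv> t + 1"
  assumes wf: "valid_columns m N G U V" and m: "m \<le> t" "0 < t"
    and constant_from: "\<And>i. i < m \<Longrightarrow> constant_from (gate_set m N G U V i) t"
  shows "component0 Q p < m \<Longrightarrow> component2 Q p = m \<Longrightarrow> 2 * (m - component0 Q p) \<le> k \<Longrightarrow>
    wins (move m t N G U V) (Q * Q * Q * Q) k p \<longleftrightarrow> component1 Q p \<in> gate_set m N G U V (component0 Q p)"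
proof (induction k arbitrary: p rule: less_induct)
  case (less k)
  let ?S = "gate_set m N G U V" and ?B = "Q * Q * Q * Q"
  let ?R = "move m t N G U V"
  have Q: "0 < Q" "m < Q"
    using m by (auto simp: Q_def)
  have step: "wins ?R ?B (Suc k') q \<longleftrightarrow> (\<exists>r<?B. move4 m t N G U V (component0 Q q) (component1 Q q) (component2 Q q)
      (component3 Q q) (component0 Q r) (component1 Q r) (component2 Q r) (component3 Q r) \<and> \<not> wins ?R ?B k' r)" for k' q
    by (simp add: move_def Q_def)
  have dead: "\<not> wins ?R ?B k' q" if "m \<le> component0 Q q" "m \<le> component2 Q q" for k' q
    using that unfolding Q_def by (cases k') (auto simp: move_def move4_def)
  have pair: "\<not> wins ?R ?B (Suc k') q \<longleftrightarrow> component1 Q q \<in> ?S (component0 Q q) \<and> component3 Q q \<in> ?S (component2 Q q)"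
    if "k' < k" "component0 Q q < m" "component2 Q q < m" "2 * (m - component0 Q q) \<le> k'" "2 * (m - component2 Q q) \<le> k'" for k' q
  proof -
    have "wins ?R ?B (Suc k') q \<longleftrightarrow> (\<exists>r<?B. (component2 Q r = m \<and>
        (component0 Q r = component0 Q q \<and> component1 Q r = component1 Q q \<or> component0 Q r = component2 Q q \<and> component1 Q r = component3 Q q)) \<and>
        \<not> wins ?R ?B k' r)"
      unfolding step using that(3) by (simp add: move4_def)
    also have "\<dots> \<longleftrightarrow> (\<exists>r<?B. (component2 Q r = m \<and>
        (component0 Q r = component0 Q q \<and> component1 Q r = component1 Q q \<or> component0 Q r = component2 Q q \<and> component1 Q r = component3 Q q)) \<and>
        \<not> component1 Q r \<in> ?S (component0 Q r))"
      using less.IH[OF that(1)] that by (intro ex_cong1 conj_cong refl) auto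
    also have "\<dots> \<longleftrightarrow> (\<exists>i<Q. \<exists>x<Q. \<exists>j<Q. \<exists>y<Q. (j = m \<and>
        (i = component0 Q q \<and> x = component1 Q q \<or> i = component2 Q q \<and> x = component3 Q q)) \<and> \<not> x \<in> ?S i)"
      using ex_quad[OF Q(1), of "\<lambda>i x j y. (j = m \<and>
        (i = component0 Q q \<and> x = component1 Q q \<or> i = component2 Q q \<and> x = component3 Q q)) \<and> \<not> x \<in> ?S i"] .
    also have "\<dots> \<longleftrightarrow> \<not> (component1 Q q \<in> ?S (component0 Q q) \<and> component3 Q q \<in> ?S (component2 Q q))"
      using Q component_less[OF Q(1), of q] by blast
    finally show ?thesis
      by blast
  qed
  define i x where "i = component0 Q p" and "x = component1 Q p"
  have i: "i < m" and x: "x < Q" "x \<le> t"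
    using less.prems component_less[OF Q(1), of p] by (auto simp: i_def x_def Q_def)
  have wfi: "G i \<noteq> 0 \<longrightarrow> i < U i \<and> U i < m \<and> (G i \<noteq> 3 \<longrightarrow> i < V i \<and> V i < m)"
    using wf i unfolding valid_columns_def by blast
  obtain k' where k: "k = Suc (Suc k')" "2 * (m - Suc i) \<le> k'"
  proof -
    have "2 \<le> k" "2 * (m - Suc i) \<le> k - 2"
      using less.prems(3) i by (auto simp: i_def[symmetric])
    then show thesis
      using that[of "k - 2"] by (metis Suc_eq_plus1 Suc_1 add_2_eq_Suc le_add_diff_inverse)
  qed
  have win: "wins ?R ?B k p \<longleftrightarrow> (\<exists>r<?B. move4 m t N G U V i x m (component3 Q p)
      (component0 Q r) (component1 Q r) (component2 Q r) (component3 Q r) \<and> \<not> wins ?R ?B (Suc k') r)"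
    unfolding k(1) step using less.prems(2) by (simp add: i_def x_def)
  \<comment> \<open>Common to all binary operations: the mover wins by naming a pair of true claims
    allowed by \<open>P\<close>.\<close>
  have two: "wins ?R ?B k p \<longleftrightarrow> (\<exists>i'<Q. \<exists>x'<Q. \<exists>j'<Q. \<exists>y'<Q. P i' x' j' y' \<and> x' \<in> ?S i' \<and> y' \<in> ?S j')"
    if P: "\<And>i' x' j' y'. move4 m t N G U V i x m (component3 Q p) i' x' j' y' \<longleftrightarrow> P i' x' j' y'"
      and P': "\<And>i' x' j' y'. P i' x' j' y' \<Longrightarrow> i < i' \<and> i' < m \<and> i < j' \<and> j' < m" for P
  proof -
    have "wins ?R ?B k p \<longleftrightarrow> (\<exists>r<?B. P (component0 Q r) (component1 Q r) (component2 Q r) (component3 Q r) \<and>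
        component1 Q r \<in> ?S (component0 Q r) \<and> component3 Q r \<in> ?S (component2 Q r))"
      unfolding win P
    proof (intro ex_cong1 conj_cong refl)
      fix r
      assume "P (component0 Q r) (component1 Q r) (component2 Q r) (component3 Q r)"
      from P'[OF this] show "\<not> wins ?R ?B (Suc k') r \<longleftrightarrow>
          component1 Q r \<in> ?S (component0 Q r) \<and> component3 Q r \<in> ?S (component2 Q r)"
        using k by (intro pair) auto
    qed
    also have "\<dots> \<longleftrightarrow> (\<exists>i'<Q. \<exists>x'<Q. \<exists>j'<Q. \<exists>y'<Q. P i' x' j' y' \<and> x' \<in> ?S i' \<and> y' \<in> ?S j')"
      using ex_quad[OF Q(1), of "\<lambda>i' x' j' y'. P i' x' j' y' \<and> x' \<in> ?S i' \<and> y' \<in> ?S j'"] .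
    finally show ?thesis .
  qed
  have S: "?S i = (if G i = 0 then {U i} else if G i = 3 then - ?S (U i)
     else apply_bin (op_of (G i))
       (?S (if N (U i) \<le> N (V i) then U i else V i)) (?S (if N (U i) \<le> N (V i) then V i else U i)))"
    using gate_set_eq[OF wf i] .
  consider "G i = 0" | "G i = 3" | "G i = 1" | "G i = 2" | "G i = 4" | "5 \<le> G i"
    by linarith
  then have "wins ?R ?B k p \<longleftrightarrow> x \<in> ?S i"
  proof cases
    case 1
    have "wins ?R ?B k p \<longleftrightarrow> (\<exists>r<?B. (x = U i \<and> component0 Q r = m \<and> component2 Q r = m) \<and> \<not> wins ?R ?B (Suc k') r)"
      unfolding win using 1 i by (simp add: move4_def)
    also have "\<dots> \<longleftrightarrow> (\<exists>r<?B. x = U i \<and> component0 Q r = m \<and> component2 Q r = m)"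
      using dead by (metis order_refl)
    also have "\<dots> \<longleftrightarrow> (\<exists>i'<Q. \<exists>x'<Q. \<exists>j'<Q. \<exists>y'<Q. x = U i \<and> i' = m \<and> j' = m)"
      using ex_quad[OF Q(1), of "\<lambda>i' x' j' y'. x = U i \<and> i' = m \<and> j' = m"] .
    also have "\<dots> \<longleftrightarrow> x = U i"
      using Q by auto
    finally show ?thesis
      using 1 S by simp
  next
    case 2
    then have U: "i < U i" "U i < m"
      using wfi by auto
    have "wins ?R ?B k p \<longleftrightarrow> (\<exists>r<?B. (component0 Q r = U i \<and> component1 Q r = x \<and> component2 Q r = m) \<and> \<not> wins ?R ?B (Suc k') r)"
      unfolding win using 2 i by (simp add: move4_def)
    also have "\<dots> \<longleftrightarrow> (\<exists>r<?B. (component0 Q r = U i \<and> component1 Q r = x \<and> component2 Q r = m) \<and> x \<notin> ?S (U i))"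
      using less.IH[of "Suc k'"] k U by (intro ex_cong1 conj_cong refl) auto
    also have "\<dots> \<longleftrightarrow> (\<exists>i'<Q. \<exists>x'<Q. \<exists>j'<Q. \<exists>y'<Q. (i' = U i \<and> x' = x \<and> j' = m) \<and> x \<notin> ?S (U i))"
      using ex_quad[OF Q(1), of "\<lambda>i' x' j' y'. (i' = U i \<and> x' = x \<and> j' = m) \<and> x \<notin> ?S (U i)"] .
    also have "\<dots> \<longleftrightarrow> x \<notin> ?S (U i)"
      using Q U x by auto
    finally show ?thesis
      using 2 S by simp
  next
    case 3
    have "wins ?R ?B k p \<longleftrightarrow> (\<exists>i'<Q. \<exists>x'<Q. \<exists>j'<Q. \<exists>y'<Q.
        (x' = x \<and> y' = x \<and> i' = j' \<and> (i' = U i \<or> i' = V i)) \<and> x' \<in> ?S i' \<and> y' \<in> ?S j')"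
      using 3 i wfi by (intro two) (auto simp: move4_def)
    also have "\<dots> \<longleftrightarrow> (\<exists>i'<Q. (i' = U i \<or> i' = V i) \<and> x \<in> ?S i')"
      using x by auto
    also have "\<dots> \<longleftrightarrow> x \<in> ?S (U i) \<union> ?S (V i)"
    proof -
      have "U i < Q" "V i < Q"
        using wfi 3 Q by auto
      then show ?thesis
        by auto
    qed
    finally show ?thesis
      using 3 S by (auto simp: op_of_def)
  next
    case 4
    have "wins ?R ?B k p \<longleftrightarrow> (\<exists>i'<Q. \<exists>x'<Q. \<exists>j'<Q. \<exists>y'<Q.
        (x' = x \<and> y' = x \<and> i' = U i \<and> j' = V i) \<and> x' \<in> ?S i' \<and> y' \<in> ?S j')"
      using 4 i wfi by (intro two) (auto simp: move4_def)
    also have "\<dots> \<longleftrightarrow> x \<in> ?S (U i) \<inter> ?S (V i)"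
      using x Q wfi 4 by auto
    finally show ?thesis
      using 4 S by (auto simp: op_of_def)
  next
    case 5
    have "wins ?R ?B k p \<longleftrightarrow> (\<exists>i'<Q. \<exists>x'<Q. \<exists>j'<Q. \<exists>y'<Q.
        (x' + y' = x \<and> i' = U i \<and> j' = V i) \<and> x' \<in> ?S i' \<and> y' \<in> ?S j')"
      using 5 i wfi by (intro two) (auto simp: move4_def)
    also have "\<dots> \<longleftrightarrow> (\<exists>x'<Q. \<exists>y'<Q. x' + y' = x \<and> x' \<in> ?S (U i) \<and> y' \<in> ?S (V i))"
    proof -
      have "U i < Q" "V i < Q"
        using wfi 5 Q by auto
      then show ?thesis
        by blast
    qed
    also have "\<dots> \<longleftrightarrow> x \<in> set_plus (?S (U i)) (?S (V i))"
      unfolding mem_set_plus using x(1) by (metis add.commute le_add1 le_less_trans)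
    finally show ?thesis
      using 5 S set_plus_commute by (auto simp: op_of_def)
  next
    case 6
    define a b where "a = (if N (U i) \<le> N (V i) then U i else V i)"
      and "b = (if N (U i) \<le> N (V i) then V i else U i)"
    have ab: "a < m" "b < m" "i < a" "i < b"
      using wfi 6 unfolding a_def b_def by auto
    have "wins ?R ?B k p \<longleftrightarrow> (\<exists>i'<Q. \<exists>x'<Q. \<exists>j'<Q. \<exists>y'<Q.
        (1 \<le> y' \<and> x' = min (x * y') t \<and> i' = a \<and> j' = b) \<and> x' \<in> ?S i' \<and> y' \<in> ?S j')"
      using 6 i ab by (intro two) (auto simp: move4_def a_def[symmetric] b_def[symmetric])
    also have "\<dots> \<longleftrightarrow> (\<exists>y'\<le>t. 1 \<le> y' \<and> min (x * y') t \<in> ?S a \<and> y' \<in> ?S b)"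
    proof -
      have "a < Q" "b < Q" "\<And>z. min z t < Q" "\<And>z. z \<le> t \<longleftrightarrow> z < Q"
        using ab Q by (auto simp: Q_def)
      then show ?thesis
        by blast
    qed
    also have "\<dots> \<longleftrightarrow> x \<in> set_div (?S a) (?S b)"
      using set_div_capped[OF constant_from constant_from] ab m(2) by simp
    finally show ?thesis
      using 6 S by (simp add: op_of_def a_def[symmetric] b_def[symmetric])
  qed
  then show ?case
    by (simp add: i_def x_def)
qed

subsection \<open>The decision procedure\<close>

text \<open>The four columns are interleaved in the base-\<open>T\<close> digits of one number, so
  guessing a circuit is guessing \<open>c\<close>, and every \<open>c\<close> decodes to
  something.\<close>

definition column_of :: "nat \<Rightarrow> nat \<Rightarrow> nat \<Rightarrow> column" where
  "column_of T c r i = c div T ^ (4 * i + r) mod T"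

lemma computable_column_of [computable_intros]: "computable T \<Longrightarrow> computable c \<Longrightarrow> computable i \<Longrightarrow> computable (\<lambda>v. column_of (T v) (c v) r (i v))"
  unfolding column_of_def by (intro computable_mod computable_div_power computable_add computable_mult computable_const)

lemma column_of_less: "0 < T \<Longrightarrow> column_of T c r i < T"
  by (simp add: column_of_def)

lemma digits_exist:
  fixes T :: nat
  assumes "\<And>j. j < n \<Longrightarrow> F j < T" "0 < T"
  shows "\<exists>c < T ^ n. \<forall>j<n. c div T ^ j mod T = F j"
  using assms(1)
proof (induction n arbitrary: F)
  case (Suc n)
  obtain c where c: "c < T ^ n" "\<forall>j<n. c div T ^ j mod T = F (Suc j)"
    using Suc.IH[of "\<lambda>j. F (Suc j)"] Suc.prems by auto
  have F0: "F 0 < T"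
    using Suc.prems by simp
  have "(F 0 + T * c) div T ^ j mod T = F j" if "j < Suc n" for j
  proof (cases j)
    case 0
    then show ?thesis
      using div_mod_digit[OF F0, of c] by simp
  next
    case (Suc k)
    then show ?thesis
      using div_mod_digit[OF F0, of c] c(2) that by (simp add: div_mult2_eq)
  qed
  moreover have "F 0 + T * c < T ^ Suc n"
  proof -
    have "T * Suc c \<le> T * T ^ n"
      using c(1) by (intro mult_le_mono2) simp
    then show ?thesis
      using F0 by simp
  qed
  ultimately show ?case
    by blast
qed simp

lemma column_of_exist:
  fixes T :: nat
  assumes "\<And>i. i < m \<Longrightarrow> N i < T \<and> G i < T \<and> U i < T \<and> V i < T" "0 < T"
  shows "\<exists>c < T ^ (4 * m). \<forall>i<m. column_of T c 0 i = N i \<and> column_of T c 1 i = G i \<and>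
    column_of T c 2 i = U i \<and> column_of T c 3 i = V i"
proof -
  define F where "F j = (if j mod 4 = 0 then N (j div 4) else if j mod 4 = 1 then G (j div 4)
    else if j mod 4 = 2 then U (j div 4) else V (j div 4))" for j
  have "F j < T" if "j < 4 * m" for j
    using assms(1)[of "j div 4"] that by (auto simp: F_def)
  then obtain c where c: "c < T ^ (4 * m)" "\<forall>j<4 * m. c div T ^ j mod T = F j"
    using digits_exist[of "4 * m" F T] assms(2) by blast
  have "F (4 * i) = N i" "F (4 * i + 1) = G i" "F (4 * i + 2) = U i" "F (4 * i + 3) = V i" for i
  proof -
    have dm: "(4 * i + d) div 4 = i" "(4 * i + d) mod 4 = d" if "d < 4" for d
      using that by simp_all
    show "F (4 * i) = N i" "F (4 * i + 1) = G i" "F (4 * i + 2) = U i" "F (4 * i + 3) = V i"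
      using dm[of 0] dm[of 1] dm[of 2] dm[of 3] unfolding F_def by simp_all
  qed
  moreover have "column_of T c d i = F (4 * i + d)" if "i < m" "d < 4" for i d
  proof -
    have "4 * i + d < 4 * m"
      using that by linarith
    then show ?thesis
      using c(2) unfolding column_of_def by blast
  qed
  from this[of _ 0] this[of _ 1] this[of _ 2] this[of _ 3]
  have "\<forall>i<m. column_of T c 0 i = F (4 * i) \<and> column_of T c 1 i = F (4 * i + 1) \<and>
      column_of T c 2 i = F (4 * i + 2) \<and> column_of T c 3 i = F (4 * i + 3)"
    by simp
  ultimately have "\<forall>i<m. column_of T c 0 i = N i \<and> column_of T c 1 i = G i \<and> column_of T c 2 i = U i \<and> column_of T c 3 i = V i"
    by (simp only:)
  with c(1) show ?thesis
    by blast
qed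

lemma computable_component [computable_intros]:
  assumes "computable Q" "computable p"
  shows "computable (\<lambda>v. component0 (Q v) (p v))" "computable (\<lambda>v. component1 (Q v) (p v))" "computable (\<lambda>v. component2 (Q v) (p v))"
    "computable (\<lambda>v. component3 (Q v) (p v))"
  unfolding component0_def component1_def component2_def component3_def by (intro computable_mod computable_div assms)+

definition gate_str :: "column \<Rightarrow> column \<Rightarrow> column \<Rightarrow> column \<Rightarrow> nat \<Rightarrow> sym list" where
  "gate_str N G U V i = [LPar] @ bin (N i) @ [Comma] @
     (if G i = 0 then bin (U i) else if G i = 1 then [SUnion] else if G i = 2 then [SInter]
      else if G i = 3 then [SCompl] else if G i = 4 then [SPlus] else [SDiv]) @
     [Comma, LPar] @
     (if G i = 0 then [] else if G i = 3 then bin (N (U i))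
      else bin (N (U i)) @ [Comma] @ bin (N (V i))) @ [RPar, RPar]"

lemma enc_gate_of: "enc_gate (gate_of N G U V i) = gate_str N G U V i"
  by (simp add: enc_gate_def gate_of_def gate_str_def op_of_def gname_def glab_def gpreds_def)

definition instance_str :: "nat \<Rightarrow> column \<Rightarrow> column \<Rightarrow> column \<Rightarrow> column \<Rightarrow> nat \<Rightarrow> nat \<Rightarrow> sym list" where
  "instance_str m N G U V k b = [LPar] @ bin (N k) @ [Comma] @
     concat (map (gate_str N G U V) [0..<m]) @ [Comma] @ bin b @ [RPar]"

lemma enc_instance_gate_of:
  "enc_instance (N k, map (gate_of N G U V) [0..<m]) b = instance_str m N G U V k b"
proof -
  have "map enc_gate (map (gate_of N G U V) [0..<m]) = map (gate_str N G U V) [0..<m]"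
    by (simp add: enc_gate_of comp_def)
  then show ?thesis
    by (simp add: enc_instance_def instance_str_def del: map_map)
qed

text \<open>Since \<open>2 ^ length w \<le> x + 1\<close> for \<open>x = nv w\<close>, every number occurring in the string \<open>w\<close>
  is below \<open>T = x + 1\<close>, and the number of gates is at most \<open>length (bin x)\<close>. Hence all gates are
  constant beyond the threshold \<open>2 * T * T\<close>.\<close>

definition accepted :: "nat \<Rightarrow> nat \<Rightarrow> nat \<Rightarrow> nat \<Rightarrow> nat \<Rightarrow> bool" where
  "accepted x m k b c \<longleftrightarrow> k < m \<and>
     valid_columns m (column_of (x + 1) c 0) (column_of (x + 1) c 1) (column_of (x + 1) c 2) (column_of (x + 1) c 3) \<and>
     nv (instance_str m (column_of (x + 1) c 0) (column_of (x + 1) c 1) (column_of (x + 1) c 2) (column_of (x + 1) c 3) k b) = x \<and>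
     (let t = 2 * (x + 1) * (x + 1); B = (t + 1) * (t + 1) * (t + 1) * (t + 1) in
       wins (move m t (column_of (x + 1) c 0) (column_of (x + 1) c 1) (column_of (x + 1) c 2) (column_of (x + 1) c 3))
         B (2 * length (bin x)) (quad (t + 1) k b m 0 mod B))"

text \<open>The environment holds \<open>c\<close>, \<open>b\<close>, \<open>k\<close>, \<open>m\<close>, \<open>x\<close> at indices 0 to 4; capping \<open>m\<close> keeps
  all strings polynomially long in arbitrary environments.\<close>

lemma computable_accepted:
  "computable (\<lambda>v. of_bool (accepted (v 4) (min (v 3) (length (bin (v 4)))) (v 2) (v 1) (v 0)))"
proof -
  let ?m = "\<lambda>v::nat \<Rightarrow> nat. min (v 3) (length (bin (v 4)))"
  let ?T = "\<lambda>v::nat \<Rightarrow> nat. v 4 + 1"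
  let ?f = "\<lambda>v::nat \<Rightarrow> nat. column_of (v 4 + 1) (v 0)"
  let ?t = "\<lambda>v::nat \<Rightarrow> nat. 2 * (v 4 + 1) * (v 4 + 1)"
  let ?B = "\<lambda>v::nat \<Rightarrow> nat. (?t v + 1) * (?t v + 1) * (?t v + 1) * (?t v + 1)"
  have polylog_x: "polylog (\<lambda>v. length (bin (v 4)))"
    by (intro polylog_intros computable_imp_quasipoly computable_var)
  have polylog_m: "polylog ?m"
    by (rule polylog_mono[OF polylog_x]) simp
  have wf: "computable (\<lambda>v. of_bool (valid_columns (?m v) (?f v 0) (?f v 1) (?f v 2) (?f v 3)))"
    unfolding valid_columns_def by (intro computable_intros)
  have str: "string_computable (\<lambda>v. concat (map (gate_str (?f v 0) (?f v 1) (?f v 2) (?f v 3)) [0..<?m v]))"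
  proof (rule string_computable_concat)
    show "string_computable (\<lambda>v. gate_str (column_of (v (Suc 4) + 1) (v (Suc 0)) 0) (column_of (v (Suc 4) + 1) (v (Suc 0)) 1)
       (column_of (v (Suc 4) + 1) (v (Suc 0)) 2) (column_of (v (Suc 4) + 1) (v (Suc 0)) 3) (v 0))"
      unfolding gate_str_def by (intro string_computable_append string_computable_if string_computable_const string_computable_bin computable_intros)
    show "computable ?m"
      by (intro computable_intros)
    \<comment> \<open>A gate contains at most three numbers below \<open>T\<close>, and fewer than
      ten further symbols.\<close>
    show "polylog (\<lambda>v. 3 * (length (bin (?T v)) + 1) + 10)"
      by (intro polylog_intros computable_imp_quasipoly computable_intros)
    show "length (gate_str (?f v 0) (?f v 1) (?f v 2) (?f v 3) i) \<le> 3 * (length (bin (?T v)) + 1) + 10" for v i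
    proof -
      have "length (bin (?f v r j)) \<le> length (bin (?T v)) + 1" for r j
        using column_of_less[of "?T v" "v 0" r j] less_two_power_length_bin[of "?T v"]
        by (intro length_bin_le) simp
      from this[of 0 i] this[of 2 i] this[of 0 "?f v 2 i"] this[of 0 "?f v 3 i"] show ?thesis
        by (auto simp: gate_str_def)
    qed
  qed (rule polylog_m)
  have "string_computable (\<lambda>v. instance_str (?m v) (?f v 0) (?f v 1) (?f v 2) (?f v 3) (v 2) (v 1))"
    unfolding instance_str_def by (intro string_computable_append string_computable_const string_computable_bin str computable_intros)
  then have inst: "computable (\<lambda>v. nv (instance_str (?m v) (?f v 0) (?f v 1) (?f v 2) (?f v 3) (v 2) (v 1)))"
    unfolding string_computable_def by blast
  have mv: "computable (\<lambda>v. of_bool (move (?m (\<lambda>i. v (Suc (Suc i)))) (?t (\<lambda>i. v (Suc (Suc i))))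
      (?f (\<lambda>i. v (Suc (Suc i))) 0) (?f (\<lambda>i. v (Suc (Suc i))) 1) (?f (\<lambda>i. v (Suc (Suc i))) 2)
      (?f (\<lambda>i. v (Suc (Suc i))) 3) (v 0) (v (Suc 0))))"
    unfolding move_def move4_def by (intro computable_intros)
  have win: "computable (\<lambda>v. of_bool (wins (move (?m v) (?t v) (?f v 0) (?f v 1) (?f v 2) (?f v 3)) (?B v)
      (2 * length (bin (v 4))) (quad (?t v + 1) (v 2) (v 1) (?m v) 0 mod ?B v)))"
  proof (rule computable_wins[OF mv])
    show "polylog (\<lambda>v. 2 * length (bin (v 4)))"
      by (intro polylog_mult polylog_const polylog_x)
    show "computable (\<lambda>v. quad (?t v + 1) (v 2) (v 1) (?m v) 0 mod ?B v)"
      unfolding quad_def by (intro computable_mod computable_add computable_mult computable_min computable_length_bin computable_const computable_var)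
    show "quad (?t v + 1) (v 2) (v 1) (?m v) 0 mod ?B v < ?B v" for v
      by (intro mod_less_divisor) simp
  qed (intro computable_add computable_mult computable_length_bin computable_const computable_var)+
  show ?thesis
    unfolding accepted_def Let_def by (intro computable_conj computable_less computable_eq computable_intros wf inst win)
qed

definition decide :: "nat \<Rightarrow> bool" where
  "decide x \<longleftrightarrow> (\<exists>m < length (bin x) + 1. \<exists>k < x + 1. \<exists>b < x + 1. \<exists>c < (x + 1) ^ (4 * length (bin x)).
     accepted x (min m (length (bin x))) k b c)"

lemma computable_decide: "computable (\<lambda>v. of_bool (decide (v 0)))"
proof -
  have A: "computable (\<lambda>v. of_bool (accepted (v (Suc (Suc (Suc (Suc 0))))) (min (v (Suc (Suc (Suc 0))))
      (length (bin (v (Suc (Suc (Suc (Suc 0)))))))) (v (Suc (Suc 0))) (v (Suc 0)) (v 0)))"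
    using computable_accepted by (simp add: eval_nat_numeral)
  have L: "polylog (\<lambda>v. 4 * length (bin (v (Suc (Suc (Suc 0))))))"
    by (intro polylog_intros computable_imp_quasipoly computable_var)
  show ?thesis
    unfolding decide_def by (intro computable_ex computable_add computable_power computable_mult computable_length_bin computable_const computable_var A L)
qed

lemma two_power_length_bin_le_Suc: "2 ^ length (bin x) \<le> 2 * (x + 1)"
  using two_power_length_bin_le[of x] by (cases "x = 0") (simp_all add: bin_small)

lemma accepted_iff:
  fixes x c :: nat
  defines "f \<equiv> column_of (x + 1) c"
  assumes m: "m \<le> length (bin x)" and b: "b < x + 1"
  shows "accepted x m k b c \<longleftrightarrow> k < m \<and> valid_columns m (f 0) (f 1) (f 2) (f 3) \<and>
    nv (enc_instance (f 0 k, map (gate_of (f 0) (f 1) (f 2) (f 3)) [0..<m]) b) = x \<and>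
    b \<in> circuit_sem (f 0 k, map (gate_of (f 0) (f 1) (f 2) (f 3)) [0..<m])"
proof -
  define t where "t = 2 * (x + 1) * (x + 1)"
  define B where "B = (t + 1) * (t + 1) * (t + 1) * (t + 1)"
  have pw: "2 ^ j \<le> 2 * (x + 1)" if "j \<le> length (bin x)" for j
    using that two_power_length_bin_le_Suc[of x] power_increasing[OF that, of "2::nat"] by linarith
  have x_t: "2 * (x + 1) \<le> t"
    by (simp add: t_def)
  have m_t: "m \<le> t"
    using pw[OF m] x_t less_exp[of m] by linarith
  have "wins (move m t (f 0) (f 1) (f 2) (f 3)) B (2 * length (bin x)) (quad (t + 1) k b m 0 mod B)
      \<longleftrightarrow> b \<in> gate_set m (f 0) (f 1) (f 2) (f 3) k"
    if k: "k < m" and wf: "valid_columns m (f 0) (f 1) (f 2) (f 3)"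
  proof -
    have constant_from: "constant_from (gate_set m (f 0) (f 1) (f 2) (f 3) i) t" if "i < m" for i
    proof -
      have "constant_from (gate_set m (f 0) (f 1) (f 2) (f 3) i) ((x + 1) * 2 ^ (m - i))"
        using wf _ that by (rule constant_from_gate_set) (simp add: f_def column_of_less)
      \<comment> \<open>\<open>m\<close> is at most the binary length of \<open>x\<close>, so
        \<open>2 ^ m\<close> is at most \<open>2 * (x + 1)\<close>; this is the origin of
        \<open>t\<close>.\<close>
      moreover have "(x + 1) * 2 ^ (m - i) \<le> (x + 1) * (2 * (x + 1))"
        using pw[of "m - i"] m by (intro mult_le_mono2) simp
      ultimately show ?thesis
        by (rule constant_from_mono[OF _ order_trans]) (simp add: t_def)
    qed
    have small: "k < t + 1" "b < t + 1" "m < t + 1" "0 < t + 1"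
      using k m_t b x_t by auto
    \<comment> \<open>The reduction modulo \<open>B\<close> ensures a legal position in every
      environment, as \<open>computable_wins\<close> requires; for arguments in range it changes
      nothing.\<close>
    have "quad (t + 1) k b m 0 mod B = quad (t + 1) k b m 0"
      using quad_less[OF small] by (simp add: B_def)
    then show ?thesis
      using wins_iff_mem[OF wf m_t _ constant_from, of "quad (t + 1) k b m 0" "2 * length (bin x)"]
        component_quad[OF small] k m x_t by (simp add: B_def)
  qed
  then show ?thesis
    unfolding accepted_def Let_def f_def[symmetric] t_def[symmetric] B_def[symmetric]
      enc_instance_gate_of circuit_sem_def gate_set_def fst_conv snd_conv by blast
qed

lemma MC_if_decide:
  assumes "decide (nv w)"
  shows "w \<in> MC Ops"
proof -
  let ?x = "nv w"
  obtain m k b c where *: "m < length (bin ?x) + 1" "b < ?x + 1"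
      "accepted ?x (min m (length (bin ?x))) k b c"
    using assms unfolding decide_def by blast
  define f where "f = column_of (?x + 1) c"
  define C where "C = (f 0 k, map (gate_of (f 0) (f 1) (f 2) (f 3)) [0..<m])"
  have "min m (length (bin ?x)) = m" "m \<le> length (bin ?x)"
    using *(1) by auto
  then have acc: "k < m" "valid_columns m (f 0) (f 1) (f 2) (f 3)" "nv (enc_instance C b) = ?x" "b \<in> circuit_sem C"
    using *(3) accepted_iff[OF _ *(2), of m k c] unfolding f_def C_def by auto
  moreover have "is_circuit Ops C"
    unfolding C_def using acc(1,2) by (intro is_circuit_gate_of)
  moreover have "enc_instance C b = w"
    using acc(3) nv_inject by blast
  ultimately show ?thesis
    unfolding MC_def by blast
qed

text \<open>Predecessor names are traded for indices. The default \<open>v = 0\<close> keeps the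
  columns bounded where no second predecessor exists.\<close>

lemma gate_cases:
  assumes C: "is_circuit Ops C" and i: "i < length (snd C)"
  shows "\<exists>g u v. g < 6 \<and> (g = 0 \<or> g = 3 \<longrightarrow> v = 0) \<and>
    (g \<noteq> 0 \<longrightarrow> i < u \<and> u < length (snd C) \<and> (g \<noteq> 3 \<longrightarrow> i < v \<and> v < length (snd C))) \<and>
    snd C ! i = (if g = 0 then (gname (snd C ! i), Input u, [])
      else if g = 3 then (gname (snd C ! i), Oper Compl, [gname (snd C ! u)])
      else (gname (snd C ! i), Oper (op_of g), [gname (snd C ! u), gname (snd C ! v)]))"
proof -
  let ?gs = "snd C" let ?nm = "\<lambda>i. gname (?gs ! i)"
  obtain lab ps where g: "?gs ! i = (?nm i, lab, ps)"
    by (cases "?gs ! i") (simp add: gname_def)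
  have ok: "gate_ok Ops lab ps" and
    preds: "\<And>p. p \<in> set ps \<Longrightarrow> \<exists>j. i < j \<and> j < length ?gs \<and> ?nm j = p"
    using C i g unfolding is_circuit_def by (metis fst_conv glab_def gpreds_def snd_conv)+
  show ?thesis
  proof (cases lab)
    case (Input u)
    then show ?thesis
      using ok g by (intro exI[of _ 0] exI[of _ u]) simp
  next
    case (Oper s)
    have bin: ?thesis if n: "n < 6" "n \<noteq> 0" "n \<noteq> 3" "op_of n = s" "length ps = 2" for n
    proof -
      obtain p q where ps: "ps = [p, q]"
        using n(5) by (cases ps; cases "tl ps") auto
      obtain u v where uv: "i < u" "u < length ?gs" "?nm u = p" "i < v" "v < length ?gs" "?nm v = q"
        using preds[of p] preds[of q] ps by auto
      show ?thesis
        by (rule exI[of _ n], rule exI[of _ u], rule exI[of _ v])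
          (use n uv g ps Oper in simp)
    qed
    show ?thesis
    proof (cases s)
      case Union
      then show ?thesis using bin[of 1] ok Oper by (simp add: op_of_def)
    next
      case Inter
      then show ?thesis using bin[of 2] ok Oper by (simp add: op_of_def)
    next
      case Plus
      then show ?thesis using bin[of 4] ok Oper by (simp add: op_of_def)
    next
      case Div
      then show ?thesis using bin[of 5] ok Oper by (simp add: op_of_def)
    next
      case Times
      then show ?thesis using ok Oper by simp
    next
      case Compl
      then obtain p where ps: "ps = [p]"
        using ok Oper by (cases ps; cases "tl ps") auto
      obtain u where u: "i < u" "u < length ?gs" "?nm u = p"
        using preds[of p] ps by auto
      show ?thesis
        by (rule exI[of _ 3], rule exI[of _ u], rule exI[of _ 0])
          (use u g ps Oper Compl in simp)
    qed
  qed
qed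

lemma length_concat_ge:
  assumes "\<And>x. 1 \<le> length (g x)"
  shows "length xs \<le> length (concat (map g xs))"
    and "x \<in> set xs \<Longrightarrow> length (g x) \<le> length (concat (map g xs))"
proof -
  show "length xs \<le> length (concat (map g xs))"
  proof (induction xs)
    case (Cons x xs)
    then show ?case
      using assms[of x] by simp
  qed simp
  show "x \<in> set xs \<Longrightarrow> length (g x) \<le> length (concat (map g xs))"
    by (induction xs) auto
qed

lemma decide_if_MC:
  assumes "w \<in> MC Ops"
  shows "decide (nv w)"
proof -
  obtain C b where w: "w = enc_instance C b" and C: "is_circuit Ops C" and b: "b \<in> circuit_sem C"
    using assms unfolding MC_def by blast
  define gs m x where "gs = snd C" and "m = length gs" and "x = nv w"
  let ?nm = "\<lambda>i. gname (gs ! i)"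
  have T: "2 ^ length w \<le> x + 1"
    unfolding x_def by (rule two_power_length_le_nv)
  have len: "length w = length (bin (fst C)) + length (concat (map enc_gate gs)) + length (bin b) + 4"
    by (simp add: w enc_instance_def gs_def)
  have gate_len: "1 \<le> length (enc_gate g)" for g
    by (simp add: enc_gate_def)
  have m_w: "m < length w"
    using length_concat_ge(1)[of enc_gate gs, OF gate_len] len by (simp add: m_def)
  have gate_w: "length (enc_gate (gs ! i)) \<le> length w" if "i < m" for i
    using length_concat_ge(2)[of enc_gate "gs ! i" gs, OF gate_len] that len by (simp add: m_def)
  have num: "a < x + 1" if "length (bin a) \<le> length w" for a
    using less_two_power_length_bin[of a] power_increasing[OF that, of "2::nat"] T by linarith
  have idx: "a < x + 1" if "a \<le> length w" for a
    using less_exp[of a] power_increasing[OF that, of "2::nat"] T by linarith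
  have "length w < length (bin x) + 1"
  proof -
    have "2 ^ length w \<le> (2::nat) ^ length (bin x)"
      using T less_two_power_length_bin[of x] by linarith
    then show ?thesis
      by (simp add: less_Suc_eq_le)
  qed
  then have m_n: "m \<le> length (bin x)"
    using m_w by linarith
  \<comment> \<open>Packaged as one predicate so that the columns can be chosen simultaneously for
    all gates.\<close>
  define ok where "ok i g u v \<longleftrightarrow> g < 6 \<and> (g = 0 \<or> g = 3 \<longrightarrow> v = 0) \<and>
    (g \<noteq> 0 \<longrightarrow> i < u \<and> u < m \<and> (g \<noteq> 3 \<longrightarrow> i < v \<and> v < m)) \<and>
    gs ! i = (if g = 0 then (?nm i, Input u, []) else if g = 3 then (?nm i, Oper Compl, [?nm u])
      else (?nm i, Oper (op_of g), [?nm u, ?nm v]))" for i g u v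
  have "\<exists>g u v. ok i g u v" if "i < m" for i
    using gate_cases[OF C] that unfolding ok_def gs_def[symmetric] m_def[symmetric] by blast
  then obtain G U V where "\<And>i. i < m \<Longrightarrow> ok i (G i) (U i) (V i)"
    by metis
  note GUV = this[unfolded ok_def]
  have "?nm i < x + 1 \<and> G i < x + 1 \<and> U i < x + 1 \<and> V i < x + 1" if i: "i < m" for i
  proof -
    \<comment> \<open>Four delimiters and at least one bit of \<open>b\<close>: enough for the
      operation codes up to 5 to be below \<open>x + 1\<close>.\<close>
    have 6: "5 \<le> length w"
      using len length_bin_pos[of b] by linarith
    have "?nm i < x + 1"
      using gate_w[OF i] by (intro num) (simp add: enc_gate_def)
    moreover have "G i < x + 1"
      using GUV[OF i] 6 by (intro idx) linarith
    moreover have "V i < x + 1"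
      using GUV[OF i] m_w by (intro idx) linarith
    moreover have "U i < x + 1"
    proof (cases "G i = 0")
      case True
      then have "gs ! i = (?nm i, Input (U i), [])"
        using GUV[OF i] by simp
      then have "glab (gs ! i) = Input (U i)"
        by (metis glab_def fst_conv snd_conv)
      then have "length (bin (U i)) \<le> length (enc_gate (gs ! i))"
        by (simp add: enc_gate_def)
      then show ?thesis
        using gate_w[OF i] by (intro num) simp
    next
      case False
      then show ?thesis
        using GUV[OF i] m_w by (intro idx) linarith
    qed
    ultimately show ?thesis
      by blast
  qed
  then obtain c where c: "c < (x + 1) ^ (4 * m)" and fc: "\<And>i. i < m \<Longrightarrow> column_of (x + 1) c 0 i = ?nm i \<and>
      column_of (x + 1) c 1 i = G i \<and> column_of (x + 1) c 2 i = U i \<and> column_of (x + 1) c 3 i = V i"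
    using column_of_exist[of m ?nm "x + 1" G U V] by auto
  define f where "f = column_of (x + 1) c"
  have f: "f 0 i = ?nm i" "f 1 i = G i" "f 2 i = U i" "f 3 i = V i" if "i < m" for i
    using fc[OF that] by (auto simp: f_def)
  have gates: "map (gate_of (f 0) (f 1) (f 2) (f 3)) [0..<m] = gs"
  proof (rule nth_equalityI)
    fix i
    assume "i < length (map (gate_of (f 0) (f 1) (f 2) (f 3)) [0..<m])"
    then have i: "i < m" by simp
    have "gate_of (f 0) (f 1) (f 2) (f 3) i = gs ! i"
      using GUV[OF i] unfolding gate_of_def f[OF i] by (auto simp: f)
    then show "map (gate_of (f 0) (f 1) (f 2) (f 3)) [0..<m] ! i = gs ! i"
      using i by simp
  qed (simp add: m_def)
  have dist: "distinct (map gname gs)" and "fst C \<in> set (map gname gs)"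
    using C by (auto simp: is_circuit_def gs_def)
  then obtain k where k: "k < m" "fst C = ?nm k"
    by (auto simp: in_set_conv_nth m_def)
  have wf: "valid_columns m (f 0) (f 1) (f 2) (f 3)"
    unfolding valid_columns_def
  proof (intro allI impI conjI)
    fix i j
    assume "i < m" "j < i"
    then have "?nm i \<noteq> ?nm j"
      using dist unfolding distinct_conv_nth by (simp add: m_def)
    then show "f 0 i \<noteq> f 0 j"
      using f(1) \<open>i < m\<close> \<open>j < i\<close> by simp
  qed (use GUV f in auto)
  have Ceq: "C = (f 0 k, map (gate_of (f 0) (f 1) (f 2) (f 3)) [0..<m])"
    using k f(1) gates by (simp add: gs_def prod_eq_iff)
  have bx: "b < x + 1"
    using len by (intro num) simp
  have "accepted x m k b c"
    unfolding accepted_iff[OF m_n bx] f_def[symmetric] Ceq[symmetric]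
    using k wf b w by (simp add: x_def)
  moreover have "k < x + 1"
    using k m_w by (intro idx) simp
  moreover have "c < (x + 1) ^ (4 * length (bin x))"
  proof -
    have "(x + 1) ^ (4 * m) \<le> (x + 1) ^ (4 * length (bin x))"
      using m_n by (intro power_increasing) auto
    then show ?thesis
      using c by linarith
  qed
  ultimately show ?thesis
    unfolding decide_def x_def[symmetric] using m_n bx
    by (intro exI[of _ m] conjI exI[of _ k] exI[of _ b] exI[of _ c]) (simp_all add: min_absorb1)
qed

lemma PSPACE_if_computable:
  assumes "computable (\<lambda>v. of_bool (P (v 0)))" "\<And>w. w \<in> L \<longleftrightarrow> P (nv w)"
  shows "L \<in> PSPACE"
proof -
  obtain c where "computable_within c (\<lambda>v. of_bool (P (v 0)))"
    using assms(1) unfolding computable_def by blast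
  \<comment> \<open>All variables are read from the input register 0; the answer goes to register
    1.\<close>
  from computable_within_prog[OF this, of "\<lambda>i. 0" 1] obtain Q where Q: "runs c Q (\<lambda>v. of_bool (P (v 0))) (\<lambda>i. 0) 1"
    by auto
  show ?thesis
  proof (rule PSPACE_if_com)
    fix w
    let ?s = "(\<lambda>_. 0)(0 := nv w)"
    have "nv w < 2 ^ (4 * length w)"
    proof -
      have "nv w < 12 ^ length w"
        by (rule nv_less)
      also have "\<dots> \<le> (2 ^ 4) ^ length w"
        by (intro power_mono) auto
      finally show ?thesis
        by (simp only: power_mult)
    qed
    then have 1: "exec (2 ^ ((4 * length w + 2) ^ c)) Q ?s (?s(1 := of_bool (P (nv w))))"
      using runsD[OF Q, of ?s "4 * length w"] by simp
    \<comment> \<open>Four bits per base-12 digit; the factor 4 is absorbed by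
      \<open>(length w + 2) ^ 2\<close>.\<close>
    have "(4 * length w + 2) ^ c \<le> ((length w + 2) ^ 3) ^ c"
    proof (rule power_mono)
      have "4 * (length w + 2) \<le> (length w + 2) * (length w + 2) * (length w + 2)"
        using mult_le_mono[of 2 "length w + 2" 2 "length w + 2"] by (intro mult_le_mono1) simp
      then show "4 * length w + 2 \<le> (length w + 2) ^ 3"
        by (simp add: power3_eq_cube)
    qed simp
    also have "\<dots> = (length w + 2) ^ (3 * c)"
      by (simp only: power_mult)
    finally have "(2::nat) ^ ((4 * length w + 2) ^ c) \<le> 2 ^ ((length w + 2) ^ (3 * c))"
      by (intro power_increasing) auto
    with 1 have "exec (2 ^ ((length w + 2) ^ (3 * c))) Q ?s (?s(1 := of_bool (P (nv w))))"
      by (rule exec_mono)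
    then show "\<exists>s'. exec (2 ^ ((length w + 2) ^ (3 * c))) Q ?s s' \<and> (w \<in> L \<longleftrightarrow> s' 1 \<noteq> 0)"
      using assms(2) by (intro exI[of _ "?s(1 := of_bool (P (nv w)))"]) simp
  qed
qed

theorem theorem1:
  shows "MC {Union, Inter, Compl, Plus, Div} \<in> PSPACE"
  using computable_decide by (rule PSPACE_if_computable) (blast intro: MC_if_decide decide_if_MC)

end
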